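(* Let $\alpha\in\mathbb{Z}^m$ and $i\in I$. The set $\rho_{\mathbf{Q}}^{-1}(\Gamma(\alpha)/\equiv_i)$ is a basis for the Riemann-Roch space $\mathcal{L}(\alpha)$. In particular, the ring $R_{\mathbf{Q}}$ of functions of $\mathcal{X}$ that are regular outside $Q_1,\ldots,Q_m$ is spanned by $\rho_{\mathbf{Q}}^{-1}(\Gamma(\mathbf{Q}))$ as an infinite-dimensional $\mathbb{F}$-vector space.
   Context: Let $\mathbb{F}$ be a finite field and $\mathcal{X}$ a projective, non-singular, geometrically irreducible algebraic curve over $\mathbb{F}$ with function field $\mathbb{F}(\mathcal{X})$. Let $m\geq 2$ and let $\mathbf{Q}=(Q_1,\ldots,Q_m)$ be an $m$-tuple of pairwise distinct $\mathbb{F}$-rational points of $\mathcal{X}$. Standing assumption: $\#\mathbb{F}\geq m$. Put $I=\{1,\ldots,m\}$. Let $R_{\mathbf{Q}}$ be the ring of functions of $\mathcal{X}$ that are regular outside $\{Q_1,\ldots,Q_m\}$. For $f\in R_{\mathbf{Q}}\setminus\{0\}$ put $\rho_{\mathbf{Q}}(f)=(-v_{Q_1}(f),\ldots,-v_{Q_m}(f))\in\mathbb{Z}^m$, where $v_{Q_i}$ is the valuation at $Q_i$. The generalized Weierstrass semigroup is $\widehat{H}(\mathbf{Q})=\{\rho_{\mathbf{Q}}(f): f\in R_{\mathbf{Q}}\setminus\{0\}\}\subseteq\mathbb{Z}^m$. For $\alpha\in\mathbb{Z}^m$, $\mathcal{L}(\alpha)$ is the Riemann-Roch space of the divisor $\sum_{i=1}^m\alpha_iQ_i$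 and $\ell(\alpha)$ is its $\mathbb{F}$-dimension. For $\alpha\in\mathbb{Z}^m$ and a non-empty $J\subsetneq I$, set $\nabla_J(\alpha)=\{\beta\in\widehat{H}(\mathbf{Q}): \beta_j=\alpha_j\ \forall j\in J,\ \beta_i<\alpha_i\ \forall i\in I\setminus J\}$. An element $\alpha\in\widehat{H}(\mathbf{Q})$ is absolute maximal if $\nabla_J(\alpha)=\emptyset$ for every non-empty $J\subsetneq I$; $\Gamma(\mathbf{Q})$ is the set of absolute maximal elements. For $\alpha\in\mathbb{Z}^m$, $\Gamma(\alpha)=\{\beta\in\Gamma(\mathbf{Q}):\beta\leq\alpha\}$, where $\leq$ is the coordinatewise partial order. For $i\in I$, $\equiv_i$ is the equivalence relation on $\Gamma(\alpha)$ given by $\beta\equiv_i\beta'$ iff $\beta_i=\beta'_i$. The set $\Gamma(\alpha)/\equiv_i$ of equivalence classes has exactly $\ell(\alpha)$ elements; choose representatives, $\Gamma(\alpha)/\equiv_i\,=\{[\beta^1]_i,\ldots,[\beta^{\ell(\alpha)}]_i\}$, and for each $j$ choose a function $f_j\in R_{\mathbf{Q}}\setminus\{0\}$ with $\rho_{\mathbf{Q}}(f_j)=\beta^j$. By abuse of notation, $\rho_{\mathbf{Q}}^{-1}(\Gamma(\alpha)/\equiv_i)$ denotes the set $\{f_1,\ldots,f_{\ell(\alpha)}\}$ for any such choice. $\rho_{\mathbf{Q}}^{-1}(\Gamma(\mathbf{Q}))$ denotes the set of $f\in R_{\mathbf{Q}}\setminus\{0\}$ with $\rho_{\mathbf{Q}}(f)\in\Gamma(\mathbf{Q})$.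 *)

theory Defs
  imports
    "HOL-Library.Poly_Mapping"
    "HOL-Library.Cardinality"
    "HOL-Algebra.Algebraic_Closure_Type"
begin

section \<open>Projective algebraic sets\<close>

text \<open>
  The homogeneous coordinates are indexed by a finite type \<open>'n\<close>, so the ambient space is the
  projective space of dimension \<open>CARD('n) - 1\<close>.  A geometric point is a point over the algebraic
  closure of the ground field, and is represented by the set of all its homogeneous coordinate
  vectors.
\<close>

type_synonym ('n, 'b) mpoly = "('n \<Rightarrow>\<^sub>0 nat) \<Rightarrow>\<^sub>0 'b"
type_synonym ('n, 'a) point = "('n \<Rightarrow> 'a alg_closure) set"

definition mpoly_eval ::
    "('b::zero \<Rightarrow> 'c::comm_semiring_1) \<Rightarrow> ('n::finite, 'b) mpoly \<Rightarrow> ('n \<Rightarrow> 'c) \<Rightarrow> 'c" where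
  "mpoly_eval h G x =
     (\<Sum>\<mu>\<in>Poly_Mapping.keys G. h (Poly_Mapping.lookup G \<mu>) * (\<Prod>j\<in>UNIV. x j ^ Poly_Mapping.lookup \<mu> j))"

definition homogeneous :: "nat \<Rightarrow> ('n::finite, 'b::zero) mpoly \<Rightarrow> bool" where
  "homogeneous d G \<longleftrightarrow> (\<forall>\<mu>\<in>Poly_Mapping.keys G. (\<Sum>j\<in>UNIV. Poly_Mapping.lookup \<mu> j) = d)"

definition proj_point :: "('n \<Rightarrow> 'a::field alg_closure) \<Rightarrow> ('n, 'a) point" where
  "proj_point x = {(\<lambda>j. c * x j) | c. c \<noteq> 0}"

definition proj_space :: "('n, 'a::field) point set" where
  "proj_space = {proj_point x | x. x \<noteq> (\<lambda>_. 0)}"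

definition rational_point :: "('n, 'a::field) point \<Rightarrow> bool" where
  "rational_point P \<longleftrightarrow> (\<exists>x. x \<noteq> (\<lambda>_. 0) \<and> P = proj_point (\<lambda>j. to_ac (x j)))"

definition vanishes_at ::
    "('b::zero \<Rightarrow> 'a alg_closure) \<Rightarrow> ('n::finite, 'b) mpoly \<Rightarrow> ('n, 'a::field) point \<Rightarrow> bool" where
  "vanishes_at h G P \<longleftrightarrow> (\<forall>x\<in>P. mpoly_eval h G x = 0)"

text \<open>
  The coefficient map is \<^const>\<open>to_ac\<close> for forms over the ground field, and the identity for
  forms over its algebraic closure.
\<close>

definition proj_algebraic_set ::
    "('b::zero \<Rightarrow> 'a alg_closure) \<Rightarrow> ('n::finite, 'a::field) point set \<Rightarrow> bool" where
  "proj_algebraic_set h Z \<longleftrightarrow>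
     (\<exists>S. (\<forall>G\<in>S. \<exists>d. homogeneous d G) \<and> Z = {P \<in> proj_space. \<forall>G\<in>S. vanishes_at h G P})"

definition geometrically_irreducible :: "('n::finite, 'a::field) point set \<Rightarrow> bool" where
  "geometrically_irreducible \<C> \<longleftrightarrow>
     \<C> \<noteq> {} \<and>
     (\<forall>Z1 Z2. proj_algebraic_set id Z1 \<and> proj_algebraic_set id Z2 \<and> \<C> \<subseteq> Z1 \<union> Z2
        \<longrightarrow> \<C> \<subseteq> Z1 \<or> \<C> \<subseteq> Z2)"


section \<open>Function field and local rings\<close>

text \<open>
  The function field of \<open>\<C>\<close> consists of the fractions \<open>G / H\<close> of forms of equal degree over the
  ground field, with \<open>H\<close> not vanishing identically on \<open>\<C>\<close>, where \<open>G / H = G' / H'\<close> iff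
  \<open>G H' - G' H\<close> vanishes on \<open>\<C>\<close>.  It is presented as a field \<open>'k\<close> with an embedding \<open>\<iota>\<close> of the
  ground field and a vector \<open>\<xi>\<close> of homogeneous coordinates of the generic point of \<open>\<C>\<close>; the
  isomorphism sends \<open>G / H\<close> to \<open>G(\<xi>) / H(\<xi>)\<close>.
\<close>

definition function_field ::
    "('n::finite, 'a::field) point set \<Rightarrow> ('a \<Rightarrow> 'k::field) \<Rightarrow> ('n \<Rightarrow> 'k) \<Rightarrow> bool" where
  "function_field \<C> \<iota> \<xi> \<longleftrightarrow>
     \<iota> 1 = 1 \<and> (\<forall>a b. \<iota> (a + b) = \<iota> a + \<iota> b) \<and> (\<forall>a b. \<iota> (a * b) = \<iota> a * \<iota> b) \<and>
     (\<forall>d G. homogeneous d G \<longrightarrow> (mpoly_eval \<iota> G \<xi> = 0 \<longleftrightarrow> (\<forall>P\<in>\<C>. vanishes_at to_ac G P))) \<and>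
     (\<forall>f. \<exists>d G H. homogeneous d G \<and> homogeneous d H \<and> mpoly_eval \<iota> H \<xi> \<noteq> 0 \<and>
            f = mpoly_eval \<iota> G \<xi> / mpoly_eval \<iota> H \<xi>)"

definition algebraic_over :: "'k::field set \<Rightarrow> 'k \<Rightarrow> bool" where
  "algebraic_over S x \<longleftrightarrow> (\<exists>p. p \<noteq> 0 \<and> (\<forall>i. poly.coeff p i \<in> S) \<and> poly p x = 0)"

definition simple_extension :: "'k::field set \<Rightarrow> 'k \<Rightarrow> 'k set" where
  "simple_extension S t =
     {poly p t / poly q t | p q.
        (\<forall>i. poly.coeff p i \<in> S) \<and> (\<forall>i. poly.coeff q i \<in> S) \<and> poly q t \<noteq> 0}"

definition transcendence_degree_one :: "('a::field \<Rightarrow> 'k::field) \<Rightarrow> bool" where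
  "transcendence_degree_one \<iota> \<longleftrightarrow>
     (\<exists>t. \<not> algebraic_over (range \<iota>) t \<and> (\<forall>f. algebraic_over (simple_extension (range \<iota>) t) f))"

text \<open>
  The functions regular at \<open>P\<close>, and those vanishing at \<open>P\<close>.  Both depend only on the closed point
  below \<open>P\<close>, that is, on the orbit of \<open>P\<close> under the Galois group.
\<close>

definition local_ring :: "('a::field \<Rightarrow> 'k::field) \<Rightarrow> ('n::finite \<Rightarrow> 'k) \<Rightarrow> ('n, 'a) point \<Rightarrow> 'k set" where
  "local_ring \<iota> \<xi> P =
     {mpoly_eval \<iota> G \<xi> / mpoly_eval \<iota> H \<xi> | G H.
        (\<exists>d. homogeneous d G \<and> homogeneous d H) \<and> \<not> vanishes_at to_ac H P}"

definition maximal_ideal_at :: "('a::field \<Rightarrow> 'k::field) \<Rightarrow> ('n::finite \<Rightarrow> 'k) \<Rightarrow> ('n, 'a) point \<Rightarrow> 'k set" where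
  "maximal_ideal_at \<iota> \<xi> P =
     {mpoly_eval \<iota> G \<xi> / mpoly_eval \<iota> H \<xi> | G H.
        (\<exists>d. homogeneous d G \<and> homogeneous d H) \<and> vanishes_at to_ac G P \<and> \<not> vanishes_at to_ac H P}"

definition uniformizer ::
    "('a::field \<Rightarrow> 'k::field) \<Rightarrow> ('n::finite \<Rightarrow> 'k) \<Rightarrow> ('n, 'a) point \<Rightarrow> 'k \<Rightarrow> bool" where
  "uniformizer \<iota> \<xi> P t \<longleftrightarrow>
     t \<in> local_ring \<iota> \<xi> P \<and> maximal_ideal_at \<iota> \<xi> P = {t * g | g. g \<in> local_ring \<iota> \<xi> P}"

text \<open>
  Non-singularity means that all local rings are regular.  The local rings at the points of a
  curve have dimension one, so this says that their maximal ideals are generated by one element.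
\<close>

definition nonsingular_projective_curve ::
    "('n::finite, 'a::field) point set \<Rightarrow> ('a \<Rightarrow> 'k::field) \<Rightarrow> ('n \<Rightarrow> 'k) \<Rightarrow> bool" where
  "nonsingular_projective_curve \<C> \<iota> \<xi> \<longleftrightarrow>
     proj_algebraic_set (to_ac :: 'a \<Rightarrow> 'a alg_closure) \<C> \<and>
     geometrically_irreducible \<C> \<and>
     function_field \<C> \<iota> \<xi> \<and>
     transcendence_degree_one \<iota> \<and>
     (\<forall>P\<in>\<C>. \<exists>t. uniformizer \<iota> \<xi> P t)"

text \<open>Meaningful for non-zero \<open>f\<close> only; the value does not depend on the uniformizer.\<close>

definition valuation ::
    "('a::field \<Rightarrow> 'k::field) \<Rightarrow> ('n::finite \<Rightarrow> 'k) \<Rightarrow> ('n, 'a) point \<Rightarrow> 'k \<Rightarrow> int" where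
  "valuation \<iota> \<xi> P f =
     (THE k. \<exists>t u. uniformizer \<iota> \<xi> P t \<and> u \<in> local_ring \<iota> \<xi> P - maximal_ideal_at \<iota> \<xi> P \<and>
                   f = t powi k * u)"


section \<open>Riemann-Roch spaces\<close>

text \<open>The function field as a vector space over the ground field.\<close>

definition scale :: "('a::field \<Rightarrow> 'k::field) \<Rightarrow> 'a \<Rightarrow> 'k \<Rightarrow> 'k" where
  "scale \<iota> c f = \<iota> c * f"

definition basis_of :: "('a::field \<Rightarrow> 'k::field) \<Rightarrow> 'k set \<Rightarrow> 'k set \<Rightarrow> bool" where
  "basis_of \<iota> B V \<longleftrightarrow> \<not> module.dependent (scale \<iota>) B \<and> module.span (scale \<iota>) B = V"

text \<open>The divisor \<open>\<Sum>i. \<alpha> i Q i\<close>, as the function giving its coefficient at each point.\<close>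

definition divisor ::
    "('m::finite \<Rightarrow> ('n, 'a::field) point) \<Rightarrow> ('m \<Rightarrow> int) \<Rightarrow> ('n, 'a) point \<Rightarrow> int" where
  "divisor Q \<alpha> P = (\<Sum>i | Q i = P. \<alpha> i)"

definition riemann_roch_space ::
    "('n::finite, 'a::field) point set \<Rightarrow> ('a \<Rightarrow> 'k::field) \<Rightarrow> ('n \<Rightarrow> 'k) \<Rightarrow>
     (('n, 'a) point \<Rightarrow> int) \<Rightarrow> 'k set" where
  "riemann_roch_space \<C> \<iota> \<xi> D =
     {f. f = 0 \<or> (\<forall>P\<in>\<C>. valuation \<iota> \<xi> P f + D P \<ge> 0)}"


section \<open>Generalized Weierstrass semigroups\<close>

definition regular_functions ::
    "('n::finite, 'a::field) point set \<Rightarrow> ('a \<Rightarrow> 'k::field) \<Rightarrow> ('n \<Rightarrow> 'k) \<Rightarrow>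
     ('m \<Rightarrow> ('n, 'a) point) \<Rightarrow> 'k set" where
  "regular_functions \<C> \<iota> \<xi> Q = {f. \<forall>P \<in> \<C> - range Q. f \<in> local_ring \<iota> \<xi> P}"

definition rho ::
    "('a::field \<Rightarrow> 'k::field) \<Rightarrow> ('n::finite \<Rightarrow> 'k) \<Rightarrow> ('m \<Rightarrow> ('n, 'a) point) \<Rightarrow> 'k \<Rightarrow> 'm \<Rightarrow> int" where
  "rho \<iota> \<xi> Q f = (\<lambda>i. - valuation \<iota> \<xi> (Q i) f)"

definition generalized_semigroup ::
    "('n::finite, 'a::field) point set \<Rightarrow> ('a \<Rightarrow> 'k::field) \<Rightarrow> ('n \<Rightarrow> 'k) \<Rightarrow>
     ('m \<Rightarrow> ('n, 'a) point) \<Rightarrow> ('m \<Rightarrow> int) set" where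
  "generalized_semigroup \<C> \<iota> \<xi> Q = rho \<iota> \<xi> Q ` (regular_functions \<C> \<iota> \<xi> Q - {0})"

definition nabla :: "('m \<Rightarrow> int) set \<Rightarrow> 'm set \<Rightarrow> ('m \<Rightarrow> int) \<Rightarrow> ('m \<Rightarrow> int) set" where
  "nabla H J \<alpha> = {\<beta> \<in> H. (\<forall>j\<in>J. \<beta> j = \<alpha> j) \<and> (\<forall>i\<in>-J. \<beta> i < \<alpha> i)}"

definition absolute_maximal :: "('m \<Rightarrow> int) set \<Rightarrow> ('m \<Rightarrow> int) set" where
  "absolute_maximal H = {\<alpha> \<in> H. \<forall>J. J \<noteq> {} \<and> J \<noteq> UNIV \<longrightarrow> nabla H J \<alpha> = {}}"

definition Gamma ::
    "('n::finite, 'a::field) point set \<Rightarrow> ('a \<Rightarrow> 'k::field) \<Rightarrow> ('n \<Rightarrow> 'k) \<Rightarrow>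
     ('m \<Rightarrow> ('n, 'a) point) \<Rightarrow> ('m \<Rightarrow> int) set" where
  "Gamma \<C> \<iota> \<xi> Q = absolute_maximal (generalized_semigroup \<C> \<iota> \<xi> Q)"

definition Gamma_classes ::
    "('n::finite, 'a::field) point set \<Rightarrow> ('a \<Rightarrow> 'k::field) \<Rightarrow> ('n \<Rightarrow> 'k) \<Rightarrow>
     ('m \<Rightarrow> ('n, 'a) point) \<Rightarrow> ('m \<Rightarrow> int) \<Rightarrow> 'm \<Rightarrow> ('m \<Rightarrow> int) set set" where
  "Gamma_classes \<C> \<iota> \<xi> Q \<alpha> i =
     (let \<Gamma>\<alpha> = {\<beta> \<in> Gamma \<C> \<iota> \<xi> Q. \<beta> \<le> \<alpha>}
      in \<Gamma>\<alpha> // {(\<beta>, \<beta>'). \<beta> \<in> \<Gamma>\<alpha> \<and> \<beta>' \<in> \<Gamma>\<alpha> \<and> \<beta> i = \<beta>' i})"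

text \<open>
  \<open>B\<close> arises by choosing, for every equivalence class, one function whose image under
  \<^const>\<open>rho\<close> is a representative of that class.
\<close>

definition class_preimage ::
    "('n::finite, 'a::field) point set \<Rightarrow> ('a \<Rightarrow> 'k::field) \<Rightarrow> ('n \<Rightarrow> 'k) \<Rightarrow>
     ('m \<Rightarrow> ('n, 'a) point) \<Rightarrow> ('m \<Rightarrow> int) \<Rightarrow> 'm \<Rightarrow> 'k set \<Rightarrow> bool" where
  "class_preimage \<C> \<iota> \<xi> Q \<alpha> i B \<longleftrightarrow>
     (\<exists>\<phi>. (\<forall>C \<in> Gamma_classes \<C> \<iota> \<xi> Q \<alpha> i.
              \<phi> C \<in> regular_functions \<C> \<iota> \<xi> Q - {0} \<and> rho \<iota> \<xi> Q (\<phi> C) \<in> C) \<and>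
          B = \<phi> ` Gamma_classes \<C> \<iota> \<xi> Q \<alpha> i)"

end

theory Submission
  imports Defs
begin

text \<open>
  Write \<open>k\<close> for the ground field, \<open>K\<close> for the function field, \<open>R\<close> for the ring of functions that are
  regular outside the points \<open>Q\<^sub>i\<close>, and \<open>\<rho> f\<close> for the vector of pole orders of \<open>f\<close> at these points.

  Fix \<open>i\<close>.  Since \<open>Q\<^sub>i\<close> is rational, two functions with the same pole order at \<open>Q\<^sub>i\<close> have proportional
  leading terms there, so subtracting a multiple of one from the other lowers the order.  Hence a
  subset of \<open>L(\<alpha>)\<close> whose members have pairwise distinct orders at \<open>Q\<^sub>i\<close>, and which realises every
  order that occurs in \<open>L(\<alpha>)\<close>, is a basis of \<open>L(\<alpha>)\<close> (lemma \<open>basis_of_L\<close>).  It remains to see that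
  every order \<open>n\<close> that occurs at \<open>Q\<^sub>i\<close> is a coordinate of an absolute maximal element \<open>\<beta> \<le> \<alpha>\<close>.  Take
  \<open>g\<close> in \<open>L(\<alpha>)\<close> of order \<open>n\<close> at \<open>Q\<^sub>i\<close> for which the sum of the coordinates of \<open>\<rho> g\<close> is least.  If some
  \<open>\<rho> h\<close> belonged to \<open>\<nabla>\<^sub>J(\<rho> g)\<close>, then \<open>h\<close> itself (if \<open>i \<in> J\<close>), or \<open>g - c h\<close> with the leading terms
  cancelled at a point of \<open>J\<close> (if \<open>i \<notin> J\<close>), would have a smaller sum
  (lemma \<open>absolute_maximal_with_coordinate\<close>).  As \<open>R\<close> is the union of the spaces \<open>L(\<alpha>)\<close>, it is spanned
  by functions with absolute maximal pole orders.

  This argument rests on two facts about curves.  The spaces \<open>L(\<alpha>)\<close> are finite, because lowering one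
  coordinate of \<open>\<alpha>\<close> costs at most one dimension and a function without poles has no zeros
  (lemma \<open>no_zeros_without_poles\<close>).  If \<open>f\<close> had a zero, the homomorphism on \<open>k[1/f]\<close> that sends \<open>1/f\<close>
  to \<open>0\<close> would extend to a place of \<open>K\<close> with values in the algebraic closure of \<open>k\<close>; the place has a
  centre on the projective curve, and \<open>f\<close> has a pole there (lemmas \<open>valuation_ring\<close> and
  \<open>center_of_place\<close>).

  The second fact is that \<open>R\<close> is infinite (theorem \<open>infinite_regular_outside_point\<close>).  It is a
  counting version of Riemann's inequality.  Choose \<open>s\<close> with a simple zero at \<open>Q = Q\<^sub>i\<close>, put \<open>y = 1/s\<close>,
  and let \<open>d\<close> be the degree of \<open>K\<close> over \<open>k(y)\<close>.  Functions with poles of order at most \<open>N\<close> times that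
  of \<open>y\<close> are abundant: \<open>k[y]\<close>-combinations of \<open>d\<close> independent elements give about \<open>d N\<close> free
  coefficients.  Let \<open>M\<close> be the ring of functions that are regular at the poles of \<open>y\<close> other than \<open>Q\<close>.
  The quotient \<open>M / s M\<close> has dimension at most \<open>d - 1\<close>: a dimension \<open>d\<close> would bound the pole orders at
  \<open>Q\<close> of all elements of \<open>M\<close>, while weak approximation provides an element of \<open>M\<close> with a pole at \<open>Q\<close>.
  So regularity at the other poles imposes at most \<open>(d - 1) N + O(1)\<close> conditions, and about \<open>N\<close> free
  coefficients remain.  Since \<open>k\<close> is finite, dimensions are compared by counting elements.

  The degree of \<open>K\<close> over \<open>k(y)\<close> is controlled in the form of a bound on the number of elements that
  are independent over \<open>k[y]\<close>.  The bound follows from the linear growth of the spaces of forms of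
  degree \<open>N\<close> restricted to the curve (lemma \<open>card_forms_linear\<close>), which is where transcendence degree
  one enters.  It also shows that a local ring with principal maximal ideal \<open>(t)\<close> is a discrete
  valuation ring: every non-zero \<open>f\<close> is algebraically dependent on \<open>t\<close>, and therefore divides a power
  of \<open>t\<close> (lemma \<open>divides_power_of_t\<close>).
\<close>

section \<open>Discrete valuations of a field over its constants\<close>

text \<open>
  Linear dependence of \<open>u 0, \<dots>, u (n - 1)\<close> over the ring \<open>k[y]\<close>.  The coefficients are given as a
  rectangular array over \<open>k\<close>, so that passing from \<open>y\<close> to \<open>1/y\<close> just reverses the columns and
  families of coefficients can be counted.
\<close>

definition poly_dep :: "('a::field \<Rightarrow> 'k::field) \<Rightarrow> 'k \<Rightarrow> (nat \<Rightarrow> 'k) \<Rightarrow> nat \<Rightarrow> bool" where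
  "poly_dep \<iota> y u n \<longleftrightarrow> (\<exists>N c. (\<exists>i<n. \<exists>j\<le>N. c i j \<noteq> 0) \<and>
     (\<Sum>i<n. \<Sum>j\<le>N. \<iota> (c i j) * y ^ j * u i) = 0)"

text \<open>
  The fractional ideal of order \<open>n\<close>.  Zero is treated separately, as an integer-valued function
  cannot give it the value infinity.
\<close>

definition val_ge :: "('k::field \<Rightarrow> int) \<Rightarrow> int \<Rightarrow> 'k set" where
  "val_ge w n = {f. f = 0 \<or> w f \<ge> n}"

locale field_hom =
  fixes \<iota> :: "'a::field \<Rightarrow> 'k::field"
  assumes hom_one: "\<iota> 1 = 1"
    and hom_add: "\<iota> (a + b) = \<iota> a + \<iota> b"
    and hom_mult: "\<iota> (a * b) = \<iota> a * \<iota> b"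
begin

lemma hom_zero [simp]: "\<iota> 0 = 0"
  using hom_add[of 0 0] by (metis add_cancel_right_right add_0)

lemma hom_uminus: "\<iota> (- a) = - \<iota> a"
  using hom_add[of a "- a"] by (simp add: eq_neg_iff_add_eq_0 add.commute)

lemma hom_diff: "\<iota> (a - b) = \<iota> a - \<iota> b"
  using hom_add[of a "- b"] by (simp add: hom_uminus)

lemma hom_eq_0_iff [simp]: "\<iota> a = 0 \<longleftrightarrow> a = 0"
proof
  assume "\<iota> a = 0"
  show "a = 0"
  proof (rule ccontr)
    assume "a \<noteq> 0"
    hence "1 = \<iota> a * \<iota> (inverse a)" by (simp add: hom_one flip: hom_mult)
    with \<open>\<iota> a = 0\<close> show False by simp
  qed
qed simp

lemma hom_inverse: "\<iota> (inverse a) = inverse (\<iota> a)"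
proof (cases "a = 0")
  case False
  hence "\<iota> a * \<iota> (inverse a) = 1" by (simp add: hom_one flip: hom_mult)
  thus ?thesis by (metis inverse_unique)
qed simp

lemma hom_divide: "\<iota> (a / b) = \<iota> a / \<iota> b"
  by (simp add: divide_inverse hom_mult hom_inverse)

text \<open>
  Dividing by the largest power of \<open>y\<close> that divides all coefficients keeps some coefficient non-zero
  at \<open>y = 0\<close>.  This makes it possible to reduce a relation modulo \<open>y\<close>.
\<close>

lemma poly_dep_reduced:
  assumes "poly_dep \<iota> y u n" "y \<noteq> 0"
  obtains N c i where "i < n" "c i 0 \<noteq> 0"
    "(\<Sum>i<n. \<Sum>j\<le>N. \<iota> (c i j) * y ^ j * u i) = 0"
proof -
  from assms obtain N c where c: "\<exists>i<n. \<exists>j\<le>N. c i j \<noteq> 0"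
    and sum0: "(\<Sum>i<n. \<Sum>j\<le>N. \<iota> (c i j) * y ^ j * u i) = 0"
    unfolding poly_dep_def by blast
  let ?P = "\<lambda>j. j \<le> N \<and> (\<exists>i<n. c i j \<noteq> 0)"
  define j0 where "j0 = (LEAST j. ?P j)"
  from c obtain j where "?P j" by blast
  hence P0: "?P j0" unfolding j0_def by (rule LeastI)
  have low: "c i j = 0" if "i < n" "j < j0" for i j
    using not_less_Least[of j ?P] that P0 unfolding j0_def[symmetric] by auto
  obtain i where i: "i < n" "c i j0 \<noteq> 0" using P0 by blast
  have "(\<Sum>j\<le>N. \<iota> (c i j) * y ^ j * u i) = y ^ j0 * (\<Sum>j\<le>N - j0. \<iota> (c i (j + j0)) * y ^ j * u i)"
    if "i < n" for i
  proof -
    have "(\<Sum>j\<le>N. \<iota> (c i j) * y ^ j * u i) = (\<Sum>j\<in>{j0..N}. \<iota> (c i j) * y ^ j * u i)"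
      by (rule sum.mono_neutral_right) (use low[OF that] in auto)
    also have "\<dots> = (\<Sum>j\<le>N - j0. \<iota> (c i (j + j0)) * y ^ (j + j0) * u i)"
      by (rule sum.reindex_bij_witness[of _ "\<lambda>j. j + j0" "\<lambda>j. j - j0"]) (use P0 in auto)
    finally show ?thesis by (simp add: sum_distrib_left power_add algebra_simps)
  qed
  hence "y ^ j0 * (\<Sum>i<n. \<Sum>j\<le>N - j0. \<iota> (c i (j + j0)) * y ^ j * u i) = 0"
    using sum0 by (simp add: sum_distrib_left)
  hence "(\<Sum>i<n. \<Sum>j\<le>N - j0. \<iota> (c i (j + j0)) * y ^ j * u i) = 0"
    using assms by simp
  with i show ?thesis by (intro that[of i "\<lambda>i j. c i (j + j0)" "N - j0"]) auto
qed

lemma poly_dep_inverse: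
  assumes "poly_dep \<iota> y u n" "y \<noteq> 0"
  shows "poly_dep \<iota> (inverse y) u n"
proof -
  from assms obtain N c where c: "\<exists>i<n. \<exists>j\<le>N. c i j \<noteq> 0"
    and sum0: "(\<Sum>i<n. \<Sum>j\<le>N. \<iota> (c i j) * y ^ j * u i) = 0"
    unfolding poly_dep_def by blast
  have *: "(\<Sum>j\<le>N. \<iota> (c i (N - j)) * inverse y ^ j * u i)
      = inverse y ^ N * (\<Sum>j\<le>N. \<iota> (c i j) * y ^ j * u i)" for i
  proof -
    have "(\<Sum>j\<le>N. \<iota> (c i (N - j)) * inverse y ^ j * u i)
       = (\<Sum>j\<le>N. \<iota> (c i j) * inverse y ^ (N - j) * u i)"
      by (rule sum.reindex_bij_witness[of _ "\<lambda>j. N - j" "\<lambda>j. N - j"]) auto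
    also have "\<dots> = (\<Sum>j\<le>N. inverse y ^ N * (\<iota> (c i j) * y ^ j * u i))"
    proof (rule sum.cong)
      fix j assume "j \<in> {..N}"
      hence "inverse y ^ N * y ^ j = inverse y ^ (N - j)"
        using assms(2) by (simp add: field_simps flip: power_add)
      thus "\<iota> (c i j) * inverse y ^ (N - j) * u i = inverse y ^ N * (\<iota> (c i j) * y ^ j * u i)"
        by (metis mult.assoc mult.left_commute)
    qed simp
    finally show ?thesis by (simp add: sum_distrib_left)
  qed
  have "(\<Sum>i<n. \<Sum>j\<le>N. \<iota> (c i (N - j)) * inverse y ^ j * u i) = 0"
    unfolding * using sum0 by (simp flip: sum_distrib_left)
  moreover from c obtain i j where "i < n" "j \<le> N" "c i j \<noteq> 0" by blast
  hence "\<exists>i<n. \<exists>j\<le>N. c i (N - j) \<noteq> 0"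
    by (intro exI[of _ i] conjI exI[of _ "N - j"]) auto
  ultimately show ?thesis unfolding poly_dep_def
    by (intro exI[of _ N] exI[of _ "\<lambda>i j. c i (N - j)"]) simp
qed

lemma poly_dep_mono:
  assumes "poly_dep \<iota> y u m" "m \<le> n"
  shows "poly_dep \<iota> y u n"
proof -
  from assms obtain N c where c: "\<exists>i<m. \<exists>j\<le>N. c i j \<noteq> 0"
    and sum0: "(\<Sum>i<m. \<Sum>j\<le>N. \<iota> (c i j) * y ^ j * u i) = 0"
    unfolding poly_dep_def by blast
  have "(\<Sum>i<n. \<Sum>j\<le>N. \<iota> (if i < m then c i j else 0) * y ^ j * u i)
      = (\<Sum>i<m. \<Sum>j\<le>N. \<iota> (if i < m then c i j else 0) * y ^ j * u i)"
    by (rule sum.mono_neutral_right) (use assms in auto)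
  also have "\<dots> = 0" using sum0 by simp
  finally show ?thesis unfolding poly_dep_def using c assms(2)
    by (intro exI[of _ N] exI[of _ "\<lambda>i j. if i < m then c i j else 0"]) (auto intro: less_le_trans)
qed

end

locale discrete_valuation = field_hom \<iota> for \<iota> :: "'a::field \<Rightarrow> 'k::field" +
  fixes w :: "'k \<Rightarrow> int"
  assumes val_mult: "x \<noteq> 0 \<Longrightarrow> y \<noteq> 0 \<Longrightarrow> w (x * y) = w x + w y"
    and val_add: "x \<noteq> 0 \<Longrightarrow> y \<noteq> 0 \<Longrightarrow> x + y \<noteq> 0 \<Longrightarrow> min (w x) (w y) \<le> w (x + y)"
    and val_surj: "\<exists>t. t \<noteq> 0 \<and> w t = 1"
    and val_const: "c \<noteq> 0 \<Longrightarrow> w (\<iota> c) = 0"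
begin

lemma val_one [simp]: "w 1 = 0"
  using val_mult[of 1 1] by simp

lemma val_inverse: "x \<noteq> 0 \<Longrightarrow> w (inverse x) = - w x"
  using val_mult[of x "inverse x"] by simp

lemma val_divide: "x \<noteq> 0 \<Longrightarrow> y \<noteq> 0 \<Longrightarrow> w (x / y) = w x - w y"
  by (simp add: divide_inverse val_mult val_inverse)

lemma val_power: "x \<noteq> 0 \<Longrightarrow> w (x ^ n) = int n * w x"
  by (induction n) (auto simp: val_mult algebra_simps)

lemma val_powi: "x \<noteq> 0 \<Longrightarrow> w (x powi n) = n * w x"
  by (auto simp: power_int_def val_power val_inverse)

lemma val_uminus: "w (- x) = w x"
proof (cases "x = 0")
  case False
  have "w (- 1) = 0" using val_const[of "-1"] by (simp add: hom_uminus hom_one)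
  thus ?thesis using val_mult[of "-1" x] False by simp
qed simp

lemma val_ge_0 [simp]: "0 \<in> val_ge w n" by (simp add: val_ge_def)

lemma val_ge_mono: "x \<in> val_ge w n \<Longrightarrow> m \<le> n \<Longrightarrow> x \<in> val_ge w m"
  by (auto simp: val_ge_def)

lemma val_ge_uminus: "x \<in> val_ge w n \<Longrightarrow> - x \<in> val_ge w n"
  by (auto simp: val_ge_def val_uminus)

lemma val_ge_add: "x \<in> val_ge w n \<Longrightarrow> y \<in> val_ge w n \<Longrightarrow> x + y \<in> val_ge w n"
  using val_add[of x y] by (cases "x = 0"; cases "y = 0"; cases "x + y = 0") (auto simp: val_ge_def)

lemma val_ge_diff: "x \<in> val_ge w n \<Longrightarrow> y \<in> val_ge w n \<Longrightarrow> x - y \<in> val_ge w n"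
  using val_ge_add[of x n "- y"] val_ge_uminus[of y n] by simp

lemma val_ge_sum: "(\<And>i. i \<in> A \<Longrightarrow> f i \<in> val_ge w n) \<Longrightarrow> sum f A \<in> val_ge w n"
  by (induction A rule: infinite_finite_induct) (auto intro: val_ge_add)

lemma val_ge_mult: "x \<in> val_ge w m \<Longrightarrow> y \<in> val_ge w n \<Longrightarrow> x * y \<in> val_ge w (m + n)"
  using val_mult[of x y] by (cases "x = 0"; cases "y = 0") (auto simp: val_ge_def)

lemma val_ge_mult0: "x \<in> val_ge w 0 \<Longrightarrow> y \<in> val_ge w n \<Longrightarrow> x * y \<in> val_ge w n"
  using val_ge_mult[of x 0 y n] by simp

lemma val_ge_const: "\<iota> c \<in> val_ge w 0"
  using val_const[of c] by (cases "c = 0") (auto simp: val_ge_def)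

lemma val_ge_const_mult: "y \<in> val_ge w n \<Longrightarrow> \<iota> c * y \<in> val_ge w n"
  by (rule val_ge_mult0[OF val_ge_const])

lemma val_ge_power: "x \<in> val_ge w m \<Longrightarrow> x ^ n \<in> val_ge w (int n * m)"
proof (induction n)
  case (Suc n)
  thus ?case using val_ge_mult[of x m "x ^ n" "int n * m"] by (simp add: algebra_simps)
qed (simp add: val_ge_def)

lemma val_ge_power0: "x \<in> val_ge w 0 \<Longrightarrow> x ^ n \<in> val_ge w 0"
  using val_ge_power[of x 0 n] by simp

lemma val_ge_mult_cancel: "x \<noteq> 0 \<Longrightarrow> x * y \<in> val_ge w (w x + n) \<longleftrightarrow> y \<in> val_ge w n"
  using val_mult[of x y] by (cases "y = 0") (auto simp: val_ge_def)

lemma val_add_higher: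
  assumes "x \<noteq> 0" "y \<in> val_ge w (w x + 1)"
  shows "x + y \<noteq> 0" "w (x + y) = w x"
proof -
  show nz: "x + y \<noteq> 0"
  proof
    assume "x + y = 0"
    hence "y = - x" by (simp add: eq_neg_iff_add_eq_0 add.commute)
    with assms show False by (auto simp: val_ge_def val_uminus)
  qed
  have "x + y \<in> val_ge w (w x)"
    using assms val_ge_mono[of y "w x + 1" "w x"] by (intro val_ge_add) (auto simp: val_ge_def)
  hence "w (x + y) \<ge> w x" using nz by (auto simp: val_ge_def)
  moreover have "\<not> w (x + y) \<ge> w x + 1"
  proof
    assume "w (x + y) \<ge> w x + 1"
    hence "(x + y) - y \<in> val_ge w (w x + 1)" using assms by (intro val_ge_diff) (auto simp: val_ge_def)
    thus False using assms by (auto simp: val_ge_def)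
  qed
  ultimately show "w (x + y) = w x" by linarith
qed

text \<open>
  The constants have value zero, so the lowest term of a polynomial in an element of positive value
  dominates.
\<close>

lemma val_poly:
  assumes "w s > 0" "s \<noteq> 0" "j0 \<le> N" "c j0 \<noteq> 0" "\<And>j. j < j0 \<Longrightarrow> c j = 0"
  shows "(\<Sum>j\<le>N. \<iota> (c j) * s ^ j) \<noteq> 0" "w (\<Sum>j\<le>N. \<iota> (c j) * s ^ j) = int j0 * w s"
proof -
  let ?t = "\<lambda>j. \<iota> (c j) * s ^ j"
  have t0: "?t j0 \<noteq> 0" "w (?t j0) = int j0 * w s"
    using assms by (auto simp: val_mult val_const val_power)
  have split: "(\<Sum>j\<le>N. ?t j) = ?t j0 + (\<Sum>j\<in>{..N} - {j0}. ?t j)"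
    by (rule sum.remove) (use assms in auto)
  have "(\<Sum>j\<in>{..N} - {j0}. ?t j) \<in> val_ge w (w (?t j0) + 1)"
  proof (rule val_ge_sum)
    fix j assume "j \<in> {..N} - {j0}"
    show "?t j \<in> val_ge w (w (?t j0) + 1)"
    proof (cases "j < j0")
      case False
      with \<open>j \<in> _\<close> have "j \<ge> Suc j0" by auto
      hence "int j * w s \<ge> int (Suc j0) * w s" using assms by (intro mult_right_mono) auto
      hence "int j * w s \<ge> int j0 * w s + 1" using assms by (simp add: algebra_simps)
      thus ?thesis using assms t0
        by (intro val_ge_const_mult) (auto simp: val_ge_def val_power)
    qed (use assms in auto)
  qed
  from val_add_higher[OF t0(1) this] show "(\<Sum>j\<le>N. ?t j) \<noteq> 0" "w (\<Sum>j\<le>N. ?t j) = int j0 * w s"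
    unfolding split t0(2) by auto
qed

lemma poly_nonzero:
  assumes "w s > 0" "s \<noteq> 0" "j \<le> N" "c j \<noteq> 0"
  shows "(\<Sum>j\<le>N. \<iota> (c j) * s ^ j) \<noteq> 0"
proof -
  define j0 where "j0 = (LEAST j. c j \<noteq> 0)"
  have "c j0 \<noteq> 0" unfolding j0_def using assms(4) by (rule LeastI)
  moreover have "j0 \<le> j" unfolding j0_def using assms(4) by (rule Least_le)
  moreover have "c j = 0" if "j < j0" for j using that not_less_Least unfolding j0_def by blast
  ultimately show ?thesis using assms by (intro val_poly[of s j0]) auto
qed

end

text \<open>
  If the ring of \<open>w\<close> were contained in that of \<open>w'\<close>, then units for \<open>w\<close> would be units for \<open>w'\<close>, so
  \<open>w'\<close> would be an integral multiple of \<open>w\<close>.  Both take the value \<open>1\<close>, which leaves \<open>w' = w\<close>.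
\<close>

lemma distinct_valuations_incomparable:
  assumes "discrete_valuation \<iota> w" "discrete_valuation \<iota> w'" "x \<noteq> 0" "w x \<noteq> w' x"
  shows "\<exists>f. f \<noteq> 0 \<and> w f \<ge> 0 \<and> w' f < 0"
proof (rule ccontr)
  assume "\<not> ?thesis"
  hence le: "w' f \<ge> 0" if "f \<noteq> 0" "w f \<ge> 0" for f using that by force
  interpret W: discrete_valuation \<iota> w by fact
  interpret W': discrete_valuation \<iota> w' by fact
  obtain t where t: "t \<noteq> 0" "w t = 1" using W.val_surj by blast
  obtain t' where t': "t' \<noteq> 0" "w' t' = 1" using W'.val_surj by blast
  have unit: "w' f = 0" if "f \<noteq> 0" "w f = 0" for f
    using le[of f] le[of "inverse f"] that by (auto simp: W.val_inverse W'.val_inverse)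
  have proportional: "w' f = w f * w' t" if "f \<noteq> 0" for f
  proof -
    have "w' (f / t powi (w f)) = 0"
      using that t by (intro unit) (auto simp: W.val_divide W.val_powi)
    thus ?thesis using that t by (simp add: W'.val_divide W'.val_powi)
  qed
  have "w t' * w' t = 1" using proportional[OF t'(1)] t' by simp
  moreover have "w' t \<ge> 0" using le[of t] t by simp
  ultimately have "w' t = 1" by (metis abs_of_nonneg dvd_triv_right zdvd1_eq)
  with proportional[OF assms(3)] assms(4) show False by simp
qed

section \<open>Weak approximation and finiteness of poles\<close>

text \<open>
  Multiplying \<open>b\<close> by the leading coefficient \<open>a e\<close> turns the relation into an integral equation
  \<open>g ^ e = - (\<Sum>i<e. a i * a e ^ (e - 1 - i) * g ^ i)\<close> for \<open>g = a e * b\<close>.  If \<open>g\<close> had value below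
  \<open>-\<beta>\<close>, then every term on the right would have larger value than the left-hand side.
\<close>

lemma (in discrete_valuation) integral_bound:
  assumes "\<beta> \<ge> 0" "e \<ge> 1" "\<And>i. i \<le> e \<Longrightarrow> a i \<in> val_ge w (- \<beta>)" "(\<Sum>i\<le>e. a i * b ^ i) = 0"
  shows "a e * b \<in> val_ge w (- \<beta>)"
proof (rule ccontr)
  define g where "g = a e * b"
  assume "a e * b \<notin> val_ge w (- \<beta>)"
  hence g: "g \<noteq> 0" "w g < - \<beta>" by (auto simp: val_ge_def g_def)
  have "0 = a e ^ (e - 1) * (\<Sum>i\<le>e. a i * b ^ i)" using assms by simp
  also have "\<dots> = (\<Sum>i<e. a i * a e ^ (e - 1) * b ^ i) + a e ^ (e - 1) * a e * b ^ e"
    by (simp add: sum.atMost_Suc lessThan_Suc_atMost[symmetric] sum_distrib_left algebra_simps)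
  also have "a e ^ (e - 1) * a e * b ^ e = g ^ e"
    using assms(2) by (simp add: g_def power_mult_distrib flip: power_Suc2)
  also have "(\<Sum>i<e. a i * a e ^ (e - 1) * b ^ i) = (\<Sum>i<e. a i * a e ^ (e - 1 - i) * g ^ i)"
  proof (rule sum.cong)
    fix i assume "i \<in> {..<e}"
    hence "a e ^ (e - 1) = a e ^ (e - 1 - i) * a e ^ i" by (simp flip: power_add)
    thus "a i * a e ^ (e - 1) * b ^ i = a i * a e ^ (e - 1 - i) * g ^ i"
      by (simp add: g_def power_mult_distrib)
  qed simp
  finally have eq: "g ^ e = - (\<Sum>i<e. a i * a e ^ (e - 1 - i) * g ^ i)"
    by (simp add: eq_neg_iff_add_eq_0 add.commute)
  have "g ^ e \<in> val_ge w (int e * w g + 1)" unfolding eq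
  proof (intro val_ge_uminus val_ge_sum)
    fix i assume i: "i \<in> {..<e}"
    have "a i * a e ^ (e - 1 - i) * g ^ i \<in> val_ge w (- \<beta> + int (e - 1 - i) * (- \<beta>) + int i * w g)"
      using assms i by (intro val_ge_mult val_ge_power) (auto simp: val_ge_def)
    moreover have "- \<beta> + int (e - 1 - i) * (- \<beta>) + int i * w g \<ge> int e * w g + 1"
    proof -
      have "int (e - i) * (w g + 1) \<le> int (e - i) * (- \<beta>)"
        using g by (intro mult_left_mono) auto
      moreover have "int (e - i) = int e - int i" "int (e - 1 - i) = int e - 1 - int i" "int (e - i) \<ge> 1"
        using i by auto
      ultimately show ?thesis by (simp add: algebra_simps)
    qed
    ultimately show "a i * a e ^ (e - 1 - i) * g ^ i \<in> val_ge w (int e * w g + 1)" by (rule val_ge_mono)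
  qed
  thus False using g by (auto simp: val_ge_def val_power)
qed

text \<open>
  Induction on \<open>F\<close>.  A new place \<open>R\<close> is accommodated with a function \<open>h\<close> that has a pole at \<open>P0\<close> and a zero
  at \<open>R\<close>.  If \<open>z\<close> has no pole at \<open>R\<close>, then \<open>z ^ n * h\<close> works; otherwise \<open>z ^ n / (z ^ n + 1)\<close> is a
  unit at \<open>P0\<close> and \<open>R\<close> and has zeros of high order at the points of \<open>F\<close>, and \<open>h\<close> is multiplied by it.
\<close>

lemma weak_approximation:
  assumes "finite F" "discrete_valuation \<iota> (v P0)" "\<forall>P\<in>F. discrete_valuation \<iota> (v P)"
    and "\<forall>P\<in>F. \<exists>x. x \<noteq> 0 \<and> v P0 x \<noteq> v P x"
  shows "\<exists>z. z \<noteq> 0 \<and> v P0 z < (0::int) \<and> (\<forall>P\<in>F. v P z > 0)"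
  using assms
proof (induction F rule: finite_induct)
  case empty
  then interpret V: discrete_valuation \<iota> "v P0" by simp
  obtain t where "t \<noteq> 0" "v P0 t = 1" using V.val_surj by blast
  thus ?case by (intro exI[of _ "inverse t"]) (auto simp: V.val_inverse)
next
  case (insert R F)
  interpret V0: discrete_valuation \<iota> "v P0" by fact
  interpret VR: discrete_valuation \<iota> "v R" using insert.prems by simp
  obtain z where z: "z \<noteq> 0" "v P0 z < 0" "\<forall>P\<in>F. v P z > 0" using insert by auto
  obtain x where x: "x \<noteq> 0" "v P0 x \<noteq> v R x" using insert.prems by auto
  obtain f where f: "f \<noteq> 0" "v P0 f \<ge> 0" "v R f < 0"
    using distinct_valuations_incomparable[OF V0.discrete_valuation_axioms VR.discrete_valuation_axioms x]
    by blast
  obtain g where g: "g \<noteq> 0" "v R g \<ge> 0" "v P0 g < 0"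
    using distinct_valuations_incomparable[OF VR.discrete_valuation_axioms V0.discrete_valuation_axioms x(1) x(2)[symmetric]]
    by blast
  define h where "h = g / f"
  have h: "h \<noteq> 0" "v P0 h < 0" "v R h > 0"
    using f g by (auto simp: h_def V0.val_divide VR.val_divide)
  \<comment> \<open>large enough for the zeros of \<open>z ^ n\<close> at the points of \<open>F\<close> to outweigh all poles of \<open>h\<close> there\<close>
  define n where "n = Suc (\<Sum>P\<in>F. nat \<bar>v P h\<bar>)"
  have large: "int n * v P z + v P h > 0" if P: "P \<in> F" for P
  proof -
    have "nat \<bar>v P h\<bar> < n" unfolding n_def less_Suc_eq_le
      using P insert.hyps by (intro member_le_sum) auto
    hence "- v P h < int n" by linarith
    also have "int n * 1 \<le> int n * v P z" using z P by (intro mult_left_mono) auto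
    hence "int n \<le> int n * v P z" by simp
    finally show ?thesis by simp
  qed
  have nn: "n \<ge> 1" by (simp add: n_def)
  show ?case
  proof (cases "v R z \<ge> 0")
    case True
    have neg: "int n * v P0 z \<le> 0" using z by (simp add: mult_nonneg_nonpos)
    have "v P (z ^ n * h) > 0" if P: "P \<in> F" for P
    proof -
      interpret V: discrete_valuation \<iota> "v P" using P insert.prems by auto
      show ?thesis using large[OF P] z h by (simp add: V.val_mult V.val_power)
    qed
    thus ?thesis using z h True neg
      by (intro exI[of _ "z ^ n * h"])
        (auto simp: V0.val_mult V0.val_power VR.val_mult VR.val_power intro: add_nonneg_pos)
  next
    case False
    have "1 \<in> val_ge (v P0) (v P0 (z ^ n) + 1)" "1 \<in> val_ge (v R) (v R (z ^ n) + 1)"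
      using z False nn mult_less_0_iff[of "int n" "v P0 z"] mult_less_0_iff[of "int n" "v R z"]
      by (auto simp: val_ge_def V0.val_power VR.val_power simp flip: less_eq_iff_succ_less)
    with z have *: "z ^ n + 1 \<noteq> 0" "v P0 (z ^ n + 1) = v P0 (z ^ n)" "v R (z ^ n + 1) = v R (z ^ n)"
      using V0.val_add_higher[of "z ^ n" 1] VR.val_add_higher[of "z ^ n" 1] by auto
    have "v P (z ^ n * h / (z ^ n + 1)) > 0" if P: "P \<in> F" for P
    proof -
      interpret V: discrete_valuation \<iota> "v P" using P insert.prems by auto
      have "int n * v P z > 0" using P z nn by simp
      hence "z ^ n \<in> val_ge (v P) (v P 1 + 1)" using z by (auto simp: val_ge_def V.val_power)
      hence "v P (z ^ n + 1) = 0" using V.val_add_higher(2)[of 1 "z ^ n"] by (simp add: add.commute)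
      thus ?thesis using large[OF P] z h *(1) by (simp add: V.val_mult V.val_power V.val_divide)
    qed
    thus ?thesis using z h *
      by (intro exI[of _ "z ^ n * h / (z ^ n + 1)"])
        (auto simp: V0.val_mult VR.val_mult V0.val_divide VR.val_divide)
  qed
qed

text \<open>
  What is needed of a curve: the valuations at its points, finite degree over \<open>k(y)\<close> for transcendental \<open>y\<close>,
  expressed as a bound on the length of families independent over \<open>k[y]\<close>, and the absence of zeros of
  functions without poles.
\<close>

locale valuations = field_hom \<iota> for \<iota> :: "'a::{field,finite} \<Rightarrow> 'k::field" +
  fixes C :: "'p set" and v :: "'p \<Rightarrow> 'k \<Rightarrow> int"
  assumes valuation: "P \<in> C \<Longrightarrow> discrete_valuation \<iota> (v P)"
    and finite_rank: "\<exists>d. \<forall>u. poly_dep \<iota> y u d"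
    and no_zeros_without_poles: "f \<noteq> 0 \<Longrightarrow> \<forall>P\<in>C. v P f \<ge> 0 \<Longrightarrow> P \<in> C \<Longrightarrow> v P f = 0"
begin

text \<open>
  Choose for each \<open>P\<close> in \<open>F\<close> an element of value \<open>0\<close> at \<open>P\<close> and of positive value at the other points.
  A relation over \<open>k[s]\<close> between these elements, reduced modulo \<open>s\<close>, contradicts the values at the
  point whose coefficient is non-zero modulo \<open>s\<close>.  By \<open>finite_rank\<close> the zeros of \<open>s\<close> therefore give
  only finitely many valuations.
\<close>

lemma indep_at_poles:
  assumes "finite F" "F \<subseteq> C" "s \<noteq> 0" "\<forall>P\<in>F. v P s > 0"
    and dist: "\<forall>P\<in>F. \<forall>P'\<in>F. P \<noteq> P' \<longrightarrow> (\<exists>x. x \<noteq> 0 \<and> v P x \<noteq> v P' x)"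
  shows "\<exists>u. \<not> poly_dep \<iota> s u (card F)"
proof -
  have "\<exists>e. e \<noteq> 0 \<and> v P e = 0 \<and> (\<forall>P'\<in>F - {P}. v P' e > 0)" if P: "P \<in> F" for P
  proof -
    interpret V: discrete_valuation \<iota> "v P" using valuation P assms by auto
    have "\<exists>z. z \<noteq> 0 \<and> v P z < 0 \<and> (\<forall>P'\<in>F - {P}. v P' z > 0)"
      using assms P valuation by (intro weak_approximation[where \<iota> = \<iota>]) auto
    then obtain z where z: "z \<noteq> 0" "v P z < 0" "\<forall>P'\<in>F - {P}. v P' z > 0" by blast
    have "z + 1 \<noteq> 0" "v P (z + 1) = v P z"
      using V.val_add_higher[of z 1] z by (auto simp: val_ge_def)
    moreover have "v P' (z / (z + 1)) > 0" if P': "P' \<in> F - {P}" for P'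
    proof -
      interpret V': discrete_valuation \<iota> "v P'" using valuation P' assms by auto
      have "v P' z > 0" using z P' by blast
      moreover from this have "1 + z \<noteq> 0" "v P' (1 + z) = 0"
        using V'.val_add_higher[of 1 z] by (auto simp: val_ge_def)
      ultimately show ?thesis using z(1) by (simp add: V'.val_divide add.commute)
    qed
    ultimately show ?thesis using z by (intro exI[of _ "z / (z + 1)"]) (auto simp: V.val_divide)
  qed
  then obtain e where e: "\<And>P. P \<in> F \<Longrightarrow> e P \<noteq> 0 \<and> v P (e P) = 0 \<and> (\<forall>P'\<in>F - {P}. v P' (e P) > 0)"
    by metis
  obtain p where p: "bij_betw p {..<card F} F"
    using ex_bij_betw_nat_finite[OF assms(1)] by (auto simp: atLeast0LessThan)
  hence pF: "p i \<in> F" if "i < card F" for i using that by (auto simp: bij_betw_def)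
  have "\<not> poly_dep \<iota> s (\<lambda>i. e (p i)) (card F)"
  proof
    assume "poly_dep \<iota> s (\<lambda>i. e (p i)) (card F)"
    then obtain N c i0 where c: "i0 < card F" "c i0 0 \<noteq> 0"
      and sum0: "(\<Sum>i<card F. \<Sum>j\<le>N. \<iota> (c i j) * s ^ j * e (p i)) = 0"
      using assms(3) by (rule poly_dep_reduced)
    interpret V: discrete_valuation \<iota> "v (p i0)" using valuation pF[OF c(1)] assms by auto
    have s: "v (p i0) s > 0" using pF[OF c(1)] assms by auto
    let ?q = "\<lambda>i. \<Sum>j\<le>N. \<iota> (c i j) * s ^ j"
    have lead: "?q i0 * e (p i0) \<noteq> 0" "v (p i0) (?q i0 * e (p i0)) = 0"
      using V.val_poly[of s 0 N "c i0"] s assms(3) c e[OF pF[OF c(1)]] by (auto simp: V.val_mult)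
    have "(\<Sum>i\<in>{..<card F} - {i0}. ?q i * e (p i)) \<in> val_ge (v (p i0)) 1"
    proof (rule V.val_ge_sum)
      fix i assume i: "i \<in> {..<card F} - {i0}"
      hence "p i \<noteq> p i0" using p c(1) by (auto simp: bij_betw_def inj_on_def)
      hence "e (p i) \<in> val_ge (v (p i0)) 1" using e[of "p i"] pF[of i] pF[OF c(1)] i
        by (force simp: val_ge_def)
      moreover have "?q i \<in> val_ge (v (p i0)) 0"
        using s by (intro V.val_ge_sum V.val_ge_const_mult V.val_ge_power0) (auto simp: val_ge_def)
      ultimately show "?q i * e (p i) \<in> val_ge (v (p i0)) 1" by (intro V.val_ge_mult0)
    qed
    with lead V.val_add_higher(1)[of "?q i0 * e (p i0)" "\<Sum>i\<in>{..<card F} - {i0}. ?q i * e (p i)"]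
    have "?q i0 * e (p i0) + (\<Sum>i\<in>{..<card F} - {i0}. ?q i * e (p i)) \<noteq> 0" by simp
    moreover have "(\<Sum>i<card F. ?q i * e (p i)) = 0" using sum0 by (simp add: sum_distrib_right)
    ultimately show False using c(1) by (simp add: sum.remove)
  qed
  thus ?thesis by blast
qed

text \<open>
  The zeros of \<open>s\<close> give only finitely many valuations.  Weak approximation applies to a
  maximal set \<open>F\<close> of zeros with distinct valuations, and every other zero has the valuation of a
  member of \<open>F\<close>.
\<close>

lemma separate_from_other_poles:
  assumes "Q0 \<in> C" "s \<noteq> 0" "v Q0 s > 0"
    and sep: "\<forall>P\<in>C - {Q0}. \<exists>x. x \<noteq> 0 \<and> v P x \<noteq> v Q0 x"
  shows "\<exists>z. z \<noteq> 0 \<and> v Q0 z < 0 \<and> (\<forall>P\<in>C - {Q0}. v P s > 0 \<longrightarrow> v P z \<ge> 0)"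
proof -
  obtain d where d: "\<forall>u. poly_dep \<iota> s u d" using finite_rank by blast
  define ok where "ok F \<longleftrightarrow> finite F \<and> F \<subseteq> C \<and> Q0 \<in> F \<and> (\<forall>P\<in>F. v P s > 0) \<and>
      (\<forall>P\<in>F. \<forall>P'\<in>F. P \<noteq> P' \<longrightarrow> (\<exists>x. x \<noteq> 0 \<and> v P x \<noteq> v P' x))" for F
  have "card F < Suc d" if "ok F" for F
  proof (rule ccontr)
    assume "\<not> card F < Suc d"
    moreover obtain u where "\<not> poly_dep \<iota> s u (card F)"
      using indep_at_poles[of F s] \<open>ok F\<close> assms unfolding ok_def by blast
    ultimately show False using d poly_dep_mono[of s u d "card F"] by auto
  qed
  moreover have "ok {Q0}" using assms by (auto simp: ok_def)
  ultimately have "\<exists>F. ok F \<and> (\<forall>F'. ok F' \<longrightarrow> card F' \<le> card F)"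
    by (intro ex_has_greatest_nat[of ok "{Q0}" card "Suc d"]) (auto intro: less_imp_le)
  then obtain F where F: "ok F" and max: "\<And>F'. ok F' \<Longrightarrow> card F' \<le> card F" by blast
  have "\<exists>z. z \<noteq> 0 \<and> v Q0 z < 0 \<and> (\<forall>P\<in>F - {Q0}. v P z > 0)"
  proof (rule weak_approximation[where \<iota> = \<iota>])
    show "\<forall>P\<in>F - {Q0}. \<exists>x. x \<noteq> 0 \<and> v Q0 x \<noteq> v P x"
      using F unfolding ok_def by (metis DiffD1 DiffD2 insertI1)
  qed (use F valuation assms(1) in \<open>auto simp: ok_def\<close>)
  then obtain z where z: "z \<noteq> 0" "v Q0 z < 0" "\<forall>P\<in>F - {Q0}. v P z > 0" by blast
  have "v P z \<ge> 0" if P: "P \<in> C - {Q0}" "v P s > 0" for P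
  proof -
    have "\<exists>P'\<in>F. \<forall>x. x \<noteq> 0 \<longrightarrow> v P x = v P' x"
    proof (rule ccontr)
      assume no: "\<not> ?thesis"
      hence "P \<notin> F" by blast
      have "ok (insert P F)" using F P no unfolding ok_def by (auto; metis)
      from max[OF this] show False using \<open>P \<notin> F\<close> F by (auto simp: ok_def)
    qed
    then obtain P' where P': "P' \<in> F" "\<forall>x. x \<noteq> 0 \<longrightarrow> v P x = v P' x"
      by blast
    have "P' \<noteq> Q0" using P' sep P by blast
    thus ?thesis using P' z by (simp add: less_imp_le)
  qed
  with z show ?thesis by blast
qed

end

section \<open>Functions with poles at a single point\<close>

context valuations begin

text \<open>
  The element \<open>b\<close> is algebraic over \<open>k(y)\<close> with \<open>y = 1/s\<close>, and the leading coefficient \<open>a\<close> of its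
  equation makes \<open>a * b\<close> integral over \<open>k[y]\<close>.  So its poles lie among those of \<open>y\<close>, with orders
  bounded by a fixed multiple of the orders of \<open>y\<close>.
\<close>

lemma multiplier_into_regular:
  assumes "Q0 \<in> C" "s \<noteq> 0" "v Q0 s > 0"
  defines "A \<equiv> {f. \<exists>n. \<forall>P\<in>C. f \<in> val_ge (v P) (- (int n * max 0 (v P s)))}"
  shows "\<exists>a. a \<noteq> 0 \<and> a \<in> A \<and> a * b \<in> A"
proof -
  interpret V0: discrete_valuation \<iota> "v Q0" using valuation assms by auto
  define y where "y = inverse s"
  have y: "y \<noteq> 0" "s * y = 1" using assms by (auto simp: y_def)
  obtain d where "poly_dep \<iota> y (\<lambda>i. b ^ i) d" using finite_rank by blast
  then obtain N c where c: "\<exists>i<d. \<exists>j\<le>N. c i j \<noteq> 0"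
    and sum0: "(\<Sum>i<d. \<Sum>j\<le>N. \<iota> (c i j) * y ^ j * b ^ i) = 0"
    unfolding poly_dep_def by blast
  define a where "a i = (\<Sum>j\<le>N. \<iota> (c i j) * y ^ j)" for i
  define e where "e = (GREATEST i. i < d \<and> (\<exists>j\<le>N. c i j \<noteq> 0))"
  have e: "e < d" "\<exists>j\<le>N. c e j \<noteq> 0"
    using GreatestI_ex_nat[of "\<lambda>i. i < d \<and> (\<exists>j\<le>N. c i j \<noteq> 0)" d] c
      unfolding e_def by auto
  have top: "i \<le> e" if "i < d" "\<exists>j\<le>N. c i j \<noteq> 0" for i
    unfolding e_def using that by (intro Greatest_le_nat[of _ _ d]) auto
  have "a i = 0" if "i < d" "i > e" for i
    using top[OF that(1)] that(2) unfolding a_def by (intro sum.neutral) force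
  hence "(\<Sum>i\<le>e. a i * b ^ i) = (\<Sum>i<d. a i * b ^ i)"
    using e(1) by (intro sum.mono_neutral_left) auto
  hence rel: "(\<Sum>i\<le>e. a i * b ^ i) = 0"
    using sum0 by (simp add: a_def sum_distrib_right)
  have "a e \<noteq> 0"
  proof -
    obtain j where j: "j \<le> N" "c e j \<noteq> 0" using e by blast
    have "a e = (\<Sum>j\<le>N. \<iota> (c e (N - j)) * y ^ (N - j))" unfolding a_def
      by (rule sum.reindex_bij_witness[of _ "\<lambda>j. N - j" "\<lambda>j. N - j"]) auto
    also have "\<dots> = (\<Sum>j\<le>N. y ^ N * (\<iota> (c e (N - j)) * s ^ j))"
    proof (rule sum.cong)
      fix j assume "j \<in> {..N}"
      hence "y ^ N * s ^ j = y ^ (N - j) * (y ^ j * s ^ j)" by (simp flip: power_add mult.assoc)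
      also have "y ^ j * s ^ j = 1" using y by (simp add: mult.commute flip: power_mult_distrib)
      finally show "\<iota> (c e (N - j)) * y ^ (N - j) = y ^ N * (\<iota> (c e (N - j)) * s ^ j)"
        by (simp add: algebra_simps)
    qed simp
    finally have "a e = y ^ N * (\<Sum>j\<le>N. \<iota> (c e (N - j)) * s ^ j)"
      by (simp add: sum_distrib_left)
    moreover have "(\<Sum>j\<le>N. \<iota> (c e (N - j)) * s ^ j) \<noteq> 0"
      using V0.poly_nonzero[of s "N - j" N "\<lambda>j. c e (N - j)"] j assms by simp
    ultimately show ?thesis using y by simp
  qed
  have "e \<noteq> 0" using rel \<open>a e \<noteq> 0\<close> by (intro notI) simp
  have bound: "a i \<in> val_ge (v P) (- (int N * max 0 (v P s)))" if P: "P \<in> C" for P i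
  proof -
    interpret V: discrete_valuation \<iota> "v P" using valuation P by auto
    have "y \<in> val_ge (v P) (- max 0 (v P s))"
      using assms y V.val_inverse[of s] by (auto simp: val_ge_def y_def)
    hence "y ^ j \<in> val_ge (v P) (int j * - max 0 (v P s))" for j by (rule V.val_ge_power)
    moreover have "int j * - max 0 (v P s) \<ge> - (int N * max 0 (v P s))" if "j \<le> N" for j
      using that by (simp add: mult_right_mono)
    ultimately show ?thesis unfolding a_def
      by (intro V.val_ge_sum V.val_ge_const_mult) (metis V.val_ge_mono atMost_iff)
  qed
  have "a e * b \<in> val_ge (v P) (- (int N * max 0 (v P s)))" if P: "P \<in> C" for P
  proof -
    interpret V: discrete_valuation \<iota> "v P" using valuation P by auto
    show ?thesis using \<open>e \<noteq> 0\<close> rel bound[OF P] by (intro V.integral_bound) auto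
  qed
  with bound \<open>a e \<noteq> 0\<close> show ?thesis unfolding A_def by blast
qed

end

text \<open>
  A class of \<open>\<tau>\<close> is mapped by \<open>g\<close> into a translate of \<open>R\<close>.
\<close>

lemma card_le_by_cosets:
  fixes g :: "'b \<Rightarrow> 'k::ab_group_add"
  assumes "finite Y" "finite T" "finite R" "inj_on g Y"
    and \<tau>: "\<And>c. c \<in> Y \<Longrightarrow> \<tau> c \<in> T"
    and diff: "\<And>c c'. c \<in> Y \<Longrightarrow> c' \<in> Y \<Longrightarrow> \<tau> c = \<tau> c' \<Longrightarrow> g c - g c' \<in> R"
  shows "card Y \<le> card T * card R"
proof -
  define rep where "rep t = (SOME c. c \<in> Y \<and> \<tau> c = t)" for t
  have rep: "rep (\<tau> c) \<in> Y \<and> \<tau> (rep (\<tau> c)) = \<tau> c" if "c \<in> Y" for c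
  proof -
    from that have "\<exists>c'. c' \<in> Y \<and> \<tau> c' = \<tau> c" by blast
    from someI_ex[OF this] show ?thesis unfolding rep_def .
  qed
  let ?h = "\<lambda>c. (\<tau> c, g c - g (rep (\<tau> c)))"
  have "inj_on ?h Y"
  proof (rule inj_onI)
    fix c c' assume c: "c \<in> Y" "c' \<in> Y" and eq: "?h c = ?h c'"
    from eq have "rep (\<tau> c) = rep (\<tau> c')" by simp
    with eq have "g c = g c'" by simp
    with c assms(4) show "c = c'" by (simp add: inj_on_eq_iff)
  qed
  moreover have "?h ` Y \<subseteq> T \<times> R"
  proof (rule image_subsetI)
    fix c assume c: "c \<in> Y"
    with rep[OF c] have "g c - g (rep (\<tau> c)) \<in> R" by (intro diff) auto
    with \<tau>[OF c] show "?h c \<in> T \<times> R" by simp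
  qed
  ultimately have "card Y \<le> card (T \<times> R)"
    using assms(2,3) by (intro card_inj_on_le[of ?h]) auto
  thus ?thesis by (simp add: card_cartesian_product)
qed

context valuations begin

text \<open>
  A family in \<open>M\<close> that is independent modulo \<open>s M\<close> is independent over \<open>k[s]\<close>, so it has at most \<open>D\<close>
  members.  Length \<open>D\<close> is impossible: each power \<open>z ^ k\<close> would then be a combination of the family
  with coefficients in \<open>k[s]\<close>, divided by a polynomial with non-zero constant term, and the pole
  orders of all powers of \<open>z\<close> at \<open>Q0\<close> would be bounded.  Therefore a maximal family has \<open>r < D\<close>
  members, and its linear combinations represent all classes of \<open>M / s M\<close>.
\<close>

lemma finite_codim_one_step:
  assumes "Q0 \<in> C" "s \<noteq> 0" "v Q0 s > 0" "z \<noteq> 0" "v Q0 z < 0"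
    and M_const_mult: "\<And>c f. f \<in> M \<Longrightarrow> \<iota> c * f \<in> M"
    and M_add: "\<And>f g. f \<in> M \<Longrightarrow> g \<in> M \<Longrightarrow> f + g \<in> M"
    and M_mult: "\<And>f. f \<in> M \<Longrightarrow> s * f \<in> M"
    and M_zero: "0 \<in> M"
    and zM: "\<And>k. z ^ k \<in> M"
    and rank: "\<forall>u. poly_dep \<iota> s u (Suc D)"
  shows "\<exists>r T. r < D \<and> finite T \<and> card T \<le> CARD('a) ^ r \<and> (\<forall>f\<in>M. \<exists>\<tau>\<in>T. \<exists>m\<in>M. f = \<tau> + s * m)"
proof -
  interpret V0: discrete_valuation \<iota> "v Q0" using valuation assms by auto
  have M_sum: "sum f A \<in> M" if "\<And>i. i \<in> A \<Longrightarrow> f i \<in> M" for f and A :: "nat set"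
    using that by (induction A rule: infinite_finite_induct) (auto intro: M_zero M_add)
  have M_uminus: "- f \<in> M" if "f \<in> M" for f
    using M_const_mult[OF that, of "-1"] by (simp add: hom_uminus hom_one)
  have M_power: "s ^ j * f \<in> M" if "f \<in> M" for f j
    by (induction j) (auto simp: that mult.assoc intro: M_mult)
  have split: "(\<Sum>j\<le>N. \<iota> (c j) * s ^ j * f) = \<iota> (c 0) * f + s * (\<Sum>j<N. \<iota> (c (Suc j)) * (s ^ j * f))"
    for N c f
    by (simp only: sum.atMost_shift) (simp add: sum_distrib_left mult.assoc mult.left_commute)
  define indep where "indep u r \<longleftrightarrow> (\<forall>i<r. u i \<in> M) \<and>
    (\<forall>c. (\<exists>m\<in>M. (\<Sum>i<r. \<iota> (c i) * u i) = s * m) \<longrightarrow> (\<forall>i<r. c i = 0))" for u :: "nat \<Rightarrow> 'k" and r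
  \<comment> \<open>a relation over \<open>k[s]\<close>, reduced modulo \<open>s\<close>\<close>
  have reduce: "\<exists>m\<in>M. (\<Sum>i<r. \<iota> (c i 0) * u i) = s * m"
    if "\<And>i. i < r \<Longrightarrow> u i \<in> M" "(\<Sum>i<r. \<Sum>j\<le>N. \<iota> (c i j) * s ^ j * u i) = 0"
    for u :: "nat \<Rightarrow> 'k" and r c N
  proof
    let ?m = "- (\<Sum>i<r. \<Sum>j<N. \<iota> (c i (Suc j)) * (s ^ j * u i))"
    show "?m \<in> M"
    proof (rule M_uminus, rule M_sum, rule M_sum)
      fix i j assume "i \<in> {..<r}"
      thus "\<iota> (c i (Suc j)) * (s ^ j * u i) \<in> M" by (intro M_const_mult M_power that(1)) simp
    qed
    have "0 = (\<Sum>i<r. \<iota> (c i 0) * u i + s * (\<Sum>j<N. \<iota> (c i (Suc j)) * (s ^ j * u i)))"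
      using that(2) unfolding split by simp
    also have "\<dots> = (\<Sum>i<r. \<iota> (c i 0) * u i) - s * ?m"
      by (simp add: sum.distrib sum_distrib_left)
    finally show "(\<Sum>i<r. \<iota> (c i 0) * u i) = s * ?m" by (simp add: eq_neg_iff_add_eq_0)
  qed
  have indep_M: "u i \<in> M" if "indep u r" "i < r" for u r i
    using that unfolding indep_def by blast
  have indep_D: "c i = 0" if "indep u r" "\<exists>m\<in>M. (\<Sum>i<r. \<iota> (c i) * u i) = s * m" "i < r" for u r c i
    using that unfolding indep_def by blast
  have indep_dep: "\<not> poly_dep \<iota> s u r" if "indep u r" for u r
  proof
    assume "poly_dep \<iota> s u r"
    then obtain N c i where c: "i < r" "c i 0 \<noteq> 0"
      and sum0: "(\<Sum>i<r. \<Sum>j\<le>N. \<iota> (c i j) * s ^ j * u i) = 0"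
      using assms(2) by (rule poly_dep_reduced)
    have "c i 0 = 0"
      using indep_D[of u r "\<lambda>i. c i 0", OF that reduce[OF indep_M[OF that] sum0] c(1)] by simp
    with c show False by simp
  qed
  have less: "r < D" if u: "indep u r" for u r
  proof (rule ccontr)
    assume "\<not> r < D"
    moreover have "r \<le> D" using indep_dep[OF u] rank poly_dep_mono[of s u "Suc D" r]
      by (meson not_less_eq_eq)
    ultimately have r: "r = D" by simp
    define B where "B = (\<Sum>i<D. nat \<bar>v Q0 (u i)\<bar>)"
    have B: "u i \<in> val_ge (v Q0) (- int B)" if "i < D" for i
    proof -
      have "nat \<bar>v Q0 (u i)\<bar> \<le> B" unfolding B_def using that by (intro member_le_sum) auto
      thus ?thesis by (auto simp: val_ge_def)
    qed
    \<comment> \<open>the pole order of this element at \<open>Q0\<close> exceeds that of every \<open>u i\<close>\<close>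
    define x where "x = z ^ Suc B"
    define u' where "u' = u(D := x)"
    have "poly_dep \<iota> s u' (Suc D)" using rank by blast
    then obtain N c i where c: "i < Suc D" "c i 0 \<noteq> 0"
      and sum0: "(\<Sum>i<Suc D. \<Sum>j\<le>N. \<iota> (c i j) * s ^ j * u' i) = 0"
      using assms(2) by (rule poly_dep_reduced)
    have u'M: "u' i \<in> M" if "i < Suc D" for i
      using indep_M[OF u] r that zM[of "Suc B"] by (auto simp: u'_def x_def less_Suc_eq)
    have sum_u': "(\<Sum>i<D. g i * u' i) = (\<Sum>i<D. g i * u i)" for g
      by (rule sum.cong) (auto simp: u'_def)
    have "c D 0 \<noteq> 0"
    proof
      assume "c D 0 = 0"
      hence "\<exists>m\<in>M. (\<Sum>i<D. \<iota> (c i 0) * u i) = s * m"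
        using reduce[OF u'M sum0] by (simp add: sum_u')
      hence "c i 0 = 0" if "i < D" for i
        using indep_D[of u D "\<lambda>i. c i 0"] u r that by simp
      with c \<open>c D 0 = 0\<close> show False by (auto simp: less_Suc_eq)
    qed
    define p where "p i = (\<Sum>j\<le>N. \<iota> (c i j) * s ^ j)" for i
    have p: "p D \<noteq> 0" "v Q0 (p D) = 0"
      using V0.val_poly[of s 0 N "c D"] assms \<open>c D 0 \<noteq> 0\<close> by (auto simp: p_def)
    have "(\<Sum>i<Suc D. p i * u' i) = 0" using sum0 by (simp add: p_def sum_distrib_right)
    hence "p D * x = - (\<Sum>i<D. p i * u i)"
      using sum_u'[of p] by (simp add: u'_def eq_neg_iff_add_eq_0 add.commute)
    moreover have "(\<Sum>i<D. p i * u i) \<in> val_ge (v Q0) (- int B)"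
    proof (rule V0.val_ge_sum)
      fix i assume "i \<in> {..<D}"
      moreover have "p i \<in> val_ge (v Q0) 0" unfolding p_def
        using assms by (intro V0.val_ge_sum V0.val_ge_const_mult V0.val_ge_power0) (auto simp: val_ge_def)
      ultimately show "p i * u i \<in> val_ge (v Q0) (- int B)" using B by (intro V0.val_ge_mult0) auto
    qed
    ultimately have "p D * x \<in> val_ge (v Q0) (- int B)" by (simp add: V0.val_ge_uminus)
    hence "v Q0 (p D * x) \<ge> - int B" using p assms by (auto simp: val_ge_def x_def)
    moreover have "v Q0 (p D * x) = int (Suc B) * v Q0 z"
      using p assms by (simp add: x_def V0.val_mult V0.val_power del: power_Suc)
    moreover have "int (Suc B) * v Q0 z \<le> int (Suc B) * (- 1)" using assms
      by (intro mult_left_mono) auto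
    ultimately show False by simp
  qed
  have "\<exists>r. (\<exists>u. indep u r) \<and> (\<forall>r'. (\<exists>u. indep u r') \<longrightarrow> r' \<le> r)"
  proof (rule ex_has_greatest_nat[of _ 0 "\<lambda>r. r" D])
    show "\<exists>u. indep u 0" by (simp add: indep_def)
  qed (use less in \<open>auto intro: less_imp_le\<close>)
  then obtain r u where u: "indep u r" and greatest: "\<And>r' u'. indep u' r' \<Longrightarrow> r' \<le> r"
    by blast
  have max: "\<not> indep u' (Suc r)" for u' using greatest[of u' "Suc r"] by auto
  define T where "T = (\<lambda>c. \<Sum>i<r. \<iota> (c i) * u i) ` ({..<r} \<rightarrow>\<^sub>E (UNIV :: 'a set))"
  have "card T \<le> card ({..<r} \<rightarrow>\<^sub>E (UNIV :: 'a set))"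
    unfolding T_def by (intro card_image_le finite_PiE) auto
  hence "card T \<le> CARD('a) ^ r" by (simp add: card_funcsetE)
  moreover have "finite T" unfolding T_def by (intro finite_imageI finite_PiE) auto
  moreover have "\<exists>\<tau>\<in>T. \<exists>m\<in>M. f = \<tau> + s * m" if f: "f \<in> M" for f
  proof -
    have sum_upd: "(\<Sum>i<r. \<iota> (c i) * (u(r := f)) i) = (\<Sum>i<r. \<iota> (c i) * u i)" for c
      by (rule sum.cong) auto
    have "\<forall>i<Suc r. (u(r := f)) i \<in> M" using indep_M[OF u] f by (auto simp: less_Suc_eq)
    with max[of "u(r := f)"] have "\<exists>c. (\<exists>m\<in>M. (\<Sum>i<Suc r. \<iota> (c i) * (u(r := f)) i) = s * m) \<and>
        \<not> (\<forall>i<Suc r. c i = 0)"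
      unfolding indep_def by blast
    then obtain c m where m: "m \<in> M"
      and eq: "(\<Sum>i<Suc r. \<iota> (c i) * (u(r := f)) i) = s * m" and nz: "\<not> (\<forall>i<Suc r. c i = 0)"
      by (elim exE conjE bexE)
    from eq have eq': "(\<Sum>i<r. \<iota> (c i) * u i) + \<iota> (c r) * f = s * m"
      using sum_upd[of c] by simp
    have cr: "c r \<noteq> 0"
    proof
      assume "c r = 0"
      with eq' m have "\<exists>m\<in>M. (\<Sum>i<r. \<iota> (c i) * u i) = s * m" by auto
      from indep_D[OF u this] \<open>c r = 0\<close> nz show False by (auto simp: less_Suc_eq)
    qed
    define c' where "c' = restrict (\<lambda>i. - c i / c r) {..<r}"
    have "\<iota> (c r) * (\<Sum>i<r. \<iota> (c' i) * u i) = - (\<Sum>i<r. \<iota> (c i) * u i)"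
      unfolding sum_distrib_left sum_negf[symmetric]
      by (rule sum.cong) (use cr in \<open>auto simp: c'_def hom_divide hom_uminus\<close>)
    hence "\<iota> (c r) * f = \<iota> (c r) * ((\<Sum>i<r. \<iota> (c' i) * u i) + s * (\<iota> (inverse (c r)) * m))"
      using eq' cr by (simp add: distrib_left hom_inverse algebra_simps)
    hence "f = (\<Sum>i<r. \<iota> (c' i) * u i) + s * (\<iota> (inverse (c r)) * m)" using cr by simp
    moreover have "(\<Sum>i<r. \<iota> (c' i) * u i) \<in> T" unfolding T_def
      by (rule imageI) (auto simp: c'_def split: if_splits)
    ultimately show ?thesis using M_const_mult[OF m] by blast
  qed
  ultimately show ?thesis using less[OF u] by blast
qed

end

context valuations begin

text \<open>
  Iterating the previous bound along the filtration of \<open>s\<^sup>-\<^sup>n M\<close> by the modules \<open>s\<^sup>-\<^sup>j M\<close>.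
\<close>

lemma finite_codim_steps:
  assumes "s \<noteq> 0" "finite T" "card T \<le> q ^ r" "\<forall>f\<in>M. \<exists>\<tau>\<in>T. \<exists>m\<in>M. f = \<tau> + s * m"
  shows "\<exists>S. finite S \<and> card S \<le> q ^ (r * n) \<and> (\<forall>f::'k. s ^ n * f \<in> M \<longrightarrow> (\<exists>\<tau>\<in>S. f - \<tau> \<in> M))"
proof (induction n)
  case 0
  show ?case by (intro exI[of _ "{0}"]) auto
next
  case (Suc n)
  then obtain S where S: "finite S" "card S \<le> q ^ (r * n)"
    "\<And>f. s ^ n * f \<in> M \<Longrightarrow> \<exists>\<tau>\<in>S. f - \<tau> \<in> M" by blast
  define S' where "S' = (\<lambda>(\<tau>, \<sigma>). \<tau> / s ^ Suc n + \<sigma>) ` (T \<times> S)"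
  have "card S' \<le> card (T \<times> S)" unfolding S'_def using S assms by (intro card_image_le) auto
  also have "\<dots> \<le> q ^ r * q ^ (r * n)"
    unfolding card_cartesian_product using S(2) assms(3) by (rule mult_le_mono[rotated])
  finally have "card S' \<le> q ^ (r * Suc n)" by (simp add: power_add)
  moreover have "\<exists>\<sigma>\<in>S'. f - \<sigma> \<in> M" if f: "s ^ Suc n * f \<in> M" for f
  proof -
    obtain \<tau> m where \<tau>: "\<tau> \<in> T" "m \<in> M" "s ^ Suc n * f = \<tau> + s * m"
      using assms(4) f by blast
    have "s ^ n * (f - \<tau> / s ^ Suc n) = m"
      using \<tau>(3) assms(1) by (simp add: field_simps)
    with S(3)[of "f - \<tau> / s ^ Suc n"] \<tau> obtain \<sigma> where "\<sigma> \<in> S" "f - \<tau> / s ^ Suc n - \<sigma> \<in> M" by auto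
    with \<tau>(1) show ?thesis unfolding S'_def
      by (intro bexI[of _ "\<tau> / s ^ Suc n + \<sigma>"] image_eqI[of _ _ "(\<tau>, \<sigma>)"]) (auto simp: diff_diff_eq)
  qed
  moreover have "finite S'" unfolding S'_def using S assms by auto
  ultimately show ?case by blast
qed

text \<open>
  Functions whose poles lie among the zeros of \<open>s\<close>, with orders at most \<open>n\<close> times the orders of these
  zeros.
\<close>

definition poles_bounded :: "'k \<Rightarrow> nat \<Rightarrow> 'k set" where
  "poles_bounded s n = {f. \<forall>P\<in>C. f \<in> val_ge (v P) (- (int n * max 0 (v P s)))}"

lemma poles_boundedD: "f \<in> poles_bounded s n \<Longrightarrow> P \<in> C \<Longrightarrow> f \<in> val_ge (v P) (- (int n * max 0 (v P s)))"
  by (simp add: poles_bounded_def)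

lemma poles_bounded_mult:
  assumes "f \<in> poles_bounded s m" "g \<in> poles_bounded s n"
  shows "f * g \<in> poles_bounded s (m + n)"
  unfolding poles_bounded_def
proof safe
  fix P assume P: "P \<in> C"
  interpret V: discrete_valuation \<iota> "v P" using valuation[OF P] .
  show "f * g \<in> val_ge (v P) (- (int (m + n) * max 0 (v P s)))"
    using V.val_ge_mult[OF poles_boundedD[OF assms(1) P] poles_boundedD[OF assms(2) P]]
    by (simp add: algebra_simps)
qed

lemma poles_bounded_mono:
  assumes "f \<in> poles_bounded s m" "m \<le> n"
  shows "f \<in> poles_bounded s n"
  unfolding poles_bounded_def
proof safe
  fix P assume P: "P \<in> C"
  have "int m * max 0 (v P s) \<le> int n * max 0 (v P s)" using assms(2) by (intro mult_right_mono) auto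
  thus "f \<in> val_ge (v P) (- (int n * max 0 (v P s)))"
    using discrete_valuation.val_ge_mono[OF valuation[OF P] poles_boundedD[OF assms(1) P]] by simp
qed

lemma poles_bounded_const_mult: "f \<in> poles_bounded s n \<Longrightarrow> \<iota> c * f \<in> poles_bounded s n"
  unfolding poles_bounded_def by (auto intro!: discrete_valuation.val_ge_const_mult[OF valuation])

lemma poles_bounded_sum:
  "(\<And>i. i \<in> A \<Longrightarrow> f i \<in> poles_bounded s n) \<Longrightarrow> sum f A \<in> poles_bounded s n"
  unfolding poles_bounded_def by (auto intro!: discrete_valuation.val_ge_sum[OF valuation])

lemma poles_bounded_inverse_power: "s \<noteq> 0 \<Longrightarrow> inverse s ^ j \<in> poles_bounded s j"
  unfolding poles_bounded_def
proof safe
  fix P assume P: "P \<in> C" and s: "s \<noteq> 0"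
  interpret V: discrete_valuation \<iota> "v P" using valuation[OF P] .
  have "inverse s \<in> val_ge (v P) (- max 0 (v P s))" using s by (auto simp: val_ge_def V.val_inverse)
  from V.val_ge_power[OF this] show "inverse s ^ j \<in> val_ge (v P) (- (int j * max 0 (v P s)))" by simp
qed

lemma common_multiplier_into_regular:
  fixes b :: "nat \<Rightarrow> 'k"
  assumes "Q0 \<in> C" "s \<noteq> 0" "v Q0 s > 0"
  shows "\<exists>a N. a \<noteq> 0 \<and> (\<forall>l<n. a * b l \<in> poles_bounded s N)"
proof -
  have "\<exists>a N. a \<noteq> 0 \<and> a \<in> poles_bounded s N \<and> (\<forall>l<n. a * b l \<in> poles_bounded s N)"
  proof (induction n)
    case 0
    have "1 \<in> poles_bounded s 0" using poles_bounded_inverse_power[of s 0] assms by simp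
    thus ?case by (intro exI[of _ "1::'k"] exI[of _ "0::nat"]) auto
  next
    case (Suc n)
    then obtain a N where a: "a \<noteq> 0" "a \<in> poles_bounded s N" "\<forall>l<n. a * b l \<in> poles_bounded s N"
      by blast
    have "\<exists>a' M M'. a' \<noteq> 0 \<and> a' \<in> poles_bounded s M \<and> a' * b n \<in> poles_bounded s M'"
      using multiplier_into_regular[OF assms, of "b n"] by (auto simp: poles_bounded_def)
    then obtain a' M M' where a': "a' \<noteq> 0" "a' \<in> poles_bounded s M" "a' * b n \<in> poles_bounded s M'"
      by blast
    have "a' * (a * b l) \<in> poles_bounded s (M + N)" if "l < n" for l
      using poles_bounded_mult[of a' s M "a * b l" N] a a' that by simp
    hence 1: "(a' * a) * b l \<in> poles_bounded s (M + N + M')" if "l < n" for l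
      using poles_bounded_mono[of _ s "M + N" "M + N + M'"] that by (simp add: mult.assoc)
    have "a * (a' * b n) \<in> poles_bounded s (N + M')" using poles_bounded_mult a a' by blast
    hence 2: "(a' * a) * b n \<in> poles_bounded s (M + N + M')"
      using poles_bounded_mono[of _ s "N + M'" "M + N + M'"] by (simp add: mult_ac)
    have "a' * a \<in> poles_bounded s (M + N)" using poles_bounded_mult a a' by blast
    hence "a' * a \<in> poles_bounded s (M + N + M')" by (rule poles_bounded_mono) simp
    with 1 2 a(1) a'(1) show ?case
      by (intro exI[of _ "a' * a"] exI[of _ "M + N + M'"]) (auto simp: less_Suc_eq)
  qed
  thus ?thesis by blast
qed

text \<open>
  For a family \<open>b\<close> of maximal length \<open>D\<close> that is independent over \<open>k[y]\<close>, and suitably scaled, the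
  combinations \<open>\<Sum>l<D. \<Sum>j\<le>N. c l j * y ^ j * b l\<close> are \<open>q ^ (D * (N + 1))\<close> functions whose poles are
  poles of \<open>y\<close>.  They fall into at most \<open>q ^ (r * (N + N0))\<close> classes modulo \<open>M\<close>, where \<open>r < D\<close>, and two
  members of a class differ by a function that is regular outside \<open>Q0\<close>.  If there were only finitely
  many such functions, this would be impossible for large \<open>N\<close>.
\<close>

theorem infinite_regular_outside_point:
  assumes "Q0 \<in> C" and sep: "\<forall>P\<in>C - {Q0}. \<exists>x. x \<noteq> 0 \<and> v P x \<noteq> v Q0 x"
  shows "infinite {f. \<forall>P\<in>C - {Q0}. f \<in> val_ge (v P) 0}" (is "infinite ?R")
proof
  assume fin: "finite ?R"
  interpret V0: discrete_valuation \<iota> "v Q0" using valuation assms by auto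
  obtain s where s: "s \<noteq> 0" "v Q0 s = 1" using V0.val_surj by blast
  define y where "y = inverse s"
  define M where "M = {f. \<forall>P\<in>C - {Q0}. v P s > 0 \<longrightarrow> f \<in> val_ge (v P) 0}"
  obtain z where z: "z \<noteq> 0" "v Q0 z < 0" "\<forall>P\<in>C - {Q0}. v P s > 0 \<longrightarrow> v P z \<ge> 0"
    using separate_from_other_poles[of Q0 s] assms s by auto
  define n0 where "n0 = (LEAST n. \<forall>u. poly_dep \<iota> s u n)"
  have n0: "\<forall>u. poly_dep \<iota> s u n0" unfolding n0_def using finite_rank by (rule LeastI_ex)
  have "n0 \<noteq> 0"
  proof
    assume "n0 = 0"
    with n0 have "poly_dep \<iota> s (\<lambda>_. 0) 0" by metis
    thus False by (simp add: poly_dep_def)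
  qed
  then obtain D where D: "n0 = Suc D" using not0_implies_Suc by blast
  obtain b where b: "\<not> poly_dep \<iota> s b D"
    using not_less_Least[of D "\<lambda>n. \<forall>u. poly_dep \<iota> s u n"] D unfolding n0_def by auto
  have "\<exists>r T. r < D \<and> finite T \<and> card T \<le> CARD('a) ^ r \<and> (\<forall>f\<in>M. \<exists>\<tau>\<in>T. \<exists>m\<in>M. f = \<tau> + s * m)"
  proof (rule finite_codim_one_step)
    show "\<iota> c * f \<in> M" if "f \<in> M" for c f
      using that unfolding M_def by (auto intro!: discrete_valuation.val_ge_const_mult[OF valuation])
    show "f + g \<in> M" if "f \<in> M" "g \<in> M" for f g
      using that unfolding M_def by (auto intro!: discrete_valuation.val_ge_add[OF valuation])
    show "s * f \<in> M" if "f \<in> M" for f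
      unfolding M_def
    proof safe
      fix P assume P: "P \<in> C" "P \<noteq> Q0" "v P s > 0"
      interpret V: discrete_valuation \<iota> "v P" using valuation[OF P(1)] .
      have "s \<in> val_ge (v P) 0" using P by (auto simp: val_ge_def)
      moreover have "f \<in> val_ge (v P) 0" using that P by (auto simp: M_def)
      ultimately show "s * f \<in> val_ge (v P) 0" by (rule V.val_ge_mult0)
    qed
    show "z ^ k \<in> M" for k unfolding M_def
    proof safe
      fix P assume P: "P \<in> C" "P \<noteq> Q0" "v P s > 0"
      interpret V: discrete_valuation \<iota> "v P" using valuation[OF P(1)] .
      show "z ^ k \<in> val_ge (v P) 0" using z P by (intro V.val_ge_power0) (auto simp: val_ge_def)
    qed
    show "0 \<in> M" by (simp add: M_def val_ge_def)
    show "\<forall>u. poly_dep \<iota> s u (Suc D)" using n0 D by simp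
  qed (use s z assms in auto)
  then obtain r T where T: "r < D" "finite T" "card T \<le> CARD('a) ^ r"
    "\<forall>f\<in>M. \<exists>\<tau>\<in>T. \<exists>m\<in>M. f = \<tau> + s * m" by blast
  obtain a N0 where a: "a \<noteq> 0" "\<forall>l<D. a * b l \<in> poles_bounded s N0"
    using common_multiplier_into_regular[of Q0 s D b] assms s by auto
  define q where "q = CARD('a)"
  define \<rho> where "\<rho> = card ?R"
  have bound: "q ^ (D * Suc N) \<le> q ^ (r * (N + N0)) * \<rho>" for N
  proof -
    obtain S where S: "finite S" "card S \<le> q ^ (r * (N + N0))"
      and S_cover: "\<And>f. s ^ (N + N0) * f \<in> M \<Longrightarrow> \<exists>\<tau>\<in>S. f - \<tau> \<in> M"
      using finite_codim_steps[OF s(1) T(2,3,4), of "N + N0"] unfolding q_def by blast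
    define Y where "Y = ({..<D} \<times> {..N}) \<rightarrow>\<^sub>E (UNIV :: 'a set)"
    define g where "g c = (\<Sum>l<D. \<Sum>j\<le>N. \<iota> (c (l, j)) * y ^ j * (a * b l))" for c
    have g_diff: "g c - g c' = (\<Sum>l<D. \<Sum>j\<le>N. \<iota> (c (l, j) - c' (l, j)) * y ^ j * (a * b l))" for c c'
      unfolding g_def by (simp add: hom_diff left_diff_distrib sum_subtractf)
    have "inj_on g Y"
    proof (rule inj_onI, rule ccontr)
      fix c c' assume c: "c \<in> Y" "c' \<in> Y" "g c = g c'" "c \<noteq> c'"
      have "\<exists>x\<in>{..<D} \<times> {..N}. c x \<noteq> c' x"
        using c(1,2,4) unfolding Y_def by (metis PiE_ext)
      hence ex: "\<exists>l<D. \<exists>j\<le>N. c (l, j) - c' (l, j) \<noteq> 0" by force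
      have "a * (\<Sum>l<D. \<Sum>j\<le>N. \<iota> (c (l, j) - c' (l, j)) * y ^ j * b l) = g c - g c'"
        unfolding g_diff by (simp add: sum_distrib_left mult_ac)
      hence "(\<Sum>l<D. \<Sum>j\<le>N. \<iota> (c (l, j) - c' (l, j)) * y ^ j * b l) = 0"
        using c(3) a(1) by simp
      with ex have "poly_dep \<iota> y b D" unfolding poly_dep_def
        by (intro exI[of _ N] exI[of _ "\<lambda>l j. c (l, j) - c' (l, j)"]) simp
      hence "poly_dep \<iota> (inverse y) b D" using s by (intro poly_dep_inverse) (auto simp: y_def)
      with b show False by (simp add: y_def)
    qed
    have g_bounded: "g c \<in> poles_bounded s (N + N0)" for c
      unfolding g_def
    proof (intro poles_bounded_sum)
      fix l j assume lj: "l \<in> {..<D}" "j \<in> {..N}"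
      have "y ^ j * (a * b l) \<in> poles_bounded s (j + N0)"
        using a lj s unfolding y_def by (intro poles_bounded_mult poles_bounded_inverse_power) auto
      hence "y ^ j * (a * b l) \<in> poles_bounded s (N + N0)" by (rule poles_bounded_mono) (use lj in auto)
      thus "\<iota> (c (l, j)) * y ^ j * (a * b l) \<in> poles_bounded s (N + N0)"
        unfolding mult.assoc by (rule poles_bounded_const_mult)
    qed
    have g_M: "s ^ (N + N0) * g c \<in> M" for c
      unfolding M_def
    proof safe
      fix P assume P: "P \<in> C" "P \<noteq> Q0" "v P s > 0"
      interpret V: discrete_valuation \<iota> "v P" using valuation[OF P(1)] .
      have "s ^ (N + N0) \<in> val_ge (v P) (int (N + N0) * v P s)" using s
        by (intro V.val_ge_power) (auto simp: val_ge_def)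
      from V.val_ge_mult[OF this poles_boundedD[OF g_bounded P(1)]] P(3)
      show "s ^ (N + N0) * g c \<in> val_ge (v P) 0" by simp
    qed
    hence "\<forall>c. \<exists>\<tau>\<in>S. g c - \<tau> \<in> M" using S_cover by blast
    then obtain \<tau> where \<tau>: "\<And>c. \<tau> c \<in> S" "\<And>c. g c - \<tau> c \<in> M" by metis
    have diff: "g c - g c' \<in> ?R" if eq: "\<tau> c = \<tau> c'" for c c'
    proof (intro CollectI ballI)
      fix P assume "P \<in> C - {Q0}"
      hence P: "P \<in> C" "P \<noteq> Q0" by auto
      interpret V: discrete_valuation \<iota> "v P" using valuation[OF P(1)] .
      show "g c - g c' \<in> val_ge (v P) 0"
      proof (cases "v P s > 0")
        case True
        hence "g c - \<tau> c \<in> val_ge (v P) 0" "g c' - \<tau> c' \<in> val_ge (v P) 0"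
          using \<tau>(2)[of c] \<tau>(2)[of c'] P by (auto simp: M_def)
        hence "(g c - \<tau> c) - (g c' - \<tau> c') \<in> val_ge (v P) 0" by (rule V.val_ge_diff)
        thus ?thesis using eq by simp
      next
        case False
        thus ?thesis using poles_boundedD[OF g_bounded P(1), of c] poles_boundedD[OF g_bounded P(1), of c']
          by (intro V.val_ge_diff) auto
      qed
    qed
    have "finite Y" unfolding Y_def by (intro finite_PiE) auto
    from card_le_by_cosets[OF this S(1) fin \<open>inj_on g Y\<close> \<tau>(1) diff]
    have "card Y \<le> card S * card ?R" .
    also have "\<dots> \<le> q ^ (r * (N + N0)) * \<rho>" using S(2) by (simp add: \<rho>_def)
    finally show ?thesis by (simp add: Y_def card_funcsetE card_cartesian_product q_def)
  qed
  have "card {0, 1 :: 'a} \<le> q" unfolding q_def by (intro card_mono) auto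
  hence q: "q \<ge> 2" by simp
  \<comment> \<open>beyond this degree the number of combinations exceeds the number of classes times \<open>\<rho>\<close>\<close>
  define N where "N = r * N0 + \<rho>"
  have "q ^ (D * Suc N) \<le> q ^ (r * (N + N0)) * \<rho>" by (rule bound)
  also have "\<dots> < q ^ (r * (N + N0)) * q ^ \<rho>"
    using q by (intro mult_strict_left_mono) (auto intro: less_le_trans[OF less_exp] power_mono)
  finally have "q ^ (D * Suc N) < q ^ (r * (N + N0) + \<rho>)" by (simp add: power_add)
  hence "D * Suc N < r * (N + N0) + \<rho>" using q by simp
  moreover have "Suc r * Suc N \<le> D * Suc N" using T(1) by (intro mult_right_mono) auto
  ultimately show False by (simp add: N_def algebra_simps)
qed

end

section \<open>Absolute maximal elements and bases of Riemann-Roch spaces\<close>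

sublocale field_hom \<subseteq> vs: vector_space "scale \<iota>"
  by unfold_locales (auto simp: scale_def hom_one hom_add hom_mult algebra_simps)

text \<open>
  Over a finite field, finite generation is finiteness; dimension bounds become bounds on cardinality.
\<close>

lemma span_of_finite:
  fixes \<iota> :: "'a::{field,finite} \<Rightarrow> 'k::field"
  assumes "field_hom \<iota>" "finite B"
  shows "finite (module.span (scale \<iota>) B)"
    and "card (module.span (scale \<iota>) B) \<le> CARD('a) ^ card B"
proof -
  interpret field_hom \<iota> by fact
  let ?g = "\<lambda>u. \<Sum>b\<in>B. scale \<iota> (u b) b" and ?U = "B \<rightarrow>\<^sub>E (UNIV :: 'a set)"
  have "vs.span B \<subseteq> ?g ` ?U"
  proof
    fix x assume "x \<in> vs.span B"
    then obtain u where "x = ?g u" using vs.span_finite[OF assms(2)] by auto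
    hence "x = ?g (restrict u B)" by simp
    thus "x \<in> ?g ` ?U" by (rule image_eqI[where f = ?g]) auto
  qed
  moreover have "finite ?U" using assms by (intro finite_PiE) auto
  ultimately show "finite (vs.span B)" "card (vs.span B) \<le> CARD('a) ^ card B"
    using surj_card_le[of ?U "vs.span B" ?g] assms(2)
    by (auto intro: finite_subset simp: card_funcsetE)
qed

text \<open>
  The assumption \<open>rational\<close> says that the residue field at each \<open>Q i\<close> is the ground field.
\<close>

locale pole_orders = valuations \<iota> C v
  for \<iota> :: "'a::{field,finite} \<Rightarrow> 'k::field" and C :: "'p set" and v :: "'p \<Rightarrow> 'k \<Rightarrow> int" +
  fixes Q :: "'m::finite \<Rightarrow> 'p"
  assumes Q_in: "Q i \<in> C"
    and rational: "f \<in> val_ge (v (Q i)) 0 \<Longrightarrow> \<exists>c. f - \<iota> c \<in> val_ge (v (Q i)) 1"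
    and separated: "P \<in> C \<Longrightarrow> P \<noteq> Q i \<Longrightarrow> \<exists>x. x \<noteq> 0 \<and> v P x \<noteq> v (Q i) x"
begin

definition reg :: "'k set" where
  "reg = {f. \<forall>P\<in>C - range Q. f \<in> val_ge (v P) 0}"

definition \<rho> :: "'k \<Rightarrow> 'm \<Rightarrow> int" where
  "\<rho> f = (\<lambda>i. - v (Q i) f)"

definition H :: "('m \<Rightarrow> int) set" where
  "H = \<rho> ` (reg - {0})"

definition L :: "('m \<Rightarrow> int) \<Rightarrow> 'k set" where
  "L \<alpha> = {f \<in> reg. \<forall>i. f \<in> val_ge (v (Q i)) (- \<alpha> i)}"

lemma val_Q: "discrete_valuation \<iota> (v (Q i))"
  using Q_in valuation by blast

lemma L_iff: "f \<noteq> 0 \<Longrightarrow> f \<in> L \<alpha> \<longleftrightarrow> f \<in> reg \<and> \<rho> f \<le> \<alpha>"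
  unfolding L_def \<rho>_def val_ge_def le_fun_def mem_Collect_eq by (metis minus_le_iff)

lemma zero_in_L: "0 \<in> L \<alpha>" by (simp add: L_def reg_def val_ge_def)

lemma reg_add: "f \<in> reg \<Longrightarrow> g \<in> reg \<Longrightarrow> f + g \<in> reg"
  unfolding reg_def by (auto intro!: discrete_valuation.val_ge_add[OF valuation])

lemma reg_const_mult: "f \<in> reg \<Longrightarrow> \<iota> c * f \<in> reg"
  unfolding reg_def by (auto intro!: discrete_valuation.val_ge_const_mult[OF valuation])

lemma L_add: "f \<in> L \<alpha> \<Longrightarrow> g \<in> L \<alpha> \<Longrightarrow> f + g \<in> L \<alpha>"
  unfolding L_def by (auto intro!: discrete_valuation.val_ge_add[OF val_Q] reg_add)

lemma L_const_mult: "f \<in> L \<alpha> \<Longrightarrow> \<iota> c * f \<in> L \<alpha>"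
  unfolding L_def by (auto intro!: discrete_valuation.val_ge_const_mult[OF val_Q] reg_const_mult)

lemma L_diff_const_mult: "f \<in> L \<alpha> \<Longrightarrow> g \<in> L \<alpha> \<Longrightarrow> f - \<iota> c * g \<in> L \<alpha>"
  using L_add[of f \<alpha> "\<iota> (- c) * g"] L_const_mult[of g \<alpha> "- c"] by (simp add: hom_uminus)

lemma subspace_L: "vs.subspace (L \<alpha>)"
  by (rule vs.subspaceI) (auto simp: zero_in_L L_add scale_def L_const_mult)

lemma subspace_reg: "vs.subspace reg"
  by (rule vs.subspaceI) (auto simp: reg_add scale_def reg_const_mult, simp add: reg_def val_ge_def)

text \<open>
  The quotient \<open>f / g\<close> is a unit at \<open>Q i\<close>, and \<open>c\<close> is its residue.
\<close>

lemma cancel_leading_term: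
  assumes "f \<noteq> 0" "g \<noteq> 0" "\<rho> f i = \<rho> g i"
  shows "\<exists>c. c \<noteq> 0 \<and> f - \<iota> c * g \<in> val_ge (v (Q i)) (v (Q i) f + 1)"
proof -
  interpret V: discrete_valuation \<iota> "v (Q i)" by (rule val_Q)
  have "f / g \<noteq> 0" "v (Q i) (f / g) = 0" using assms by (auto simp: V.val_divide \<rho>_def)
  hence 0: "f / g \<in> val_ge (v (Q i)) 0" "f / g \<notin> val_ge (v (Q i)) 1" by (auto simp: val_ge_def)
  from rational[OF this(1)] obtain c where c: "f / g - \<iota> c \<in> val_ge (v (Q i)) 1" by blast
  have "g * (f / g - \<iota> c) \<in> val_ge (v (Q i)) (v (Q i) g + 1)"
    using V.val_ge_mult_cancel[OF assms(2), of "f / g - \<iota> c" 1] c by blast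
  moreover have "g * (f / g - \<iota> c) = f - \<iota> c * g" using assms by (simp add: field_simps)
  moreover have "c \<noteq> 0" using c 0 by auto
  ultimately show ?thesis using assms by (auto simp: \<rho>_def)
qed

text \<open>
  Such a function has no poles, so it cannot have zeros at the points \<open>Q i\<close>.
\<close>

lemma L_negative:
  assumes "\<And>i. \<alpha> i < 0"
  shows "L \<alpha> = {0}"
proof -
  have "f = 0" if "f \<in> L \<alpha>" for f
  proof (rule ccontr)
    assume f: "f \<noteq> 0"
    have pos: "v (Q i) f > 0" for i
    proof -
      have "f \<in> val_ge (v (Q i)) (- \<alpha> i)" using that by (simp add: L_def)
      with f assms[of i] show ?thesis by (simp add: val_ge_def)
    qed
    have "v P f \<ge> 0" if P: "P \<in> C" for P
      using \<open>f \<in> L \<alpha>\<close> f P pos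
        by (cases "P \<in> range Q") (auto simp: L_def reg_def val_ge_def intro: less_imp_le)
    hence "v (Q undefined) f = 0" using no_zeros_without_poles f Q_in by blast
    with pos show False by (metis less_irrefl)
  qed
  thus ?thesis using zero_in_L by auto
qed

text \<open>
  Induction on the number of steps that make all coordinates negative.  Lowering one coordinate
  \<open>\<alpha> i\<close> by one yields a subspace such that all remaining functions have the same order at \<open>Q i\<close>, so
  that they are multiples of one of them modulo the subspace.
\<close>

lemma finite_L: "finite (L \<alpha>)"
proof (induction "\<Sum>i\<in>UNIV. nat (\<alpha> i + 1)" arbitrary: \<alpha> rule: less_induct)
  case (less \<alpha>)
  show ?case
  proof (cases "\<forall>i. \<alpha> i < 0")
    case True
    thus ?thesis using L_negative[of \<alpha>] by simp
  next
    case False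
    then obtain i where i: "\<alpha> i \<ge> 0" by (auto simp: not_less)
    define \<alpha>' where "\<alpha>' = \<alpha>(i := \<alpha> i - 1)"
    have "(\<Sum>i\<in>UNIV. nat (\<alpha>' i + 1)) < (\<Sum>i\<in>UNIV. nat (\<alpha> i + 1))"
      by (rule sum_strict_mono_ex1) (use i in \<open>auto simp: \<alpha>'_def intro!: exI[of _ i]\<close>)
    hence fin: "finite (L \<alpha>')" by (rule less)
    have step: "f \<in> L \<alpha>'" if "f \<in> L \<alpha>" "f \<in> val_ge (v (Q i)) (- \<alpha> i + 1)" for f
      using that by (auto simp: L_def \<alpha>'_def)
    show ?thesis
    proof (cases "L \<alpha> \<subseteq> L \<alpha>'")
      case True
      thus ?thesis using fin finite_subset by blast
    next
      case False
      then obtain g where g: "g \<in> L \<alpha>" "g \<notin> L \<alpha>'" by blast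
      have val: "v (Q i) f = - \<alpha> i" "f \<noteq> 0" if "f \<in> L \<alpha>" "f \<notin> L \<alpha>'" for f
      proof -
        show "f \<noteq> 0" using that zero_in_L by blast
        moreover have "f \<in> val_ge (v (Q i)) (- \<alpha> i)" using that(1) by (simp add: L_def)
        moreover have "f \<notin> val_ge (v (Q i)) (- \<alpha> i + 1)" using step that by blast
        ultimately show "v (Q i) f = - \<alpha> i" by (auto simp: val_ge_def)
      qed
      have "\<exists>c. f - \<iota> c * g \<in> L \<alpha>'" if f: "f \<in> L \<alpha>" for f
      proof (cases "f \<in> L \<alpha>'")
        case True
        thus ?thesis by (intro exI[of _ 0]) simp
      next
        case False
        have "\<exists>c. c \<noteq> 0 \<and> f - \<iota> c * g \<in> val_ge (v (Q i)) (v (Q i) f + 1)"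
          using val f g False by (intro cancel_leading_term) (auto simp: \<rho>_def)
        then obtain c where "f - \<iota> c * g \<in> val_ge (v (Q i)) (- \<alpha> i + 1)"
          using val[OF f False] by auto
        thus ?thesis using step L_diff_const_mult[OF f g(1)] by blast
      qed
      hence "L \<alpha> \<subseteq> (\<lambda>(h, c). h + \<iota> c * g) ` (L \<alpha>' \<times> UNIV)"
        by (force simp: image_iff)
      thus ?thesis by (rule finite_subset) (use fin in auto)
    qed
  qed
qed

text \<open>
  An element minimising the sum of the pole orders, among the functions of \<open>L \<alpha>\<close> with prescribed pole
  order at \<open>Q i\<close>, has absolute maximal pole orders.  Finiteness of \<open>L \<alpha>\<close> provides the minimum.
\<close>

lemma absolute_maximal_with_coordinate:
  assumes "f \<in> L \<alpha>" "f \<noteq> 0"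
  shows "\<exists>g. g \<in> L \<alpha> \<and> g \<noteq> 0 \<and> \<rho> g \<in> absolute_maximal H \<and> \<rho> g i = \<rho> f i"
proof -
  define S where "S = {g \<in> L \<alpha> - {0}. \<rho> g i = \<rho> f i}"
  define size where "size g = (\<Sum>j\<in>UNIV. \<rho> g j)" for g
  have S: "finite S" "f \<in> S" using finite_L assms by (auto simp: S_def)
  define g where "g = arg_min_on size S"
  have g: "g \<in> S" unfolding g_def using S by (intro arg_min_if_finite) auto
  have min: "size g \<le> size h" if "h \<in> S" for h
    unfolding g_def using S that by (intro arg_min_least) auto
  from g have g': "g \<in> L \<alpha>" "g \<noteq> 0" "\<rho> g i = \<rho> f i" by (auto simp: S_def)
  have "nabla H J (\<rho> g) = {}" if J: "J \<noteq> {}" "J \<noteq> UNIV" for J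
  proof (rule ccontr)
    assume "nabla H J (\<rho> g) \<noteq> {}"
    then obtain h where h: "h \<in> reg" "h \<noteq> 0" "\<And>j. j \<in> J \<Longrightarrow> \<rho> h j = \<rho> g j"
      "\<And>j. j \<notin> J \<Longrightarrow> \<rho> h j < \<rho> g j"
      by (auto simp: nabla_def H_def)
    have le: "\<rho> h j \<le> \<rho> g j" for j using h(3,4)[of j] by (cases "j \<in> J") auto
    have "\<rho> h \<le> \<rho> g" using le by (simp add: le_fun_def)
    also have "\<rho> g \<le> \<alpha>" using g' L_iff by blast
    finally have hL: "h \<in> L \<alpha>" using h L_iff by blast
    show False
    proof (cases "i \<in> J")
      case True
      hence "h \<in> S" using hL h g' by (auto simp: S_def)
      moreover have "size h < size g" unfolding size_def
        by (rule sum_strict_mono_ex1) (use le h(4) J in auto)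
      ultimately show False using min by force
    next
      case False
      \<comment> \<open>cancelling the leading terms at a point of \<open>J\<close> leaves the order at \<open>Q i\<close> unchanged\<close>
      obtain j where j: "j \<in> J" using J by blast
      obtain c where c: "c \<noteq> 0" "g - \<iota> c * h \<in> val_ge (v (Q j)) (v (Q j) g + 1)"
        using cancel_leading_term[of g h j] g' h j by auto
      define x where "x = g - \<iota> c * h"
      have xL: "x \<in> L \<alpha>" unfolding x_def using g' hL by (intro L_diff_const_mult)
      interpret V: discrete_valuation \<iota> "v (Q i)" by (rule val_Q)
      have "- (\<iota> c * h) \<in> val_ge (v (Q i)) (v (Q i) g + 1)"
        using h(4)[OF False]
          by (intro V.val_ge_uminus V.val_ge_const_mult) (auto simp: \<rho>_def val_ge_def)
      from V.val_add_higher[OF g'(2) this] have x: "x \<noteq> 0" "\<rho> x i = \<rho> g i"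
        by (auto simp: x_def \<rho>_def)
      have "\<rho> x l \<le> \<rho> g l" for l
      proof -
        interpret V: discrete_valuation \<iota> "v (Q l)" by (rule val_Q)
        have "x \<in> val_ge (v (Q l)) (v (Q l) g)" unfolding x_def
          using le[of l] by (intro V.val_ge_diff V.val_ge_const_mult) (auto simp: val_ge_def \<rho>_def)
        thus ?thesis using x by (auto simp: val_ge_def \<rho>_def)
      qed
      moreover have "\<rho> x j < \<rho> g j" using c x unfolding x_def[symmetric]
        by (auto simp: val_ge_def \<rho>_def)
      ultimately have "size x < size g" unfolding size_def
        by (intro sum_strict_mono_ex1) auto
      moreover have "x \<in> S" using xL x g' by (auto simp: S_def)
      ultimately show False using min by force
    qed
  qed
  moreover have "\<rho> g \<in> H" using g' L_iff unfolding H_def by blast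
  ultimately show ?thesis using g' by (auto simp: absolute_maximal_def)
qed

lemma sum_distinct_orders_nonzero:
  assumes "finite S" "S \<noteq> {}" "0 \<notin> S" "inj_on (\<lambda>b. \<rho> b i) S" "\<And>b. b \<in> S \<Longrightarrow> c b \<noteq> 0"
  shows "(\<Sum>b\<in>S. \<iota> (c b) * b) \<noteq> 0"
proof -
  interpret V: discrete_valuation \<iota> "v (Q i)" by (rule val_Q)
  define b where "b = arg_min_on (v (Q i)) S"
  have b: "b \<in> S" unfolding b_def using assms by (intro arg_min_if_finite) auto
  have min: "v (Q i) b \<le> v (Q i) x" if "x \<in> S" for x
    unfolding b_def using assms that by (intro arg_min_least) auto
  have "b \<noteq> 0" "c b \<noteq> 0" using b assms(3,5) by auto
  hence lead: "\<iota> (c b) * b \<noteq> 0" "v (Q i) (\<iota> (c b) * b) = v (Q i) b"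
    by (simp_all add: V.val_mult V.val_const)
  have "(\<Sum>x\<in>S - {b}. \<iota> (c x) * x) \<in> val_ge (v (Q i)) (v (Q i) (\<iota> (c b) * b) + 1)"
  proof (intro V.val_ge_sum V.val_ge_const_mult)
    fix x assume x: "x \<in> S - {b}"
    hence "v (Q i) x \<noteq> v (Q i) b" using assms(4) b by (auto simp: inj_on_def \<rho>_def)
    with min[of x] x show "x \<in> val_ge (v (Q i)) (v (Q i) (\<iota> (c b) * b) + 1)"
      unfolding lead(2) by (auto simp: val_ge_def)
  qed
  from V.val_add_higher(1)[OF lead(1) this] show ?thesis
    using assms(1) b by (simp add: sum.remove)
qed

text \<open>
  Independence holds because the term of highest pole order dominates any linear combination.  For
  spanning, the pole order at \<open>Q i\<close> is lowered step by step with members of \<open>B\<close>; this ends as only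
  finitely many functions of \<open>L \<alpha>\<close> have smaller order.
\<close>

lemma basis_of_L:
  assumes "B \<subseteq> L \<alpha>" "0 \<notin> B" "inj_on (\<lambda>b. \<rho> b i) B"
    and hit: "\<And>f. f \<in> L \<alpha> \<Longrightarrow> f \<noteq> 0 \<Longrightarrow> \<exists>b\<in>B. \<rho> b i = \<rho> f i"
  shows "vs.independent B" "vs.span B = L \<alpha>"
proof -
  have "finite B" using assms(1) finite_L finite_subset by blast
  show "vs.independent B"
  proof
    assume "vs.dependent B"
    then obtain u where u: "\<exists>b\<in>B. u b \<noteq> 0" "(\<Sum>b\<in>B. scale \<iota> (u b) b) = 0"
      using vs.dependent_finite[OF \<open>finite B\<close>] by auto
    let ?S = "{b \<in> B. u b \<noteq> 0}"
    have "(\<Sum>b\<in>?S. \<iota> (u b) * b) = (\<Sum>b\<in>B. \<iota> (u b) * b)"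
      by (rule sum.mono_neutral_left) (use \<open>finite B\<close> in auto)
    hence "(\<Sum>b\<in>?S. \<iota> (u b) * b) = 0" using u(2) by (simp add: scale_def)
    moreover have "(\<Sum>b\<in>?S. \<iota> (u b) * b) \<noteq> 0"
      using \<open>finite B\<close> u assms(2,3)
      by (intro sum_distinct_orders_nonzero[where i = i]) (auto simp: inj_on_def)
    ultimately show False by simp
  qed
  have "vs.span B \<subseteq> L \<alpha>" using assms(1) subspace_L by (intro vs.span_minimal)
  moreover have "f \<in> vs.span B" if "f \<in> L \<alpha>" for f
    using that
  proof (induction "card {h \<in> L \<alpha>. h \<noteq> 0 \<and> \<rho> h i < \<rho> f i}" arbitrary: f rule: less_induct)
    case (less f)
    show ?case
    proof (cases "f = 0")
      case False
      obtain b where b: "b \<in> B" "\<rho> b i = \<rho> f i" using hit less.prems False by blast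
      have "b \<noteq> 0" using b assms(2) by blast
      obtain c where c: "f - \<iota> c * b \<in> val_ge (v (Q i)) (v (Q i) f + 1)"
        using cancel_leading_term[of f b i] False b \<open>b \<noteq> 0\<close> by auto
      let ?g = "f - \<iota> c * b"
      have gL: "?g \<in> L \<alpha>" using less.prems b assms(1) by (intro L_diff_const_mult) auto
      have "?g \<in> vs.span B"
      proof (cases "?g = 0")
        case False
        hence lt: "\<rho> ?g i < \<rho> f i" using c by (auto simp: val_ge_def \<rho>_def)
        have "card {h \<in> L \<alpha>. h \<noteq> 0 \<and> \<rho> h i < \<rho> ?g i} < card {h \<in> L \<alpha>. h \<noteq> 0 \<and> \<rho> h i < \<rho> f i}"
        proof (rule psubset_card_mono)
          show "{h \<in> L \<alpha>. h \<noteq> 0 \<and> \<rho> h i < \<rho> ?g i} \<subset> {h \<in> L \<alpha>. h \<noteq> 0 \<and> \<rho> h i < \<rho> f i}"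
            using gL False lt by force
        qed (use finite_L in auto)
        thus ?thesis using gL by (rule less.hyps)
      qed (simp only: vs.span_zero)
      hence "?g + scale \<iota> c b \<in> vs.span B"
        by (rule vs.span_add[OF _ vs.span_scale[OF vs.span_base[OF b(1)]]])
      thus ?thesis by (simp add: scale_def)
    qed (simp only: vs.span_zero)
  qed
  ultimately show "vs.span B = L \<alpha>" by blast
qed

definition max_classes :: "('m \<Rightarrow> int) \<Rightarrow> 'm \<Rightarrow> ('m \<Rightarrow> int) set set" where
  "max_classes \<alpha> i = (let \<Gamma>\<alpha> = {\<beta> \<in> absolute_maximal H. \<beta> \<le> \<alpha>}
     in \<Gamma>\<alpha> // {(\<beta>, \<beta>'). \<beta> \<in> \<Gamma>\<alpha> \<and> \<beta>' \<in> \<Gamma>\<alpha> \<and> \<beta> i = \<beta>' i})"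

lemma max_classes_iff:
  "K \<in> max_classes \<alpha> i \<longleftrightarrow> (\<exists>\<beta>\<in>absolute_maximal H. \<beta> \<le> \<alpha> \<and>
     K = {\<beta>' \<in> absolute_maximal H. \<beta>' \<le> \<alpha> \<and> \<beta>' i = \<beta> i})"
  unfolding max_classes_def Let_def quotient_def by (fastforce simp: Image_def)

text \<open>
  Functions chosen from distinct classes have distinct pole orders at \<open>Q i\<close>, and by
  \<open>absolute_maximal_with_coordinate\<close> every order that occurs in \<open>L \<alpha>\<close> is that of a class.
\<close>

lemma class_choice:
  assumes "\<forall>K\<in>max_classes \<alpha> i. \<phi> K \<in> reg - {0} \<and> \<rho> (\<phi> K) \<in> K"
  shows "inj_on \<phi> (max_classes \<alpha> i)" "vs.independent (\<phi> ` max_classes \<alpha> i)"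
    "vs.span (\<phi> ` max_classes \<alpha> i) = L \<alpha>" "finite (max_classes \<alpha> i)"
proof -
  have eq: "K = K'"
    if K: "K \<in> max_classes \<alpha> i" "K' \<in> max_classes \<alpha> i" "\<rho> (\<phi> K) i = \<rho> (\<phi> K') i" for K K'
  proof -
    obtain \<beta> \<beta>' where \<beta>: "K = {\<gamma> \<in> absolute_maximal H. \<gamma> \<le> \<alpha> \<and> \<gamma> i = \<beta> i}"
      "K' = {\<gamma> \<in> absolute_maximal H. \<gamma> \<le> \<alpha> \<and> \<gamma> i = \<beta>' i}"
      using K(1,2) unfolding max_classes_iff by blast
    have "\<rho> (\<phi> K) \<in> K" "\<rho> (\<phi> K') \<in> K'" using assms K by auto
    hence "\<beta> i = \<beta>' i" using \<beta> K(3) by auto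
    thus ?thesis using \<beta> by simp
  qed
  thus inj: "inj_on \<phi> (max_classes \<alpha> i)" by (auto simp: inj_on_def)
  have sub: "\<phi> ` max_classes \<alpha> i \<subseteq> L \<alpha>"
  proof safe
    fix K assume K: "K \<in> max_classes \<alpha> i"
    hence "\<rho> (\<phi> K) \<in> K" "\<phi> K \<noteq> 0" "\<phi> K \<in> reg" using assms by auto
    moreover from this(1) K have "\<rho> (\<phi> K) \<le> \<alpha>" unfolding max_classes_iff by auto
    ultimately show "\<phi> K \<in> L \<alpha>" by (simp add: L_iff)
  qed
  show "finite (max_classes \<alpha> i)" using sub finite_L finite_subset finite_imageD[OF _ inj] by blast
  have inj': "inj_on (\<lambda>b. \<rho> b i) (\<phi> ` max_classes \<alpha> i)" using eq
    by (auto simp: inj_on_def)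
  have hit: "\<exists>b\<in>\<phi> ` max_classes \<alpha> i. \<rho> b i = \<rho> f i" if f: "f \<in> L \<alpha>" "f \<noteq> 0" for f
  proof -
    obtain g where g: "g \<in> L \<alpha>" "g \<noteq> 0" "\<rho> g \<in> absolute_maximal H" "\<rho> g i = \<rho> f i"
      using absolute_maximal_with_coordinate[OF f] by blast
    let ?K = "{\<beta> \<in> absolute_maximal H. \<beta> \<le> \<alpha> \<and> \<beta> i = \<rho> g i}"
    have K: "?K \<in> max_classes \<alpha> i" unfolding max_classes_iff using g L_iff by blast
    from bspec[OF assms K] have "\<rho> (\<phi> ?K) \<in> ?K" by (rule conjunct2)
    hence "\<rho> (\<phi> ?K) i = \<rho> f i" using g(4) by simp
    thus ?thesis using K by blast
  qed
  have "0 \<notin> \<phi> ` max_classes \<alpha> i"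
  proof
    assume "0 \<in> \<phi> ` max_classes \<alpha> i"
    then obtain K where "K \<in> max_classes \<alpha> i" "\<phi> K = 0" by auto
    with bspec[OF assms this(1)] show False by simp
  qed
  from basis_of_L[OF sub this inj' hit] show "vs.independent (\<phi> ` max_classes \<alpha> i)"
    "vs.span (\<phi> ` max_classes \<alpha> i) = L \<alpha>" by auto
qed

lemma class_choice_exists: "\<exists>\<phi>. \<forall>K\<in>max_classes \<alpha> i. \<phi> K \<in> reg - {0} \<and> \<rho> (\<phi> K) \<in> K"
proof (rule bchoice, rule ballI)
  fix K assume "K \<in> max_classes \<alpha> i"
  then obtain \<beta> where \<beta>: "\<beta> \<in> absolute_maximal H" "\<beta> \<in> K"
    unfolding max_classes_iff by blast
  hence "\<beta> \<in> H" by (simp add: absolute_maximal_def)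
  with \<beta> show "\<exists>f. f \<in> reg - {0} \<and> \<rho> f \<in> K" by (auto simp: H_def)
qed

lemma card_classes: "card (max_classes \<alpha> i) = vs.dim (L \<alpha>)"
proof -
  obtain \<phi> where \<phi>: "\<forall>K\<in>max_classes \<alpha> i. \<phi> K \<in> reg - {0} \<and> \<rho> (\<phi> K) \<in> K"
    using class_choice_exists by blast
  note * = class_choice[OF \<phi>]
  have "vs.dim (L \<alpha>) = card (\<phi> ` max_classes \<alpha> i)"
    using *(2,3) by (metis vs.dim_eq_card vs.span_span)
  thus ?thesis using *(1) by (simp add: card_image)
qed

text \<open>
  Every \<open>f\<close> in \<open>reg\<close> belongs to \<open>L (\<rho> f)\<close>.
\<close>

lemma span_absolute_maximal: "vs.span {f \<in> reg - {0}. \<rho> f \<in> absolute_maximal H} = reg"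
proof
  show "vs.span {f \<in> reg - {0}. \<rho> f \<in> absolute_maximal H} \<subseteq> reg"
    using subspace_reg by (intro vs.span_minimal) auto
  show "reg \<subseteq> vs.span {f \<in> reg - {0}. \<rho> f \<in> absolute_maximal H}"
  proof
    fix f assume f: "f \<in> reg"
    obtain \<phi> where \<phi>: "\<forall>K\<in>max_classes (\<rho> f) undefined. \<phi> K \<in> reg - {0} \<and> \<rho> (\<phi> K) \<in> K"
      using class_choice_exists by blast
    have "f \<in> L (\<rho> f)" using f L_iff[of f "\<rho> f"] zero_in_L by (cases "f = 0") auto
    also have "L (\<rho> f) = vs.span (\<phi> ` max_classes (\<rho> f) undefined)"
      using class_choice(3)[OF \<phi>] by simp
    also have "\<dots> \<subseteq> vs.span {f \<in> reg - {0}. \<rho> f \<in> absolute_maximal H}"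
    proof (rule vs.span_mono, rule image_subsetI)
      fix K assume K: "K \<in> max_classes (\<rho> f) undefined"
      with \<phi> have \<phi>K: "\<phi> K \<in> reg - {0}" "\<rho> (\<phi> K) \<in> K" by auto
      from K have "K \<subseteq> absolute_maximal H" unfolding max_classes_iff by blast
      with \<phi>K show "\<phi> K \<in> {f \<in> reg - {0}. \<rho> f \<in> absolute_maximal H}" by auto
    qed
    finally show "f \<in> vs.span {f \<in> reg - {0}. \<rho> f \<in> absolute_maximal H}" .
  qed
qed

lemma reg_not_finitely_spanned: "\<not> (\<exists>B. finite B \<and> vs.span B = reg)"
proof
  assume "\<exists>B. finite B \<and> vs.span B = reg"
  then obtain B where B: "finite B" "reg = vs.span B" by blast
  have "{f. \<forall>P\<in>C - {Q undefined}. f \<in> val_ge (v P) 0} \<subseteq> reg"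
    by (auto simp: reg_def)
  moreover have "infinite {f. \<forall>P\<in>C - {Q undefined}. f \<in> val_ge (v P) 0}"
    using Q_in separated by (intro infinite_regular_outside_point) auto
  moreover have "finite reg" unfolding B(2)
    using B(1) field_hom_axioms by (intro span_of_finite)
  ultimately show False using finite_subset by blast
qed

end

section \<open>Extension of residue maps to places\<close>

text \<open>
  The graph of a homomorphism over the ground field from a subring of the field \<open>'k\<close> to the field
  \<open>'w\<close>.  A partial homomorphism is encoded by its graph, a subring of the product, because graphs are
  ordered by inclusion and unions of chains of graphs are graphs.  The condition \<open>functional\<close> is
  single-valuedness, which by additivity can be tested at zero.
\<close>

locale graph_ring = field_hom \<iota> + res: field_hom \<kappa>
  for \<iota> :: "'a::field \<Rightarrow> 'k::field" and \<kappa> :: "'a \<Rightarrow> 'w::field" +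
  fixes g :: "('k \<times> 'w) set"
  assumes const: "(\<iota> c, \<kappa> c) \<in> g"
    and add: "(a, b) \<in> g \<Longrightarrow> (a', b') \<in> g \<Longrightarrow> (a + a', b + b') \<in> g"
    and mult: "(a, b) \<in> g \<Longrightarrow> (a', b') \<in> g \<Longrightarrow> (a * a', b * b') \<in> g"
    and functional: "(0, b) \<in> g \<Longrightarrow> b = 0"
begin

lemma zero: "(0, 0) \<in> g" using const[of 0] by simp

lemma one: "(1, 1) \<in> g" using const[of 1] by (simp add: hom_one res.hom_one)

lemma uminus: "(a, b) \<in> g \<Longrightarrow> (- a, - b) \<in> g"
  using mult[OF const[of "-1"]] by (simp add: hom_uminus hom_one res.hom_uminus res.hom_one)

lemma diff: "(a, b) \<in> g \<Longrightarrow> (a', b') \<in> g \<Longrightarrow> (a - a', b - b') \<in> g"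
  using add[OF _ uminus] by simp

lemma unique: "(a, b) \<in> g \<Longrightarrow> (a, b') \<in> g \<Longrightarrow> b = b'"
  using diff[of a b a b'] functional[of "b - b'"] by simp

lemma sum: "(\<And>i. i \<in> A \<Longrightarrow> (f i, h i) \<in> g) \<Longrightarrow> (sum f A, sum h A) \<in> g"
  by (induction A rule: infinite_finite_induct) (auto simp: zero add)

lemma prod: "(\<And>i. i \<in> A \<Longrightarrow> (f i, h i) \<in> g) \<Longrightarrow> (prod f A, prod h A) \<in> g"
  by (induction A rule: infinite_finite_induct) (auto simp: one mult)

lemma power: "(a, b) \<in> g \<Longrightarrow> (a ^ n, b ^ n) \<in> g"
  by (induction n) (auto simp: one mult)

lemma ideal_mult: "(a, b) \<in> g \<Longrightarrow> (a', 0) \<in> g \<Longrightarrow> (a * a', 0) \<in> g"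
  using mult[of a b a' 0] by simp

text \<open>
  Pairs of a polynomial over the domain and its image under the homomorphism.
\<close>

definition polys :: "('k poly \<times> 'w poly) set" where
  "polys = {(p, q). \<forall>i. (poly.coeff p i, poly.coeff q i) \<in> g}"

lemma polys_coeff: "(p, q) \<in> polys \<Longrightarrow> (poly.coeff p i, poly.coeff q i) \<in> g"
  by (simp add: polys_def)

lemma polys_add: "(p, q) \<in> polys \<Longrightarrow> (p', q') \<in> polys \<Longrightarrow> (p + p', q + q') \<in> polys"
  by (simp add: polys_def add)

lemma polys_diff: "(p, q) \<in> polys \<Longrightarrow> (p', q') \<in> polys \<Longrightarrow> (p - p', q - q') \<in> polys"
  by (simp add: polys_def diff)

lemma polys_mult: "(p, q) \<in> polys \<Longrightarrow> (p', q') \<in> polys \<Longrightarrow> (p * p', q * q') \<in> polys"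
  by (auto simp: polys_def coeff_mult intro!: sum mult)

lemma polys_monom: "(a, b) \<in> g \<Longrightarrow> (monom a n, monom b n) \<in> polys"
  by (auto simp: polys_def zero)

lemma polys_smult: "(a, b) \<in> g \<Longrightarrow> (p, q) \<in> polys \<Longrightarrow> (smult a p, smult b q) \<in> polys"
  by (auto simp: polys_def mult)

definition adjoin :: "'k \<Rightarrow> 'w \<Rightarrow> ('k \<times> 'w) set" where
  "adjoin x c = {(poly p x, poly q c) | p q. (p, q) \<in> polys}"

text \<open>
  The hypothesis is exactly single-valuedness of \<open>poly p x \<mapsto> poly q c\<close>; compatibility with sums and
  products is inherited from evaluation.
\<close>

lemma adjoin_graph_ring:
  assumes "\<And>p q. (p, q) \<in> polys \<Longrightarrow> poly p x = 0 \<Longrightarrow> poly q c = 0"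
  shows "graph_ring \<iota> \<kappa> (adjoin x c)"
proof unfold_locales
  show "(\<iota> d, \<kappa> d) \<in> adjoin x c" for d
    unfolding adjoin_def using polys_monom[OF const[of d], of 0] by (force simp: poly_monom)
  show "b = 0" if "(0, b) \<in> adjoin x c" for b using that assms unfolding adjoin_def by auto
  fix a b a' b' assume "(a, b) \<in> adjoin x c" "(a', b') \<in> adjoin x c"
  then obtain p q p' q' where *: "(p, q) \<in> polys" "(p', q') \<in> polys"
    "a = poly p x" "b = poly q c" "a' = poly p' x" "b' = poly q' c" unfolding adjoin_def by blast
  show "(a + a', b + b') \<in> adjoin x c" unfolding adjoin_def
    using * polys_add[OF *(1,2)] by (intro CollectI exI[of _ "p + p'"] exI[of _ "q + q'"]) simp
  show "(a * a', b * b') \<in> adjoin x c" unfolding adjoin_def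
    using * polys_mult[OF *(1,2)] by (intro CollectI exI[of _ "p * p'"] exI[of _ "q * q'"]) simp
qed

lemma subset_adjoin: "g \<subseteq> adjoin x c"
proof
  fix ab assume "ab \<in> g"
  thus "ab \<in> adjoin x c" unfolding adjoin_def
    using polys_monom[of "fst ab" "snd ab" 0]
    by (intro CollectI exI[of _ "monom (fst ab) 0"] exI[of _ "monom (snd ab) 0"]) (auto simp: poly_monom)
qed

lemma in_adjoin: "(x, c) \<in> adjoin x c"
  unfolding adjoin_def using polys_monom[OF one, of 1]
  by (intro CollectI exI[of _ "monom 1 1"]) (auto simp: poly_monom)

end

lemma poly_as_sum:
  fixes p :: "'z::field poly"
  assumes "Polynomial.degree p \<le> n"
  shows "poly p x = (\<Sum>i\<le>n. poly.coeff p i * x ^ i)"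
  unfolding poly_altdef using assms by (intro sum.mono_neutral_left) (auto simp: coeff_eq_0)

locale maximal_graph_ring = graph_ring \<iota> \<kappa> g
  for \<iota> :: "'a::field \<Rightarrow> 'k::field" and \<kappa> :: "'a \<Rightarrow> 'w::alg_closed_field" and g +
  assumes maximal: "graph_ring \<iota> \<kappa> g' \<Longrightarrow> g \<subseteq> g' \<Longrightarrow> g' = g"
begin

lemma adjoin_in:
  assumes "\<And>p q. (p, q) \<in> polys \<Longrightarrow> poly p x = 0 \<Longrightarrow> poly q c = 0"
  shows "(x, c) \<in> g"
  using maximal[OF adjoin_graph_ring[of x c] subset_adjoin] assms in_adjoin[of x c] by simp

text \<open>
  The domain of a maximal homomorphism is a local ring whose maximal ideal is the kernel: clearing
  denominators shows that \<open>inverse a\<close> can be given the value \<open>inverse b\<close>.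
\<close>

lemma inverse:
  assumes "(a, b) \<in> g" "b \<noteq> 0"
  shows "(inverse a, inverse b) \<in> g"
proof (rule adjoin_in)
  have a: "a \<noteq> 0" using assms functional by blast
  fix p q assume pq: "(p, q) \<in> polys" "poly p (inverse a) = 0"
  define n where "n = max (Polynomial.degree p) (Polynomial.degree q)"
  have clear: "y ^ n * poly r (inverse y) = (\<Sum>i\<le>n. poly.coeff r i * y ^ (n - i))"
    if "y \<noteq> 0" "Polynomial.degree r \<le> n" for y :: "'z::field" and r
    unfolding poly_as_sum[OF that(2)] sum_distrib_left
  proof (rule sum.cong)
    fix i assume "i \<in> {..n}"
    hence "y ^ n = y ^ (n - i) * y ^ i" by (simp flip: power_add)
    thus "y ^ n * (poly.coeff r i * inverse y ^ i) = poly.coeff r i * y ^ (n - i)"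
      using that(1) by (simp add: field_simps)
  qed simp
  have "(\<Sum>i\<le>n. poly.coeff p i * a ^ (n - i), \<Sum>i\<le>n. poly.coeff q i * b ^ (n - i)) \<in> g"
    using assms(1) pq(1) by (intro sum mult power polys_coeff)
  moreover have "a ^ n * poly p (inverse a) = (\<Sum>i\<le>n. poly.coeff p i * a ^ (n - i))"
    using a by (intro clear) (simp_all add: n_def)
  moreover have "b ^ n * poly q (inverse b) = (\<Sum>i\<le>n. poly.coeff q i * b ^ (n - i))"
    using assms(2) by (intro clear) (simp_all add: n_def)
  ultimately have "(a ^ n * poly p (inverse a), b ^ n * poly q (inverse b)) \<in> g" by simp
  hence "(0, b ^ n * poly q (inverse b)) \<in> g" using pq(2) by simp
  hence "b ^ n * poly q (inverse b) = 0" by (rule functional)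
  thus "poly q (inverse b) = 0" using assms by simp
qed

text \<open>
  The kernel generates the unit ideal of the ring extended by \<open>x\<close>, as witnessed by a polynomial of
  degree at most \<open>n\<close>.
\<close>

definition unit_ideal :: "'k \<Rightarrow> nat \<Rightarrow> bool" where
  "unit_ideal x n \<longleftrightarrow> (\<exists>p. Polynomial.degree p \<le> n \<and> (\<forall>i. (poly.coeff p i, 0) \<in> g) \<and> poly p x = 1)"

text \<open>
  If \<open>x\<close> cannot be given any value, then the images of the polynomials vanishing at \<open>x\<close> have no common
  root in the algebraically closed field \<open>'w\<close>.  Let \<open>q0\<close> be a non-zero image of least degree.
  Pseudo-division by \<open>q0\<close> shows that its roots are common roots, so \<open>q0\<close> is constant.  The polynomial
  that maps to \<open>q0\<close>, divided by its constant coefficient and subtracted from \<open>1\<close>, is the witness.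
\<close>

lemma unit_ideal_of_no_value:
  assumes "\<nexists>c. (x, c) \<in> g"
  shows "\<exists>n. unit_ideal x n"
proof -
  define I where "I = {(p, q). (p, q) \<in> polys \<and> poly p x = 0}"
  have noroot: "\<exists>(p, q)\<in>I. poly q c \<noteq> 0" for c
    using adjoin_in[of x c] assms unfolding I_def by blast
  then obtain p1 q1 where "(p1, q1) \<in> I" "poly q1 0 \<noteq> 0" by blast
  moreover from this(2) have "q1 \<noteq> 0" by auto
  ultimately have "\<exists>n p q. (p, q) \<in> I \<and> q \<noteq> 0 \<and> Polynomial.degree q = n"
    by blast
  from LeastI_ex[OF this] obtain p0 q0 where 0: "(p0, q0) \<in> I" "q0 \<noteq> 0"
    and least: "Polynomial.degree q0 = (LEAST n. \<exists>p q. (p, q) \<in> I \<and> q \<noteq> 0 \<and> Polynomial.degree q = n)"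
    by blast
  have min: "Polynomial.degree q0 \<le> Polynomial.degree q" if "(p, q) \<in> I" "q \<noteq> 0" for p q
    unfolding least using that by (intro Least_le) blast
  have deg0: "Polynomial.degree q0 = 0"
  proof (rule ccontr)
    assume "Polynomial.degree q0 \<noteq> 0"
    then obtain c where c: "poly q0 c = 0" using alg_closed_imp_poly_has_root[of q0] by auto
    have "poly q c = 0" if "(p, q) \<in> I" for p q
      using that
    proof (induction "Polynomial.degree q" arbitrary: p q rule: less_induct)
      case (less q p)
      show ?case
      proof (cases "q = 0")
        case False
        define n n0 where "n = Polynomial.degree q" and "n0 = Polynomial.degree q0"
        have n: "n0 \<le> n" using min[OF less.prems False] by (simp add: n_def n0_def)
        define p' where "p' = smult (poly.coeff p0 n0) p - monom (poly.coeff p n) (n - n0) * p0"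
        define q' where "q' = smult (poly.coeff q0 n0) q - monom (poly.coeff q n) (n - n0) * q0"
        have "(p', q') \<in> polys" unfolding p'_def q'_def
          using less.prems 0 unfolding I_def
          by (intro polys_diff polys_smult polys_mult polys_monom polys_coeff) auto
        moreover have "poly p' x = 0" using less.prems 0 by (simp add: p'_def I_def)
        ultimately have I': "(p', q') \<in> I" by (simp add: I_def)
        have "poly q' c = 0"
        proof (cases "q' = 0")
          case False
          have "Polynomial.degree q' \<le> n" unfolding q'_def
            by (intro degree_diff_le order_trans[OF degree_smult_le] order_trans[OF degree_mult_le])
              (use n degree_monom_le[of "poly.coeff q n" "n - n0"] in \<open>auto simp: n_def n0_def\<close>)
          moreover have "poly.coeff q' n = 0"
            using n by (simp add: q'_def coeff_monom_mult n_def n0_def)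
          ultimately have "Polynomial.degree q' < n"
            using False by (metis leading_coeff_0_iff le_neq_implies_less)
          thus ?thesis using less.hyps[of q' p'] I' by (simp add: n_def)
        qed simp
        hence "poly.coeff q0 n0 * poly q c = 0" using c by (simp add: q'_def)
        thus ?thesis using 0 by (simp add: n0_def)
      qed simp
    qed
    with noroot[of c] show False by blast
  qed
  define b where "b = poly.coeff q0 0"
  obtain b0 where "q0 = [:b0:]" using deg0 by (rule degree_eq_zeroE)
  hence q0: "q0 = [:b:]" by (simp add: b_def)
  have b: "b \<noteq> 0" using 0 q0 by auto
  define a where "a = poly.coeff p0 0"
  have ab: "(a, b) \<in> g" using 0 polys_coeff[of p0 q0 0] by (simp add: a_def b_def I_def)
  have a: "a \<noteq> 0" using ab b functional by blast
  have inv: "(inverse a, inverse b) \<in> g" using ab b by (rule inverse)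
  define p where "p = 1 - smult (inverse a) p0"
  have "(poly.coeff p i, 0) \<in> g" for i
  proof (cases "i = 0")
    case True
    thus ?thesis using a zero by (simp add: p_def a_def)
  next
    case False
    have "(poly.coeff p0 i, 0) \<in> g"
      using 0 polys_coeff[of p0 q0 i] False by (auto simp: I_def q0 coeff_pCons split: nat.splits)
    from uminus[OF ideal_mult[OF inv this]] show ?thesis using False by (simp add: p_def coeff_1)
  qed
  moreover have "poly p x = 1" using 0 by (simp add: p_def I_def)
  ultimately show ?thesis unfolding unit_ideal_def by blast
qed

text \<open>
  The relation for \<open>inverse x\<close>, multiplied by \<open>x ^ n\<close>, expresses \<open>x ^ n\<close> by lower powers of \<open>x\<close>, because
  one minus an element of the kernel is invertible.
\<close>

lemma unit_ideal_reduce: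
  assumes "unit_ideal x n" "unit_ideal (inverse x) k" "k \<le> n" "x \<noteq> 0"
  shows "n \<ge> 1 \<and> unit_ideal x (n - 1)"
proof -
  obtain p where p: "Polynomial.degree p \<le> n" "\<And>i. (poly.coeff p i, 0) \<in> g" "poly p x = 1"
    using assms(1) unfolding unit_ideal_def by blast
  obtain r where r: "Polynomial.degree r \<le> k" "\<And>i. (poly.coeff r i, 0) \<in> g" "poly r (inverse x) = 1"
    using assms(2) unfolding unit_ideal_def by blast
  have "n \<noteq> 0"
  proof
    assume "n = 0"
    hence "(poly p x, 0) \<in> g" using p(2)[of 0] p(1) by (simp add: poly_as_sum[of p 0])
    with p(3) one unique show False by force
  qed
  define u where "u = 1 - poly.coeff r 0"
  have u: "(u, 1) \<in> g" using diff[OF one r(2)[of 0]] by (simp add: u_def)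
  have u0: "u \<noteq> 0" using u functional by force
  have uinv: "(inverse u, 1) \<in> g" using inverse[OF u] by simp
  have "1 = poly.coeff r 0 + (\<Sum>i<k. poly.coeff r (Suc i) * inverse x ^ Suc i)"
    using r(3) unfolding poly_as_sum[OF r(1)] sum.atMost_shift by simp
  hence "u = (\<Sum>i<k. poly.coeff r (Suc i) * inverse x ^ Suc i)" by (simp add: u_def algebra_simps)
  hence "u * x ^ n = (\<Sum>i<k. poly.coeff r (Suc i) * (inverse x ^ Suc i * x ^ n))"
    by (simp add: sum_distrib_right mult.assoc)
  also have "\<dots> = (\<Sum>i<k. poly.coeff r (Suc i) * x ^ (n - Suc i))"
  proof (rule sum.cong)
    fix i assume "i \<in> {..<k}"
    hence "x ^ n = x ^ Suc i * x ^ (n - Suc i)" using assms(3) by (simp flip: power_add power_Suc)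
    thus "poly.coeff r (Suc i) * (inverse x ^ Suc i * x ^ n) = poly.coeff r (Suc i) * x ^ (n - Suc i)"
      using assms(4) by (simp add: field_simps)
  qed simp
  finally have xn: "x ^ n = inverse u * (\<Sum>i<k. poly.coeff r (Suc i) * x ^ (n - Suc i))"
    using u0 by (simp add: field_simps)
  define p' where "p' = (\<Sum>i<n. monom (poly.coeff p i) i)
     + (\<Sum>i<k. monom (inverse u * poly.coeff p n * poly.coeff r (Suc i)) (n - Suc i))"
  have "poly p' x = (\<Sum>i<n. poly.coeff p i * x ^ i) + poly.coeff p n * x ^ n"
    by (simp add: p'_def poly_sum poly_monom xn sum_distrib_left mult_ac)
  also have "\<dots> = poly p x"
    unfolding poly_as_sum[OF p(1)] by (simp flip: lessThan_Suc_atMost)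
  finally have "poly p' x = 1" using p(3) by simp
  moreover have "Polynomial.degree p' \<le> n - 1" unfolding p'_def
    using assms(3) \<open>n \<noteq> 0\<close>
    by (intro degree_add_le degree_sum_le) (auto intro!: order_trans[OF degree_monom_le])
  moreover have "(poly.coeff p' i, 0) \<in> g" for i
  proof -
    have "(\<Sum>j<n. poly.coeff (monom (poly.coeff p j) j) i, \<Sum>j<n. 0) \<in> g"
      by (rule sum) (use p(2) zero in auto)
    moreover have "(\<Sum>j<k. poly.coeff (monom (inverse u * poly.coeff p n * poly.coeff r (Suc j)) (n - Suc j)) i, \<Sum>j<k. 0) \<in> g"
    proof (rule sum)
      fix j
      have "(inverse u * poly.coeff p n * poly.coeff r (Suc j), 0) \<in> g"
        using ideal_mult[OF ideal_mult[OF uinv p(2)] r(2)] .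
      thus "(poly.coeff (monom (inverse u * poly.coeff p n * poly.coeff r (Suc j)) (n - Suc j)) i, 0) \<in> g"
        using zero by simp
    qed
    ultimately show ?thesis unfolding p'_def using add by (force simp: coeff_sum)
  qed
  ultimately show ?thesis using \<open>n \<noteq> 0\<close> unfolding unit_ideal_def by auto
qed

lemma not_unit_ideal_both:
  assumes "x \<noteq> 0" "unit_ideal x n" "unit_ideal (inverse x) k"
  shows False
  using assms
proof (induction "n + k" arbitrary: n k x rule: less_induct)
  case less
  show ?case
  proof (cases "k \<le> n")
    case True
    with unit_ideal_reduce[of x n k] less.prems have "n \<ge> 1" "unit_ideal x (n - 1)" by auto
    thus False using less.hyps[of "n - 1" k x] less.prems by auto
  next
    case False
    with unit_ideal_reduce[of "inverse x" k n] less.prems have "k \<ge> 1" "unit_ideal (inverse x) (k - 1)"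
      by auto
    thus False using less.hyps[of n "k - 1" x] less.prems by auto
  qed
qed

text \<open>
  Either \<open>x\<close> or \<open>inverse x\<close> has a value, as the kernel cannot generate the unit ideal in both
  extensions.  If \<open>inverse x\<close> had a non-zero value, then \<open>x\<close> would have one too.
\<close>

theorem valuation_ring:
  assumes "x \<noteq> 0"
  shows "(\<exists>c. (x, c) \<in> g) \<or> (inverse x, 0) \<in> g"
proof (rule ccontr)
  assume no: "\<not> ?thesis"
  then obtain n where n: "unit_ideal x n" using unit_ideal_of_no_value[of x] by blast
  have "\<nexists>c. (inverse x, c) \<in> g"
  proof
    assume "\<exists>c. (inverse x, c) \<in> g"
    then obtain c where c: "(inverse x, c) \<in> g" by blast
    show False using no c inverse[OF c] by (cases "c = 0") auto
  qed
  then obtain k where "unit_ideal (inverse x) k" using unit_ideal_of_no_value by blast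
  with n assms not_unit_ideal_both show False by blast
qed

end

lemma maximal_graph_ring_exists:
  fixes \<kappa> :: "'a::field \<Rightarrow> 'w::alg_closed_field" and \<iota> :: "'a \<Rightarrow> 'k::field"
  assumes "graph_ring \<iota> \<kappa> g0"
  shows "\<exists>g. g0 \<subseteq> g \<and> maximal_graph_ring \<iota> \<kappa> g"
proof -
  let ?A = "{g. graph_ring \<iota> \<kappa> g \<and> g0 \<subseteq> g}"
  have "\<exists>M\<in>?A. \<forall>g\<in>?A. M \<subseteq> g \<longrightarrow> g = M"
  proof (rule subset_Zorn_nonempty)
    show "?A \<noteq> {}" using assms by blast
    fix \<C> assume C: "\<C> \<noteq> {}" "subset.chain ?A \<C>"
    interpret g0: graph_ring \<iota> \<kappa> g0 by fact
    have ring: "graph_ring \<iota> \<kappa> g" "g0 \<subseteq> g" if "g \<in> \<C>" for g using C(2) that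
      by (auto simp: subset.chain_def)
    have two: "\<exists>g\<in>\<C>. x \<in> g \<and> y \<in> g" if "x \<in> \<Union>\<C>" "y \<in> \<Union>\<C>" for x y
      using C(2) that unfolding subset.chain_def by blast
    have "graph_ring \<iota> \<kappa> (\<Union>\<C>)"
    proof unfold_locales
      show "(\<iota> c, \<kappa> c) \<in> \<Union>\<C>" for c using C(1) ring(2) g0.const by blast
      show "b = 0" if "(0, b) \<in> \<Union>\<C>" for b using that ring(1) graph_ring.functional by blast
      fix a b a' b' assume "(a, b) \<in> \<Union>\<C>" "(a', b') \<in> \<Union>\<C>"
      from two[OF this] obtain g where g: "g \<in> \<C>" "(a, b) \<in> g" "(a', b') \<in> g" by blast
      show "(a + a', b + b') \<in> \<Union>\<C>" using g graph_ring.add[OF ring(1)[OF g(1)]] by blast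
      show "(a * a', b * b') \<in> \<Union>\<C>" using g graph_ring.mult[OF ring(1)[OF g(1)]] by blast
    qed
    thus "\<Union>\<C> \<in> ?A" using C(1) ring(2) by blast
  qed
  then obtain g where "g \<in> ?A" "\<forall>g'\<in>?A. g \<subseteq> g' \<longrightarrow> g' = g" by blast
  thus ?thesis
    by (intro exI[of _ g]) (auto simp: maximal_graph_ring_def maximal_graph_ring_axioms_def)
qed

section \<open>Forms and local rings on a projective curve\<close>

abbreviation mono_eval :: "('n::finite \<Rightarrow> 'c::comm_semiring_1) \<Rightarrow> ('n \<Rightarrow>\<^sub>0 nat) \<Rightarrow> 'c" where
  "mono_eval x \<mu> \<equiv> \<Prod>j\<in>UNIV. x j ^ Poly_Mapping.lookup \<mu> j"

lemma mono_eval_add: "mono_eval x (\<mu> + \<nu>) = mono_eval x \<mu> * mono_eval x \<nu>"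
  by (simp add: lookup_add power_add prod.distrib)

lemma poly_mapping_as_sum:
  fixes G :: "'b \<Rightarrow>\<^sub>0 'c::comm_monoid_add"
  shows "G = (\<Sum>\<mu>\<in>Poly_Mapping.keys G. Poly_Mapping.single \<mu> (Poly_Mapping.lookup G \<mu>))"
proof (rule poly_mapping_eqI)
  fix k
  have "(\<Sum>\<mu>\<in>Poly_Mapping.keys G. Poly_Mapping.lookup (Poly_Mapping.single \<mu> (Poly_Mapping.lookup G \<mu>)) k)
      = (\<Sum>\<mu>\<in>Poly_Mapping.keys G. if \<mu> = k then Poly_Mapping.lookup G \<mu> else 0)"
    by (rule sum.cong) (auto simp: lookup_single when_def)
  also have "\<dots> = Poly_Mapping.lookup G k" by (simp add: sum.delta in_keys_iff)
  finally show "Poly_Mapping.lookup G k = Poly_Mapping.lookup (\<Sum>\<mu>\<in>Poly_Mapping.keys G.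
      Poly_Mapping.single \<mu> (Poly_Mapping.lookup G \<mu>)) k"
    by (simp add: lookup_sum)
qed

context field_hom begin

lemma mpoly_eval_superset:
  fixes G :: "('n::finite, 'a) mpoly"
  assumes "finite A" "Poly_Mapping.keys G \<subseteq> A"
  shows "mpoly_eval \<iota> G x = (\<Sum>\<mu>\<in>A. \<iota> (Poly_Mapping.lookup G \<mu>) * mono_eval x \<mu>)"
  unfolding mpoly_eval_def using assms
  by (intro sum.mono_neutral_left) (auto simp: in_keys_iff)

lemma mpoly_eval_zero [simp]: "mpoly_eval \<iota> 0 x = 0" by (simp add: mpoly_eval_def)

lemma mpoly_eval_add: "mpoly_eval \<iota> (G + G') x = mpoly_eval \<iota> G x + mpoly_eval \<iota> G' x"
proof -
  let ?A = "Poly_Mapping.keys G \<union> Poly_Mapping.keys G'"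
  have "mpoly_eval \<iota> (G + G') x = (\<Sum>\<mu>\<in>?A. \<iota> (Poly_Mapping.lookup (G + G') \<mu>) * mono_eval x \<mu>)"
    by (intro mpoly_eval_superset keys_add) simp
  also have "\<dots> = mpoly_eval \<iota> G x + mpoly_eval \<iota> G' x"
    using mpoly_eval_superset[of ?A G x] mpoly_eval_superset[of ?A G' x]
    by (simp add: lookup_add hom_add distrib_right sum.distrib)
  finally show ?thesis .
qed

lemma mpoly_eval_sum: "mpoly_eval \<iota> (sum F A) x = (\<Sum>i\<in>A. mpoly_eval \<iota> (F i) x)"
  by (induction A rule: infinite_finite_induct) (auto simp: mpoly_eval_add)

lemma mpoly_eval_single: "mpoly_eval \<iota> (Poly_Mapping.single \<mu> c) x = \<iota> c * mono_eval x \<mu>"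
  by (simp add: mpoly_eval_def)

lemma mpoly_eval_mult: "mpoly_eval \<iota> (G * G') x = mpoly_eval \<iota> G x * mpoly_eval \<iota> G' x"
proof -
  have "G * G' = (\<Sum>\<mu>\<in>Poly_Mapping.keys G. \<Sum>\<nu>\<in>Poly_Mapping.keys G'.
      Poly_Mapping.single (\<mu> + \<nu>) (Poly_Mapping.lookup G \<mu> * Poly_Mapping.lookup G' \<nu>))"
    by (subst (1 2) poly_mapping_as_sum) (simp only: sum_product mult_single)
  hence "mpoly_eval \<iota> (G * G') x = (\<Sum>\<mu>\<in>Poly_Mapping.keys G. \<Sum>\<nu>\<in>Poly_Mapping.keys G'.
      \<iota> (Poly_Mapping.lookup G \<mu> * Poly_Mapping.lookup G' \<nu>) * mono_eval x (\<mu> + \<nu>))"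
    by (simp only: mpoly_eval_sum mpoly_eval_single)
  also have "\<dots> = mpoly_eval \<iota> G x * mpoly_eval \<iota> G' x"
    unfolding mpoly_eval_def sum_product mono_eval_add by (simp add: hom_mult mult_ac)
  finally show ?thesis .
qed

lemma mpoly_eval_scale:
  assumes "homogeneous d G"
  shows "mpoly_eval \<iota> G (\<lambda>j. c * x j) = c ^ d * mpoly_eval \<iota> G x"
  unfolding mpoly_eval_def sum_distrib_left
proof (rule sum.cong)
  fix \<mu> assume "\<mu> \<in> Poly_Mapping.keys G"
  hence "(\<Prod>j\<in>UNIV. c ^ Poly_Mapping.lookup \<mu> j) = c ^ d"
    using assms by (simp add: homogeneous_def flip: power_sum)
  thus "\<iota> (Poly_Mapping.lookup G \<mu>) * mono_eval (\<lambda>j. c * x j) \<mu>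
      = c ^ d * (\<iota> (Poly_Mapping.lookup G \<mu>) * mono_eval x \<mu>)"
    by (simp add: power_mult_distrib prod.distrib mult_ac)
qed simp

end

lemma homogeneous_add: "homogeneous d G \<Longrightarrow> homogeneous d H \<Longrightarrow> homogeneous d (G + H)"
  using keys_add[of G H] unfolding homogeneous_def by blast

lemma homogeneous_mult:
  fixes G H :: "('n::finite, 'b::semiring_0) mpoly"
  shows "homogeneous d G \<Longrightarrow> homogeneous e H \<Longrightarrow> homogeneous (d + e) (G * H)"
  using keys_mult[of G H] unfolding homogeneous_def
  by (fastforce simp: lookup_add sum.distrib)

lemma homogeneous_single: "(\<Sum>j\<in>UNIV. Poly_Mapping.lookup \<mu> j) = d \<Longrightarrow> homogeneous d (Poly_Mapping.single \<mu> c)"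
  by (auto simp: homogeneous_def)

lemma homogeneous_zero: "homogeneous d 0" by (simp add: homogeneous_def)

definition coord :: "'n \<Rightarrow> ('n::finite, 'b::{zero,one}) mpoly" where
  "coord j = Poly_Mapping.single (Poly_Mapping.single j 1) 1"

lemma homogeneous_coord: "homogeneous 1 (coord j)"
  unfolding coord_def by (rule homogeneous_single) (simp add: lookup_single when_def)

definition const_form :: "'b \<Rightarrow> ('n::finite, 'b::zero) mpoly" where
  "const_form c = Poly_Mapping.single 0 c"

lemma homogeneous_const_form: "homogeneous 0 (const_form c)"
  unfolding const_form_def by (rule homogeneous_single) simp

lemma (in field_hom) mpoly_eval_coord [simp]: "mpoly_eval \<iota> (coord j) x = x j"
proof -
  have "mono_eval x (Poly_Mapping.single j 1) = (\<Prod>i\<in>UNIV. if i = j then x i else 1)"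
    by (rule prod.cong) (auto simp: lookup_single when_def)
  thus ?thesis unfolding coord_def mpoly_eval_single by (simp add: hom_one)
qed

lemma (in field_hom) mpoly_eval_const_form [simp]: "mpoly_eval \<iota> (const_form c) x = \<iota> c"
  unfolding const_form_def mpoly_eval_single by simp

lemma (in graph_ring) mpoly_eval_pair:
  assumes "\<And>j. (x j, y j) \<in> g"
  shows "(mpoly_eval \<iota> G x, mpoly_eval \<kappa> G y) \<in> g"
  unfolding mpoly_eval_def using assms by (intro sum mult prod power const)

lemma field_hom_to_ac: "field_hom (to_ac :: 'a::field \<Rightarrow> 'a alg_closure)"
  by unfold_locales auto

lemma vanishes_at_proj_point:
  fixes G :: "('n::finite, 'a::field) mpoly"
  assumes "homogeneous d G"
  shows "vanishes_at to_ac G (proj_point x) \<longleftrightarrow> mpoly_eval to_ac G x = 0"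
proof -
  interpret ac: field_hom "to_ac :: 'a \<Rightarrow> 'a alg_closure" by (rule field_hom_to_ac)
  have "x \<in> proj_point x" unfolding proj_point_def by (intro CollectI exI[of _ 1]) simp
  thus ?thesis using ac.mpoly_eval_scale[OF assms]
    by (auto simp: vanishes_at_def proj_point_def)
qed

locale proj_curve =
  fixes \<C> :: "('n::finite, 'a::field) point set" and \<iota> :: "'a \<Rightarrow> 'k::field" and \<xi> :: "'n \<Rightarrow> 'k"
  assumes curve: "nonsingular_projective_curve \<C> \<iota> \<xi>"
begin

lemma function_field: "function_field \<C> \<iota> \<xi>"
  using curve by (simp add: nonsingular_projective_curve_def)

sublocale field_hom \<iota>
  using function_field by unfold_locales (auto simp: function_field_def)

sublocale ac: field_hom "to_ac :: 'a \<Rightarrow> 'a alg_closure" by (rule field_hom_to_ac)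

lemma form_zero_iff:
  "homogeneous d G \<Longrightarrow> mpoly_eval \<iota> G \<xi> = 0 \<longleftrightarrow> (\<forall>P\<in>\<C>. vanishes_at to_ac G P)"
  using function_field unfolding function_field_def by blast

lemma fraction_of_forms:
  obtains d G H where "homogeneous d G" "homogeneous d H" "mpoly_eval \<iota> H \<xi> \<noteq> 0"
    "f = mpoly_eval \<iota> G \<xi> / mpoly_eval \<iota> H \<xi>"
  using function_field unfolding function_field_def by blast

lemma point_cases:
  assumes "P \<in> \<C>"
  obtains x j where "P = proj_point x" "x j \<noteq> 0"
proof -
  have "P \<in> proj_space"
    using assms curve unfolding nonsingular_projective_curve_def proj_algebraic_set_def by auto
  then obtain x where "P = proj_point x" "x \<noteq> (\<lambda>_. 0)" unfolding proj_space_def by blast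
  with that show ?thesis by (metis ext)
qed

text \<open>
  The residue map of the local ring at the point with coordinates \<open>x\<close>, as the graph of evaluation at
  \<open>x\<close>.
\<close>

definition residue_graph :: "('n \<Rightarrow> 'a alg_closure) \<Rightarrow> ('k \<times> 'a alg_closure) set" where
  "residue_graph x = {(mpoly_eval \<iota> G \<xi> / mpoly_eval \<iota> H \<xi>, mpoly_eval to_ac G x / mpoly_eval to_ac H x) | d G H.
     homogeneous d G \<and> homogeneous d H \<and> mpoly_eval to_ac H x \<noteq> 0}"

lemma residue_graphI:
  "homogeneous d G \<Longrightarrow> homogeneous d H \<Longrightarrow> mpoly_eval to_ac H x \<noteq> 0 \<Longrightarrow>
   (mpoly_eval \<iota> G \<xi> / mpoly_eval \<iota> H \<xi>, mpoly_eval to_ac G x / mpoly_eval to_ac H x) \<in> residue_graph x"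
  unfolding residue_graph_def by blast

lemma residue_graphE:
  assumes "(f, y) \<in> residue_graph x"
  obtains d G H where "homogeneous d G" "homogeneous d H" "mpoly_eval to_ac H x \<noteq> 0"
    "f = mpoly_eval \<iota> G \<xi> / mpoly_eval \<iota> H \<xi>" "y = mpoly_eval to_ac G x / mpoly_eval to_ac H x"
  using assms unfolding residue_graph_def by blast

context
  fixes x :: "'n \<Rightarrow> 'a alg_closure"
  assumes on_curve: "proj_point x \<in> \<C>"
begin

lemma form_nonzero:
  assumes "homogeneous d H" "mpoly_eval to_ac H x \<noteq> 0"
  shows "mpoly_eval \<iota> H \<xi> \<noteq> 0"
  using form_zero_iff[OF assms(1)] vanishes_at_proj_point[OF assms(1), of x] assms(2) on_curve by blast

text \<open>
  A form that vanishes at the generic point vanishes on the whole curve, hence at \<open>x\<close>; this is why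
  the value of a fraction of forms at \<open>x\<close> is well defined.
\<close>

lemma residue_graph_ring: "graph_ring \<iota> to_ac (residue_graph x)"
proof unfold_locales
  show "(\<iota> c, to_ac c) \<in> residue_graph x" for c
    using residue_graphI[OF homogeneous_const_form homogeneous_const_form, of 1 x c]
    by (simp add: hom_one)
  show "b = 0" if b0: "(0, b) \<in> residue_graph x" for b
  proof -
    obtain d G H where *: "homogeneous d G" "homogeneous d H" "mpoly_eval to_ac H x \<noteq> 0"
      "0 = mpoly_eval \<iota> G \<xi> / mpoly_eval \<iota> H \<xi>" "b = mpoly_eval to_ac G x / mpoly_eval to_ac H x"
      using b0 by (rule residue_graphE)
    thus ?thesis using form_nonzero[OF *(2,3)] form_nonzero[OF *(1)] by auto
  qed
  fix a b a' b' assume ab: "(a, b) \<in> residue_graph x" "(a', b') \<in> residue_graph x"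
  obtain d G H where 1: "homogeneous d G" "homogeneous d H" "mpoly_eval to_ac H x \<noteq> 0"
    "a = mpoly_eval \<iota> G \<xi> / mpoly_eval \<iota> H \<xi>" "b = mpoly_eval to_ac G x / mpoly_eval to_ac H x"
    using ab(1) by (rule residue_graphE)
  obtain d' G' H' where 2: "homogeneous d' G'" "homogeneous d' H'" "mpoly_eval to_ac H' x \<noteq> 0"
    "a' = mpoly_eval \<iota> G' \<xi> / mpoly_eval \<iota> H' \<xi>" "b' = mpoly_eval to_ac G' x / mpoly_eval to_ac H' x"
    using ab(2) by (rule residue_graphE)
  note nz = form_nonzero[OF 1(2,3)] form_nonzero[OF 2(2,3)] 1(3) 2(3)
  have HH': "homogeneous (d + d') (H * H')" "mpoly_eval to_ac (H * H') x \<noteq> 0"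
    using 1 2 by (auto intro: homogeneous_mult simp: ac.mpoly_eval_mult)
  have "homogeneous (d + d') (G * H' + H * G')" "homogeneous (d + d') (G * G')"
    using 1 2 by (auto intro!: homogeneous_mult homogeneous_add)
  from this[THEN residue_graphI[OF _ HH']] nz
  show "(a + a', b + b') \<in> residue_graph x" "(a * a', b * b') \<in> residue_graph x"
    unfolding 1(4,5) 2(4,5)
    by (auto simp: mpoly_eval_mult ac.mpoly_eval_mult mpoly_eval_add ac.mpoly_eval_add add_frac_eq mult.commute)
qed

lemma residue_graph_inverse:
  assumes "(a, b) \<in> residue_graph x" "b \<noteq> 0"
  shows "(inverse a, inverse b) \<in> residue_graph x"
  using assms(1)
proof (rule residue_graphE)
  fix d G H assume *: "homogeneous d G" "homogeneous d H" "mpoly_eval to_ac H x \<noteq> 0"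
    "a = mpoly_eval \<iota> G \<xi> / mpoly_eval \<iota> H \<xi>" "b = mpoly_eval to_ac G x / mpoly_eval to_ac H x"
  with assms(2) have "mpoly_eval to_ac G x \<noteq> 0" by auto
  from residue_graphI[OF *(2,1) this] show ?thesis using * by simp
qed

lemma local_ring_iff: "f \<in> local_ring \<iota> \<xi> (proj_point x) \<longleftrightarrow> (\<exists>y. (f, y) \<in> residue_graph x)"
  unfolding local_ring_def residue_graph_def
  using vanishes_at_proj_point[of _ _ x] by (auto; blast)

lemma maximal_ideal_iff: "f \<in> maximal_ideal_at \<iota> \<xi> (proj_point x) \<longleftrightarrow> (f, 0) \<in> residue_graph x"
  unfolding maximal_ideal_at_def residue_graph_def
  using vanishes_at_proj_point[of _ _ x] by (auto; blast)

text \<open>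
  A fraction of forms of degree \<open>d\<close> is written with regular numerator and denominator by dividing
  both by \<open>X\<^sub>j ^ d\<close>, where the coordinate \<open>j\<close> does not vanish at the point.
\<close>

lemma fraction_of_local_ring:
  assumes "x j \<noteq> 0"
  obtains a b y z where "(a, y) \<in> residue_graph x" "(b, z) \<in> residue_graph x" "b \<noteq> 0" "f = a / b"
proof -
  interpret g: graph_ring \<iota> to_ac "residue_graph x" by (rule residue_graph_ring)
  have nz: "\<xi> j \<noteq> 0" using form_nonzero[OF homogeneous_coord, of j] assms by simp
  obtain d G H where *: "homogeneous d G" "homogeneous d H" "mpoly_eval \<iota> H \<xi> \<noteq> 0"
    "f = mpoly_eval \<iota> G \<xi> / mpoly_eval \<iota> H \<xi>" by (rule fraction_of_forms)
  have coord_power: "homogeneous d (coord j ^ d :: ('n, 'a) mpoly)" for d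
  proof (induction d)
    case 0
    have "(1 :: ('n, 'a) mpoly) = const_form 1" by (simp add: const_form_def)
    thus ?case using homogeneous_const_form by (metis power_0)
  next
    case (Suc d)
    thus ?case using homogeneous_mult[OF homogeneous_coord Suc, of j] by simp
  qed
  have ev: "mpoly_eval \<iota> (coord j ^ d) \<xi> = \<xi> j ^ d" "mpoly_eval to_ac (coord j ^ d) x = x j ^ d" for d
    by (induction d) (simp_all add: mpoly_eval_mult ac.mpoly_eval_mult flip: single_one const_form_def,
      simp_all add: hom_one)
  show ?thesis
    using residue_graphI[OF *(1) coord_power, of x] residue_graphI[OF *(2) coord_power, of x] * nz assms
    by (intro that[of "mpoly_eval \<iota> G \<xi> / \<xi> j ^ d" _ "mpoly_eval \<iota> H \<xi> / \<xi> j ^ d"]) (auto simp: ev)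
qed

end

end

section \<open>Linear growth of the spaces of forms\<close>

context field_hom begin

lemma subspace_mult_preimage:
  assumes "vs.subspace W"
  shows "vs.subspace {y. a * y \<in> W}"
proof (rule vs.subspaceI)
  show "scale \<iota> c y \<in> {y. a * y \<in> W}" if "y \<in> {y. a * y \<in> W}" for c y
    using vs.subspace_scale[OF assms, of "a * y" c] that by (simp add: scale_def mult.left_commute)
qed (use vs.subspace_0[OF assms] vs.subspace_add[OF assms] in \<open>auto simp: distrib_left\<close>)

lemma span_mult_mem:
  assumes "vs.subspace W" "\<And>a b. a \<in> A \<Longrightarrow> b \<in> B \<Longrightarrow> a * b \<in> W" "x \<in> vs.span A" "y \<in> vs.span B"
  shows "x * y \<in> W"
proof -
  have "vs.span B \<subseteq> {y. a * y \<in> W}" if "a \<in> A" for a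
    using assms(2) that by (intro vs.span_minimal subspace_mult_preimage[OF assms(1)]) auto
  hence "A \<subseteq> {x. x * y \<in> W}" using assms(4) by auto
  moreover have "vs.subspace {x. x * y \<in> W}"
    using subspace_mult_preimage[OF assms(1), of y] by (simp add: mult.commute)
  ultimately have "vs.span A \<subseteq> {x. x * y \<in> W}" by (rule vs.span_minimal)
  thus ?thesis using assms(3) by auto
qed

definition polys_upto :: "'k \<Rightarrow> nat \<Rightarrow> 'k set" where
  "polys_upto t D = vs.span ((\<lambda>i. t ^ i) ` {..D})"

lemma polys_upto_mono: "D \<le> D' \<Longrightarrow> a \<in> polys_upto t D \<Longrightarrow> a \<in> polys_upto t D'"
  unfolding polys_upto_def
  using vs.span_mono[OF image_mono, of "{..D}" "{..D'}" "\<lambda>i. t ^ i"] by auto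

lemma polys_upto_mult:
  "a \<in> polys_upto t D \<Longrightarrow> b \<in> polys_upto t D' \<Longrightarrow> a * b \<in> polys_upto t (D + D')"
  unfolding polys_upto_def
  by (rule span_mult_mem[OF vs.subspace_span]) (auto intro!: vs.span_base imageI simp flip: power_add)

lemma poly_in_polys_upto:
  assumes "\<And>i. poly.coeff p i \<in> range \<iota>"
  shows "poly p t \<in> polys_upto t (Polynomial.degree p)"
  unfolding poly_altdef polys_upto_def
proof (rule vs.span_sum)
  fix i assume "i \<in> {..Polynomial.degree p}"
  moreover obtain c where "poly.coeff p i = \<iota> c" using assms by blast
  ultimately show "poly.coeff p i * t ^ i \<in> vs.span ((\<lambda>i. t ^ i) ` {..Polynomial.degree p})"
    using vs.span_scale[OF vs.span_base, of "t ^ i" _ c] by (simp add: scale_def)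
qed

definition polys_in :: "'k \<Rightarrow> 'k set" where
  "polys_in t = (\<Union>D. polys_upto t D)"

lemma polys_in_mult: "a \<in> polys_in t \<Longrightarrow> b \<in> polys_in t \<Longrightarrow> a * b \<in> polys_in t"
  unfolding polys_in_def using polys_upto_mult by blast

lemma polys_in_uminus: "a \<in> polys_in t \<Longrightarrow> - a \<in> polys_in t"
  unfolding polys_in_def polys_upto_def using vs.span_neg by blast

lemma polys_in_one: "1 \<in> polys_in t"
  unfolding polys_in_def polys_upto_def
  by (intro UN_I[of 0] vs.span_base) auto

lemma polys_in_prod: "(\<And>i. i \<in> A \<Longrightarrow> f i \<in> polys_in t) \<Longrightarrow> prod f A \<in> polys_in t"
  by (induction A rule: infinite_finite_induct) (auto simp: polys_in_one polys_in_mult)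

lemma polys_in_bounded:
  assumes "finite A" "\<And>i. i \<in> A \<Longrightarrow> f i \<in> polys_in t"
  shows "\<exists>D. \<forall>i\<in>A. f i \<in> polys_upto t D"
proof -
  have "\<forall>i\<in>A. \<exists>D. f i \<in> polys_upto t D" using assms(2) by (auto simp: polys_in_def)
  then obtain D where D: "\<forall>i\<in>A. f i \<in> polys_upto t (D i)" by metis
  have "\<forall>i\<in>A. f i \<in> polys_upto t (\<Sum>i\<in>A. D i)"
    using D assms(1) by (auto intro!: polys_upto_mono[OF member_le_sum[of _ A D]])
  thus ?thesis by blast
qed

text \<open>
  Clearing the denominators of an algebraic equation over \<open>k(t)\<close>.
\<close>

lemma algebraic_relation:
  assumes "algebraic_over (simple_extension (range \<iota>) t) f"
  shows "\<exists>d a B. d \<ge> 1 \<and> a \<noteq> 0 \<and> a \<in> polys_in t \<and> (\<forall>i. B i \<in> polys_in t) \<and>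
           a * f ^ d = (\<Sum>i<d. B i * f ^ i)"
proof -
  obtain p where p: "p \<noteq> 0" "\<And>i. poly.coeff p i \<in> simple_extension (range \<iota>) t" "poly p f = 0"
    using assms unfolding algebraic_over_def by blast
  define d where "d = Polynomial.degree p"
  have "\<exists>n q. poly.coeff p i = n / q \<and> n \<in> polys_in t \<and> q \<in> polys_in t \<and> q \<noteq> 0" for i
  proof -
    obtain r s where "poly.coeff p i = poly r t / poly s t" "\<forall>i. poly.coeff r i \<in> range \<iota>"
      "\<forall>i. poly.coeff s i \<in> range \<iota>" "poly s t \<noteq> 0"
      using p(2)[of i] unfolding simple_extension_def by blast
    moreover from this have "poly r t \<in> polys_in t" "poly s t \<in> polys_in t"
      unfolding polys_in_def using poly_in_polys_upto by blast+
    ultimately show ?thesis by blast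
  qed
  then obtain n q where nq: "\<And>i. poly.coeff p i = n i / q i" "\<And>i. n i \<in> polys_in t"
    "\<And>i. q i \<in> polys_in t" "\<And>i. q i \<noteq> 0" by metis
  define R where "R = (\<Prod>i\<le>d. q i)"
  have R0: "R \<noteq> 0" using nq(4) by (simp add: R_def)
  have R: "R * poly.coeff p i \<in> polys_in t" if "i \<le> d" for i
  proof -
    have "R = q i * (\<Prod>i\<in>{..d} - {i}. q i)" unfolding R_def using that by (intro prod.remove) auto
    hence "R * poly.coeff p i = n i * (\<Prod>i\<in>{..d} - {i}. q i)" using nq(1,4)[of i] by simp
    also have "\<dots> \<in> polys_in t" using nq by (intro polys_in_mult polys_in_prod)
    finally show ?thesis .
  qed
  define a where "a = R * poly.coeff p d"
  define B where "B i = (if i \<le> d then - (R * poly.coeff p i) else 1)" for i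
  have a0: "a \<noteq> 0" using R0 p(1) by (simp add: a_def d_def)
  have "0 = R * (\<Sum>i\<le>d. poly.coeff p i * f ^ i)" using p(3) by (simp add: poly_altdef d_def)
  also have "\<dots> = a * f ^ d + (\<Sum>i<d. R * poly.coeff p i * f ^ i)"
    by (simp add: a_def distrib_left sum_distrib_left mult.assoc flip: lessThan_Suc_atMost)
  also have "(\<Sum>i<d. R * poly.coeff p i * f ^ i) = - (\<Sum>i<d. B i * f ^ i)"
    by (simp add: B_def sum_negf[symmetric])
  finally have rel: "a * f ^ d = (\<Sum>i<d. B i * f ^ i)" by simp
  hence "d \<noteq> 0" using a0 by (intro notI) simp
  moreover have "B i \<in> polys_in t" for i using R by (simp add: B_def polys_in_uminus polys_in_one)
  ultimately show ?thesis using a0 rel R[of d] unfolding a_def[symmetric]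
    by (intro exI[of _ d] exI[of _ a] exI[of _ B]) auto
qed

end

context proj_curve begin

definition forms_at_generic :: "nat \<Rightarrow> 'k set" where
  "forms_at_generic N = {mpoly_eval \<iota> G \<xi> | G. homogeneous N G}"

lemma forms_mult:
  "a \<in> forms_at_generic M \<Longrightarrow> b \<in> forms_at_generic N \<Longrightarrow> a * b \<in> forms_at_generic (M + N)"
  unfolding forms_at_generic_def by (auto simp flip: mpoly_eval_mult intro: homogeneous_mult)

lemma forms_add: "a \<in> forms_at_generic N \<Longrightarrow> b \<in> forms_at_generic N \<Longrightarrow> a + b \<in> forms_at_generic N"
  unfolding forms_at_generic_def by (auto simp flip: mpoly_eval_add intro: homogeneous_add)

lemma forms_zero: "0 \<in> forms_at_generic N"
  unfolding forms_at_generic_def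
  by (intro CollectI exI[of _ 0]) (simp add: homogeneous_zero)

lemma forms_const: "\<iota> c \<in> forms_at_generic 0"
  unfolding forms_at_generic_def
  by (intro CollectI exI[of _ "const_form c"]) (simp add: homogeneous_const_form)

lemma forms_const_mult: "a \<in> forms_at_generic N \<Longrightarrow> \<iota> c * a \<in> forms_at_generic N"
  using forms_mult[OF forms_const, of a N c] by simp

lemma forms_sum: "(\<And>i. i \<in> A \<Longrightarrow> f i \<in> forms_at_generic N) \<Longrightarrow> sum f A \<in> forms_at_generic N"
  by (induction A rule: infinite_finite_induct) (auto simp: forms_zero forms_add)

lemma forms_power: "a \<in> forms_at_generic N \<Longrightarrow> a ^ j \<in> forms_at_generic (j * N)"
proof (induction j)
  case 0
  show ?case using forms_const[of 1] by (simp add: hom_one)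
next
  case (Suc j)
  thus ?case using forms_mult[of a N "a ^ j" "j * N"] by simp
qed

lemma fraction_of_forms_at_generic:
  "\<exists>e g h. g \<in> forms_at_generic e \<and> h \<in> forms_at_generic e \<and> h \<noteq> 0 \<and> f = g / h"
proof -
  obtain d G H where "homogeneous d G" "homogeneous d H" "mpoly_eval \<iota> H \<xi> \<noteq> 0"
    "f = mpoly_eval \<iota> G \<xi> / mpoly_eval \<iota> H \<xi>" by (rule fraction_of_forms)
  thus ?thesis unfolding forms_at_generic_def by blast
qed

lemma common_denominator:
  "\<exists>e h. h \<in> forms_at_generic e \<and> h \<noteq> 0 \<and> (\<forall>i<(n::nat). u i * h \<in> forms_at_generic e)"
proof (induction n)
  case 0
  show ?case using forms_const[of 1] by (intro exI[of _ 0] exI[of _ 1]) (simp add: hom_one)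
next
  case (Suc n)
  then obtain e h where h: "h \<in> forms_at_generic e" "h \<noteq> 0" "\<forall>i<n. u i * h \<in> forms_at_generic e"
    by blast
  obtain e' g' h' where h': "g' \<in> forms_at_generic e'" "h' \<in> forms_at_generic e'" "h' \<noteq> 0" "u n = g' / h'"
    using fraction_of_forms_at_generic[of "u n"] by blast
  have "u i * (h * h') \<in> forms_at_generic (e + e')" if "i < Suc n" for i
  proof (cases "i = n")
    case True
    thus ?thesis using forms_mult[OF h(1) h'(1)] h' by (simp add: mult.commute)
  next
    case False
    thus ?thesis using forms_mult[OF _ h'(2), of "u i * h" e] h that by (simp add: mult.assoc)
  qed
  thus ?case using forms_mult[OF h(1) h'(2)] h h' by (intro exI[of _ "e + e'"] exI[of _ "h * h'"]) auto
qed

lemma nonempty: "\<C> \<noteq> {}"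
  using curve by (simp add: nonsingular_projective_curve_def geometrically_irreducible_def)

lemma generic_coordinate: "\<exists>j. \<xi> j \<noteq> 0"
proof -
  obtain P where P: "P \<in> \<C>" using nonempty by blast
  then obtain x j where "P = proj_point x" "x j \<noteq> 0" by (rule point_cases)
  thus ?thesis using form_nonzero[of x 1 "coord j"] P homogeneous_coord by auto
qed

end

locale finite_proj_curve = proj_curve \<C> \<iota> \<xi>
  for \<C> :: "('n::finite, 'a::{field,finite}) point set" and \<iota> :: "'a \<Rightarrow> 'k::field" and \<xi> :: "'n \<Rightarrow> 'k"
begin

text \<open>
  Let \<open>K\<close> be algebraic over \<open>k(t)\<close> and let \<open>x j\<close> be affine coordinates of the generic point.  For a
  common denominator \<open>\<alpha>\<close>, the products \<open>\<alpha> * x j\<close> are expressed through the finitely many monomials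
  \<open>e \<kappa>\<close> with \<open>\<kappa> j < d j\<close>, with coefficients that are polynomials in \<open>t\<close> of degree at most \<open>D\<close>.
  Hence \<open>\<alpha> ^ N\<close> times a monomial of degree \<open>N\<close> lies in the space \<open>V (N * D)\<close> spanned by \<open>t ^ i * e \<kappa>\<close>
  with \<open>i \<le> N * D\<close>, whose number of generators grows linearly in \<open>N\<close>.
\<close>

lemma card_forms_linear:
  "\<exists>c. \<forall>N. finite (forms_at_generic N) \<and> card (forms_at_generic N) \<le> CARD('a) ^ (c * (N + 1))"
proof -
  obtain t where t: "\<And>f. algebraic_over (simple_extension (range \<iota>) t) f"
    using curve unfolding nonsingular_projective_curve_def transcendence_degree_one_def by blast
  obtain j0 where j0: "\<xi> j0 \<noteq> 0" using generic_coordinate by blast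
  define x where "x j = \<xi> j / \<xi> j0" for j
  have "\<forall>j. \<exists>d a B. d \<ge> 1 \<and> a \<noteq> 0 \<and> a \<in> polys_in t \<and> (\<forall>i. B i \<in> polys_in t) \<and>
           a * x j ^ d = (\<Sum>i<d. B i * x j ^ i)"
    using algebraic_relation[OF t] by blast
  from choice[OF this] obtain d where "\<forall>j. \<exists>a B. d j \<ge> 1 \<and> a \<noteq> 0 \<and> a \<in> polys_in t \<and>
      (\<forall>i. B i \<in> polys_in t) \<and> a * x j ^ d j = (\<Sum>i<d j. B i * x j ^ i)" ..
  from choice[OF this] obtain a where "\<forall>j. \<exists>B. d j \<ge> 1 \<and> a j \<noteq> 0 \<and> a j \<in> polys_in t \<and>
      (\<forall>i. B i \<in> polys_in t) \<and> a j * x j ^ d j = (\<Sum>i<d j. B i * x j ^ i)" ..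
  from choice[OF this] obtain B where dB: "\<forall>j. d j \<ge> 1 \<and> a j \<noteq> 0 \<and> a j \<in> polys_in t \<and>
      (\<forall>i. B j i \<in> polys_in t) \<and> a j * x j ^ d j = (\<Sum>i<d j. B j i * x j ^ i)" ..
  have d: "d j \<ge> 1" and a: "a j \<noteq> 0" "a j \<in> polys_in t" and B: "B j i \<in> polys_in t"
    and rel: "a j * x j ^ d j = (\<Sum>i<d j. B j i * x j ^ i)" for j i
    using spec[OF dB, of j] by simp_all
  define \<alpha> where "\<alpha> = (\<Prod>j\<in>UNIV. a j)"
  define B' where "B' j i = (\<Prod>l\<in>UNIV - {j}. a l) * B j i" for j i
  have \<alpha>0: "\<alpha> \<noteq> 0" using a by (simp add: \<alpha>_def)
  have rel': "\<alpha> * x j ^ d j = (\<Sum>i<d j. B' j i * x j ^ i)" for j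
  proof -
    have "\<alpha> = (\<Prod>l\<in>UNIV - {j}. a l) * a j"
      unfolding \<alpha>_def by (subst prod.remove[of UNIV j]) auto
    thus ?thesis by (simp add: mult.assoc rel sum_distrib_left B'_def)
  qed
  have "\<alpha> \<in> polys_in t" unfolding \<alpha>_def using a by (intro polys_in_prod)
  then obtain D1 where D1: "\<alpha> \<in> polys_upto t D1" by (auto simp: polys_in_def)
  have "\<exists>D. \<forall>ji\<in>(SIGMA j:UNIV. {..<d j}). B' (fst ji) (snd ji) \<in> polys_upto t D"
    unfolding B'_def using a B by (intro polys_in_bounded polys_in_mult polys_in_prod) auto
  then obtain D2 where D2: "\<And>j i. i < d j \<Longrightarrow> B' j i \<in> polys_upto t D2" by force
  define D where "D = max D1 D2"
  have D: "\<alpha> \<in> polys_upto t D" "\<And>j i. i < d j \<Longrightarrow> B' j i \<in> polys_upto t D"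
    using polys_upto_mono[OF _ D1, of D] polys_upto_mono[OF _ D2, of D] by (auto simp: D_def)
  define box where "box = (\<Pi>\<^sub>E j\<in>UNIV. {..<d j})"
  have box_iff: "\<kappa> \<in> box \<longleftrightarrow> (\<forall>j. \<kappa> j < d j)" for \<kappa>
    by (auto simp: box_def PiE_def Pi_def extensional_def)
  have fin_box: "finite box" unfolding box_def by (intro finite_PiE) auto
  define e where "e \<kappa> = (\<Prod>j\<in>UNIV. x j ^ \<kappa> j)" for \<kappa> :: "'n \<Rightarrow> nat"
  have e_upd: "e (\<kappa>(j := i)) = x j ^ i * (\<Prod>l\<in>UNIV - {j}. x l ^ \<kappa> l)" for \<kappa> j i
    unfolding e_def by (subst prod.remove[of UNIV j]) (auto intro!: prod.cong)
  have e_split: "e \<kappa> = x j ^ \<kappa> j * (\<Prod>l\<in>UNIV - {j}. x l ^ \<kappa> l)" for \<kappa> j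
    using e_upd[of \<kappa> j "\<kappa> j"] by simp
  define gens where "gens M = (\<lambda>(i, \<kappa>). t ^ i * e \<kappa>) ` ({..M} \<times> box)" for M :: nat
  define V where "V M = vs.span (gens M)" for M
  have V_base: "t ^ i * e \<kappa> \<in> V M" if "i \<le> M" "\<kappa> \<in> box" for i \<kappa> M
    unfolding V_def using that by (intro vs.span_base) (auto simp: gens_def)
  have V_subspace: "vs.subspace (V M)" for M unfolding V_def by (rule vs.subspace_span)
  have V_mult: "p * y \<in> V (D' + M)" if "p \<in> polys_upto t D'" "y \<in> V M" for p y D' M
    using V_subspace _ that(1)[unfolded polys_upto_def] that(2)[unfolded V_def]
  proof (rule span_mult_mem)
    fix p y assume "p \<in> (\<lambda>i. t ^ i) ` {..D'}" "y \<in> gens M"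
    then obtain i i' \<kappa> where "i \<le> D'" "i' \<le> M" "\<kappa> \<in> box" "p * y = t ^ (i + i') * e \<kappa>"
      unfolding gens_def by (auto simp: power_add mult.assoc)
    thus "p * y \<in> V (D' + M)" using V_base by simp
  qed
  have step: "\<alpha> * x j * y \<in> V (D + M)" if "y \<in> V M" for y j M
  proof -
    have "gens M \<subseteq> {y. \<alpha> * x j * y \<in> V (D + M)}"
    proof
      fix y assume "y \<in> gens M"
      then obtain i \<kappa> where y: "i \<le> M" "\<kappa> \<in> box" "y = t ^ i * e \<kappa>"
        unfolding gens_def by auto
      have "\<alpha> * x j * y \<in> V (D + M)"
      proof (cases "Suc (\<kappa> j) < d j")
        case True
        have "x j * e \<kappa> = e (\<kappa>(j := Suc (\<kappa> j)))"
          unfolding e_upd e_split[of \<kappa> j] by simp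
        hence "\<alpha> * x j * y = \<alpha> * (t ^ i * e (\<kappa>(j := Suc (\<kappa> j))))" using y(3)
          by (simp add: mult_ac)
        moreover have "\<kappa>(j := Suc (\<kappa> j)) \<in> box" using y(2) True by (simp add: box_iff)
        ultimately show ?thesis using V_mult[OF D(1) V_base[OF y(1)]] by (simp only:)
      next
        case False
        \<comment> \<open>the exponent of \<open>x j\<close> leaves the box, and the relation for \<open>x j ^ d j\<close> brings it back\<close>
        hence dj: "d j = Suc (\<kappa> j)" using y(2) unfolding box_iff
          by (meson linorder_neqE_nat not_less_eq)
        have "x j * e \<kappa> = x j ^ d j * (\<Prod>l\<in>UNIV - {j}. x l ^ \<kappa> l)"
          unfolding e_split[of \<kappa> j] dj by simp
        hence "\<alpha> * x j * y = t ^ i * (\<alpha> * x j ^ d j) * (\<Prod>l\<in>UNIV - {j}. x l ^ \<kappa> l)"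
          using y(3) by (simp add: mult_ac)
        also have "\<dots> = (\<Sum>i'<d j. B' j i' * (t ^ i * e (\<kappa>(j := i'))))"
          unfolding rel' e_upd by (simp add: sum_distrib_left sum_distrib_right mult_ac)
        also have "\<dots> \<in> V (D + M)"
        proof (rule vs.subspace_sum[OF V_subspace])
          fix i' assume i': "i' \<in> {..<d j}"
          hence "\<kappa>(j := i') \<in> box" using y(2) by (simp add: box_iff)
          thus "B' j i' * (t ^ i * e (\<kappa>(j := i'))) \<in> V (D + M)"
            using i' y(1) by (intro V_mult D V_base) auto
        qed
        finally show ?thesis .
      qed
      thus "y \<in> {y. \<alpha> * x j * y \<in> V (D + M)}" by simp
    qed
    moreover have "vs.subspace {y. \<alpha> * x j * y \<in> V (D + M)}"
      by (rule subspace_mult_preimage[OF V_subspace])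
    ultimately have "V M \<subseteq> {y. \<alpha> * x j * y \<in> V (D + M)}" unfolding V_def[of M]
      by (rule vs.span_minimal)
    thus ?thesis using that by auto
  qed
  have mono: "\<alpha> ^ N * e \<nu> \<in> V (N * D)" if "(\<Sum>j\<in>UNIV. \<nu> j) = N" for \<nu> N
    using that
  proof (induction N arbitrary: \<nu>)
    case 0
    hence "\<nu> = (\<lambda>_. 0)" by auto
    moreover have "(\<lambda>_. 0) \<in> box" using d by (auto simp: box_iff Suc_le_eq)
    ultimately show ?case using V_base[of 0 0 "\<lambda>_. 0"] by simp
  next
    case (Suc N)
    then obtain j where j: "\<nu> j > 0" by (metis bot_nat_0.not_eq_extremum nat.distinct(1) sum.neutral)
    define \<nu>' where "\<nu>' = \<nu>(j := \<nu> j - 1)"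
    have "(\<Sum>l\<in>UNIV. \<nu> l) = \<nu> j + (\<Sum>l\<in>UNIV - {j}. \<nu> l)" "(\<Sum>l\<in>UNIV. \<nu>' l) = \<nu>' j + (\<Sum>l\<in>UNIV - {j}. \<nu>' l)"
      by (rule sum.remove; simp)+
    moreover have "(\<Sum>l\<in>UNIV - {j}. \<nu>' l) = (\<Sum>l\<in>UNIV - {j}. \<nu> l)"
      by (rule sum.cong) (auto simp: \<nu>'_def)
    ultimately have "(\<Sum>l\<in>UNIV. \<nu>' l) = N" using Suc.prems j by (simp add: \<nu>'_def)
    from step[OF Suc.IH[OF this], of j] have "\<alpha> * x j * (\<alpha> ^ N * e \<nu>') \<in> V (Suc N * D)"
      by simp
    moreover have "x j * e \<nu>' = e \<nu>"
      unfolding \<nu>'_def e_upd e_split[of \<nu> j] using j by (simp flip: power_Suc mult.assoc)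
    hence "\<alpha> * x j * (\<alpha> ^ N * e \<nu>') = \<alpha> ^ Suc N * e \<nu>"
      by (metis mult.assoc mult.left_commute power_Suc)
    ultimately show ?case by (simp only:)
  qed
  define c where "c = (D + 1) * card box"
  have "finite (forms_at_generic N) \<and> card (forms_at_generic N) \<le> CARD('a) ^ (c * (N + 1))" for N
  proof -
    have fin: "finite (gens (N * D))" unfolding gens_def using fin_box by auto
    have "card (gens (N * D)) \<le> card ({..N * D} \<times> box)"
      unfolding gens_def using fin_box by (intro card_image_le) auto
    also have "\<dots> \<le> ((N + 1) * (D + 1)) * card box" by (simp add: card_cartesian_product)
    finally have gens: "card (gens (N * D)) \<le> c * (N + 1)" by (simp add: c_def algebra_simps)
    have V: "finite (V (N * D))" "card (V (N * D)) \<le> CARD('a) ^ (card (gens (N * D)))"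
      unfolding V_def using span_of_finite[OF field_hom_axioms fin] by auto
    define s where "s = \<alpha> ^ N / \<xi> j0 ^ N"
    have s0: "s \<noteq> 0" using \<alpha>0 j0 by (simp add: s_def)
    have sub: "(\<lambda>y. s * y) ` forms_at_generic N \<subseteq> V (N * D)"
    proof safe
      fix y assume "y \<in> forms_at_generic N"
      then obtain G where G: "homogeneous N G" "y = mpoly_eval \<iota> G \<xi>"
        by (auto simp: forms_at_generic_def)
      have "s * y = (\<Sum>\<mu>\<in>Poly_Mapping.keys G. scale \<iota> (Poly_Mapping.lookup G \<mu>) (\<alpha> ^ N * e (Poly_Mapping.lookup \<mu>)))"
        unfolding G(2) mpoly_eval_def sum_distrib_left
      proof (rule sum.cong)
        fix \<mu> assume "\<mu> \<in> Poly_Mapping.keys G"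
        hence "(\<Prod>j\<in>UNIV. \<xi> j0 ^ Poly_Mapping.lookup \<mu> j) = \<xi> j0 ^ N"
          using G(1) by (simp add: homogeneous_def flip: power_sum)
        hence "mono_eval \<xi> \<mu> = \<xi> j0 ^ N * e (Poly_Mapping.lookup \<mu>)"
          unfolding e_def x_def using j0 by (simp add: power_divide prod_dividef)
        thus "s * (\<iota> (Poly_Mapping.lookup G \<mu>) * mono_eval \<xi> \<mu>)
            = scale \<iota> (Poly_Mapping.lookup G \<mu>) (\<alpha> ^ N * e (Poly_Mapping.lookup \<mu>))"
          using j0 by (simp add: s_def scale_def)
      qed simp
      also have "\<dots> \<in> V (N * D)"
        using G(1) by (intro vs.subspace_sum[OF V_subspace] vs.subspace_scale[OF V_subspace] mono)
          (auto simp: homogeneous_def)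
      finally show "s * y \<in> V (N * D)" .
    qed
    have inj: "inj_on (\<lambda>y. s * y) (forms_at_generic N)" using s0 by (auto simp: inj_on_def)
    have "card (forms_at_generic N) \<le> card (V (N * D))" using inj sub V(1) by (rule card_inj_on_le)
    also note V(2)
    also have "CARD('a) ^ (card (gens (N * D))) \<le> CARD('a) ^ (c * (N + 1))"
      using gens by (intro power_increasing) (auto simp: Suc_le_eq)
    finally show ?thesis using inj sub V(1) by (auto intro: inj_on_finite)
  qed
  thus ?thesis by blast
qed

text \<open>
  Write \<open>y = g / h\<close> with forms of degree \<open>e\<close>.  With a common denominator of the \<open>u i\<close>, all elements
  \<open>y ^ j * u i\<close> for \<open>j \<le> N\<close> become forms of degree \<open>N * e + e'\<close>.  There are at most
  \<open>q ^ (c * (N * e + e' + 1))\<close> such forms, but \<open>q ^ (n * (N + 1))\<close> combinations.  If \<open>n > c * e\<close> and \<open>N\<close>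
  is large, then two combinations coincide.
\<close>

theorem finite_rank: "\<exists>d. \<forall>u. poly_dep \<iota> y u d"
proof -
  obtain c where fin: "\<And>N. finite (forms_at_generic N)"
    and c: "\<And>N. card (forms_at_generic N) \<le> CARD('a) ^ (c * (N + 1))"
    using card_forms_linear by blast
  obtain e g h where y: "g \<in> forms_at_generic e" "h \<in> forms_at_generic e" "h \<noteq> 0" "y = g / h"
    using fraction_of_forms_at_generic by blast
  have "poly_dep \<iota> y u (c * e + 1)" for u
  proof -
    define n where "n = c * e + 1"
    obtain e' h' where h': "h' \<in> forms_at_generic e'" "h' \<noteq> 0" "\<forall>i<n. u i * h' \<in> forms_at_generic e'"
      using common_denominator[of n u] by blast
    \<comment> \<open>a value for which \<open>c * (N * e + e' + 1) < n * (N + 1)\<close>\<close>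
    define N where "N = c * (e' + 1)"
    define Y where "Y = ({..<n} \<times> {..N}) \<rightarrow>\<^sub>E (UNIV :: 'a set)"
    define F where "F k = (\<Sum>i<n. \<Sum>j\<le>N. \<iota> (k (i, j)) * y ^ j * u i)" for k
    have "(\<lambda>k. h ^ N * h' * F k) ` Y \<subseteq> forms_at_generic (N * e + e')"
    proof safe
      fix k
      have "h ^ N * h' * F k = (\<Sum>i<n. \<Sum>j\<le>N. \<iota> (k (i, j)) * (g ^ j * h ^ (N - j) * (u i * h')))"
        unfolding F_def sum_distrib_left
      proof (intro sum.cong refl)
        fix i j assume "j \<in> {..N}"
        hence "h ^ N = h ^ (N - j) * h ^ j" by (simp flip: power_add)
        hence "h ^ N * y ^ j = g ^ j * h ^ (N - j)" using y(3) by (simp add: y(4) power_divide)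
        thus "h ^ N * h' * (\<iota> (k (i, j)) * y ^ j * u i) = \<iota> (k (i, j)) * (g ^ j * h ^ (N - j) * (u i * h'))"
          by (metis (no_types, opaque_lifting) mult.assoc mult.commute)
      qed
      also have "\<dots> \<in> forms_at_generic (N * e + e')"
      proof (intro forms_sum forms_const_mult)
        fix i j assume ij: "i \<in> {..<n}" "j \<in> {..N}"
        have "g ^ j * h ^ (N - j) * (u i * h') \<in> forms_at_generic (j * e + (N - j) * e + e')"
          using y h' ij by (intro forms_mult forms_power) auto
        thus "g ^ j * h ^ (N - j) * (u i * h') \<in> forms_at_generic (N * e + e')"
          using ij by (simp flip: add_mult_distrib)
      qed
      finally show "h ^ N * h' * F k \<in> forms_at_generic (N * e + e')" .
    qed
    hence "card ((\<lambda>k. h ^ N * h' * F k) ` Y) \<le> card (forms_at_generic (N * e + e'))"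
      using fin by (intro card_mono)
    also note c
    also have "CARD('a) ^ (c * (N * e + e' + 1)) < CARD('a) ^ (n * (N + 1))"
    proof (rule power_strict_increasing)
      show "c * (N * e + e' + 1) < n * (N + 1)" by (simp add: n_def N_def algebra_simps)
      have "card {0, 1 :: 'a} \<le> CARD('a)" by (intro card_mono) auto
      thus "1 < CARD('a)" by simp
    qed
    also have "CARD('a) ^ (n * (N + 1)) = card Y"
      by (simp add: Y_def card_funcsetE card_cartesian_product)
    finally have "\<not> inj_on (\<lambda>k. h ^ N * h' * F k) Y" using pigeonhole by blast
    then obtain k k' where k: "k \<in> Y" "k' \<in> Y" "k \<noteq> k'" "h ^ N * h' * F k = h ^ N * h' * F k'"
      unfolding inj_on_def by blast
    have "\<exists>p\<in>{..<n} \<times> {..N}. k p \<noteq> k' p" using k(1-3) unfolding Y_def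
      by (metis PiE_ext)
    hence "\<exists>i<n. \<exists>j\<le>N. k (i, j) - k' (i, j) \<noteq> 0" by force
    moreover have "F k = F k'" using k(4) y(3) h'(2) by simp
    hence "(\<Sum>i<n. \<Sum>j\<le>N. \<iota> (k (i, j) - k' (i, j)) * y ^ j * u i) = 0"
      unfolding F_def by (simp add: hom_diff left_diff_distrib sum_subtractf)
    ultimately show ?thesis unfolding poly_dep_def n_def[symmetric]
      by (intro exI[of _ N] exI[of _ "\<lambda>i j. k (i, j) - k' (i, j)"]) simp
  qed
  thus ?thesis by blast
qed

end

section \<open>Local rings with principal maximal ideal\<close>

text \<open>
  A local ring, given by the graph of its residue map, with quotient field \<open>'k\<close> and principal maximal
  ideal generated by \<open>t\<close>.  The last three assumptions hold for the function field \<open>'k\<close> of a curve over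
  \<open>'a\<close> and residue fields algebraic over \<open>'a\<close>; they replace the Noetherian hypothesis by which one
  usually recognises a discrete valuation ring.
\<close>

locale dvr_graph = graph_ring \<iota> \<kappa> g
  for \<iota> :: "'a::field \<Rightarrow> 'k::field" and \<kappa> :: "'a \<Rightarrow> 'w::field" and g +
  fixes t :: 'k
  assumes inverse: "(a, b) \<in> g \<Longrightarrow> b \<noteq> 0 \<Longrightarrow> (inverse a, inverse b) \<in> g"
    and fractions: "\<exists>a b y z. (a, y) \<in> g \<and> (b, z) \<in> g \<and> b \<noteq> 0 \<and> f = a / b"
    and t_residue: "(t, 0) \<in> g"
    and t_divides: "(f, 0) \<in> g \<Longrightarrow> \<exists>h y. (h, y) \<in> g \<and> f = t * h"
    and finite_rank: "\<exists>d. \<forall>u. poly_dep \<iota> x u d"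
    and residue_algebraic: "\<exists>N c. (\<exists>j\<le>N. c j \<noteq> 0) \<and> (\<Sum>j\<le>N. \<kappa> (c j) * y ^ j) = 0"
    and transcendental: "\<exists>x. \<forall>N c. (\<exists>j\<le>N. c j \<noteq> 0) \<longrightarrow> (\<Sum>j\<le>N. \<iota> (c j) * x ^ j) \<noteq> 0"
begin

definition unit :: "'k \<Rightarrow> bool" where "unit u \<longleftrightarrow> (\<exists>z. z \<noteq> 0 \<and> (u, z) \<in> g)"

lemma unit_nonzero: "unit u \<Longrightarrow> u \<noteq> 0" unfolding unit_def using functional by blast

lemma unit_mult: "unit u \<Longrightarrow> unit u' \<Longrightarrow> unit (u * u')"
  unfolding unit_def using mult no_zero_divisors by blast

lemma unit_inverse: "unit u \<Longrightarrow> unit (inverse u)"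
  unfolding unit_def using inverse inverse_nonzero_iff_nonzero by blast

lemma unit_const: "c \<noteq> 0 \<Longrightarrow> unit (\<iota> c)"
  unfolding unit_def using const by (intro exI[of _ "\<kappa> c"]) auto

lemma unit_one: "unit 1" using unit_const[of 1] by (simp add: hom_one)

lemma unit_power_int: "unit u \<Longrightarrow> unit (u powi k)"
proof -
  assume u: "unit u"
  have "unit (u ^ n)" for n by (induction n) (auto simp: unit_one unit_mult u)
  thus ?thesis using u unit_inverse unfolding power_int_def by (auto simp: power_inverse)
qed

lemma not_unit: "(u, 0) \<in> g \<Longrightarrow> \<not> unit u" unfolding unit_def using unique by blast

lemma unit_or_maximal: "(f, y) \<in> g \<Longrightarrow> unit f \<or> (f, 0) \<in> g"
  unfolding unit_def by (cases "y = 0") auto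

text \<open>
  Otherwise the local ring would be a field, so all of \<open>'k\<close>, and the residue map would be injective.
  Then every element of \<open>'k\<close> would be algebraic, like its residue.
\<close>

lemma t_nonzero: "t \<noteq> 0"
proof
  assume "t = 0"
  hence zero_only: "f = 0" if "(f, 0) \<in> g" for f using t_divides[OF that] by auto
  obtain x where x: "\<And>N c. (\<exists>j\<le>N. c j \<noteq> 0) \<Longrightarrow> (\<Sum>j\<le>N. \<iota> (c j) * x ^ j) \<noteq> 0"
    using transcendental by blast
  obtain a b y z where ab: "(a, y) \<in> g" "(b, z) \<in> g" "b \<noteq> 0" "x = a / b" using fractions
    by blast
  have "z \<noteq> 0" using ab zero_only by blast
  from mult[OF ab(1) inverse[OF ab(2) this]] have xg: "(x, y * inverse z) \<in> g"
    by (simp add: ab(4) divide_inverse)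
  obtain N c where c: "\<exists>j\<le>N. c j \<noteq> 0" "(\<Sum>j\<le>N. \<kappa> (c j) * (y * inverse z) ^ j) = 0"
    using residue_algebraic by blast
  have "(\<Sum>j\<le>N. \<iota> (c j) * x ^ j, \<Sum>j\<le>N. \<kappa> (c j) * (y * inverse z) ^ j) \<in> g"
    by (intro sum mult const power xg)
  with c zero_only x[OF c(1)] show False by simp
qed

lemma poly_in_t:
  assumes "\<exists>j\<le>N. c j \<noteq> 0"
  shows "\<exists>j u. unit u \<and> (\<Sum>j\<le>N. \<iota> (c j) * t ^ j) = t ^ j * u"
proof -
  let ?P = "\<lambda>j. j \<le> N \<and> c j \<noteq> 0"
  define j0 where "j0 = (LEAST j. ?P j)"
  have P0: "?P j0" unfolding j0_def using assms by (intro LeastI_ex[of ?P])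
  have low: "c j = 0" if "j < j0" for j
    using not_less_Least[of j ?P] that P0 unfolding j0_def[symmetric] by auto
  define u where "u = (\<Sum>j\<le>N - j0. \<iota> (c (j + j0)) * t ^ j)"
  have "(\<Sum>j\<le>N. \<iota> (c j) * t ^ j) = (\<Sum>j\<in>{j0..N}. \<iota> (c j) * t ^ j)"
    by (rule sum.mono_neutral_right) (use low in auto)
  also have "\<dots> = (\<Sum>j\<le>N - j0. \<iota> (c (j + j0)) * t ^ (j + j0))"
    by (rule sum.reindex_bij_witness[of _ "\<lambda>j. j + j0" "\<lambda>j. j - j0"]) (use P0 in auto)
  also have "\<dots> = t ^ j0 * u"
    unfolding u_def sum_distrib_left by (rule sum.cong) (auto simp: power_add mult_ac)
  finally have eq: "(\<Sum>j\<le>N. \<iota> (c j) * t ^ j) = t ^ j0 * u" .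
  have "(u, \<Sum>j\<le>N - j0. \<kappa> (c (j + j0)) * 0 ^ j) \<in> g"
    unfolding u_def by (intro sum mult const power t_residue)
  moreover have "(\<Sum>j\<le>N - j0. \<kappa> (c (j + j0)) * 0 ^ j) = \<kappa> (c j0)"
    by (simp add: sum.atMost_shift)
  ultimately have "unit u" unfolding unit_def using P0 by (intro exI[of _ "\<kappa> (c j0)"]) simp
  with eq show ?thesis by blast
qed

text \<open>
  The powers of \<open>f\<close> satisfy a relation with coefficients in \<open>k[t]\<close>.  Cancelling a power of \<open>f\<close>, one may
  assume that the constant coefficient is non-zero.  It is divisible by \<open>f\<close>, and by \<open>poly_in_t\<close> it is a
  power of \<open>t\<close> times a unit.
\<close>

lemma divides_power_of_t:
  assumes "(f, y) \<in> g" "f \<noteq> 0"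
  shows "\<exists>j w z. (w, z) \<in> g \<and> t ^ j = f * w"
proof -
  obtain d where "poly_dep \<iota> t (\<lambda>i. f ^ i) d" using finite_rank by blast
  then obtain N c where c: "\<exists>i<d. \<exists>j\<le>N. c i j \<noteq> 0"
    and sum0: "(\<Sum>i<d. \<Sum>j\<le>N. \<iota> (c i j) * t ^ j * f ^ i) = 0"
    unfolding poly_dep_def by blast
  let ?P = "\<lambda>i. i < d \<and> (\<exists>j\<le>N. c i j \<noteq> 0)"
  define A where "A i = (\<Sum>j\<le>N. \<iota> (c i j) * t ^ j)" for i
  define i0 where "i0 = (LEAST i. ?P i)"
  have P0: "?P i0" unfolding i0_def using c by (intro LeastI_ex[of ?P])
  have low: "A i = 0" if "i < i0" for i
    using not_less_Least[of i ?P] that P0 unfolding i0_def[symmetric] A_def by (auto intro!: sum.neutral)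
  define yA where "yA i = (\<Sum>j\<le>N. \<kappa> (c i j) * 0 ^ j)" for i
  have A_in: "(A i, yA i) \<in> g" for i
    unfolding A_def yA_def by (intro sum mult const power t_residue)
  define w where "w = (\<Sum>i<d - Suc i0. A (i + Suc i0) * f ^ i)"
  have "0 = (\<Sum>i<d. A i * f ^ i)" using sum0 by (simp add: A_def sum_distrib_right)
  also have "\<dots> = (\<Sum>i\<in>{i0..<d}. A i * f ^ i)"
    by (rule sum.mono_neutral_right) (use low in auto)
  also have "\<dots> = A i0 * f ^ i0 + (\<Sum>i\<in>{Suc i0..<d}. A i * f ^ i)"
    using P0 by (simp add: sum.atLeast_Suc_lessThan)
  also have "(\<Sum>i\<in>{Suc i0..<d}. A i * f ^ i) = (\<Sum>i<d - Suc i0. A (i + Suc i0) * f ^ (i + Suc i0))"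
    by (rule sum.reindex_bij_witness[of _ "\<lambda>i. i + Suc i0" "\<lambda>i. i - Suc i0"]) auto
  also have "\<dots> = f ^ i0 * (f * w)"
    unfolding w_def sum_distrib_left by (rule sum.cong) (auto simp: power_add mult_ac)
  finally have "f ^ i0 * (A i0 + f * w) = 0" by (simp add: algebra_simps)
  hence rel: "A i0 = f * (- w)" using assms(2) by (simp add: eq_neg_iff_add_eq_0)
  have "(w, \<Sum>i<d - Suc i0. yA (i + Suc i0) * y ^ i) \<in> g"
    unfolding w_def using A_in assms(1) by (intro sum mult power)
  hence w: "\<exists>z. (- w, z) \<in> g" using uminus by blast
  obtain j u where u: "unit u" "A i0 = t ^ j * u" using poly_in_t[of N "c i0"] P0 unfolding A_def by blast
  have "t ^ j = f * (- w * inverse u)" using rel u unit_nonzero[OF u(1)] by (simp add: field_simps)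
  moreover have "\<exists>z. (- w * inverse u, z) \<in> g"
    using w unit_inverse[OF u(1)] mult unfolding unit_def by blast
  ultimately show ?thesis by blast
qed

text \<open>
  The powers of \<open>t\<close> that divide \<open>f\<close> are bounded, as \<open>f\<close> divides some power of \<open>t\<close>.  The cofactor of the
  largest one is not divisible by \<open>t\<close>, so it is a unit.
\<close>

lemma factor_local:
  assumes "(f, y) \<in> g" "f \<noteq> 0"
  shows "\<exists>n u. unit u \<and> f = t ^ n * u"
proof -
  obtain j w z where w: "(w, z) \<in> g" "t ^ j = f * w" using divides_power_of_t[OF assms] by blast
  let ?P = "\<lambda>n. \<exists>h y. (h, y) \<in> g \<and> f = t ^ n * h"
  have bound: "n \<le> j" if n: "?P n" for n
  proof (rule ccontr)
    assume "\<not> n \<le> j"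
    then obtain k where k: "n = j + Suc k" using less_imp_Suc_add[of j n] by auto
    obtain h y where h: "(h, y) \<in> g" "f = t ^ n * h" using n by blast
    have "t ^ j * 1 = t ^ j * (t ^ Suc k * (h * w))"
      using w h by (simp add: k power_add mult_ac)
    hence "1 = h * w * t ^ k * t" using t_nonzero by (simp add: mult_ac)
    moreover have "(h * w * t ^ k * t, 0) \<in> g"
      by (rule ideal_mult[OF mult[OF mult[OF h(1) w(1)] power[OF t_residue]] t_residue])
    ultimately show False using not_unit unit_one by metis
  qed
  have "?P 0" using assms by (intro exI[of _ f] exI[of _ y]) simp
  hence "?P (GREATEST n. ?P n)" using bound by (rule GreatestI_nat) 
  then obtain n h y' where n: "n = (GREATEST n. ?P n)" and h: "(h, y') \<in> g" "f = t ^ n * h" by blast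
  have "unit h"
  proof (rule ccontr)
    assume "\<not> unit h"
    with unit_or_maximal[OF h(1)] have "(h, 0) \<in> g" by blast
    from t_divides[OF this] h have "?P (Suc n)" by (auto simp: mult_ac)
    hence "Suc n \<le> n" unfolding n using bound by (rule Greatest_le_nat)
    thus False by simp
  qed
  with h show ?thesis by blast
qed

lemma factor:
  assumes "f \<noteq> 0"
  shows "\<exists>k u. unit u \<and> f = t powi k * u"
proof -
  obtain a b y z where ab: "(a, y) \<in> g" "(b, z) \<in> g" "b \<noteq> 0" "f = a / b" using fractions
    by blast
  obtain n u where u: "unit u" "a = t ^ n * u" using factor_local[OF ab(1)] ab assms by auto
  obtain m u' where u': "unit u'" "b = t ^ m * u'" using factor_local[OF ab(2,3)] by blast
  have "f = t powi (int n - int m) * (u * inverse u')"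
    using u u' ab t_nonzero by (simp add: power_int_diff field_simps)
  thus ?thesis using u u' unit_mult unit_inverse by blast
qed

lemma exponent_unique:
  assumes "unit u" "unit u'" "t powi k * u = t powi k' * u'"
  shows "k = k'"
proof -
  have no: "\<not> k < k'" if eq: "unit u" "unit u'" "t powi k * u = t powi k' * u'" for k k' u u'
  proof
    assume "k < k'"
    then obtain n where n: "k' = k + int (Suc n)" by (metis add.commute zless_iff_Suc_zadd)
    have "t powi k * u = t powi k * (t ^ Suc n * u')"
      using eq t_nonzero unfolding n by (simp add: power_int_add mult_ac)
    hence "u * inverse u' = t ^ n * t" using t_nonzero unit_nonzero[OF eq(2)] by (simp add: field_simps)
    moreover have "(t ^ n * t, 0) \<in> g" by (rule ideal_mult[OF power[OF t_residue] t_residue])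
    moreover have "unit (u * inverse u')" using eq unit_mult unit_inverse by blast
    ultimately show False using not_unit by metis
  qed
  from no[OF assms] no[OF assms(2,1) assms(3)[symmetric]] show ?thesis by simp
qed

context
  fixes w :: "'k \<Rightarrow> int"
  assumes w: "\<And>f. f \<noteq> 0 \<Longrightarrow> \<exists>u. unit u \<and> f = t powi (w f) * u"
begin

lemma order_eq: "unit u \<Longrightarrow> w (t powi k * u) = k"
proof -
  assume u: "unit u"
  hence "t powi k * u \<noteq> 0" using t_nonzero unit_nonzero by simp
  from w[OF this] obtain u' where "unit u'" "t powi k * u = t powi (w (t powi k * u)) * u'" by blast
  thus ?thesis using exponent_unique[OF u] by metis
qed

lemma order_local: "f \<noteq> 0 \<Longrightarrow> (\<exists>y. (f, y) \<in> g) \<longleftrightarrow> w f \<ge> 0"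
proof
  assume f: "f \<noteq> 0" "w f \<ge> 0"
  obtain u where u: "unit u" "f = t powi (w f) * u" using w f by blast
  have f_eq: "t ^ nat (w f) * u = f" using u(2) f(2) by (simp add: power_int_def)
  obtain z where "(u, z) \<in> g" using u(1) unfolding unit_def by blast
  from mult[OF power[OF t_residue] this] have "\<exists>y. (t ^ nat (w f) * u, y) \<in> g" by blast
  thus "\<exists>y. (f, y) \<in> g" unfolding f_eq .
next
  assume f: "f \<noteq> 0" "\<exists>y. (f, y) \<in> g"
  then obtain n u where u: "unit u" "f = t ^ n * u" using factor_local by blast
  hence "w f = int n" using order_eq[of u "int n"] by simp
  thus "w f \<ge> 0" by simp
qed

lemma order_maximal: "f \<noteq> 0 \<Longrightarrow> (f, 0) \<in> g \<longleftrightarrow> w f \<ge> 1"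
proof
  assume f: "f \<noteq> 0" "w f \<ge> 1"
  then obtain y where "(f, y) \<in> g" using order_local[OF f(1)] by auto
  moreover have "\<not> unit f" using order_eq[of f 0] f by auto
  ultimately show "(f, 0) \<in> g" using unit_or_maximal by blast
next
  assume f: "f \<noteq> 0" "(f, 0) \<in> g"
  then obtain u where u: "unit u" "f = t powi (w f) * u" using w by blast
  have "w f \<noteq> 0"
  proof
    assume 0: "w f = 0"
    from u(2) have "f = u" unfolding 0 by simp
    with not_unit[OF f(2)] u(1) show False by simp
  qed
  moreover have "w f \<ge> 0" using order_local f by blast
  ultimately show "w f \<ge> 1" by simp
qed

lemma order_discrete_valuation: "discrete_valuation \<iota> w"
proof unfold_locales
  show mult: "w (x * y) = w x + w y" if "x \<noteq> 0" "y \<noteq> 0" for x y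
  proof -
    from w[OF that(1)] obtain u where u: "unit u" "t powi (w x) * u = x" by metis
    from w[OF that(2)] obtain u' where u': "unit u'" "t powi (w y) * u' = y" by metis
    have "t powi (w x + w y) * (u * u') = (t powi (w x) * u) * (t powi (w y) * u')"
      using t_nonzero by (simp add: power_int_add mult_ac)
    also have "\<dots> = x * y" unfolding u(2) u'(2) ..
    finally show ?thesis using order_eq[OF unit_mult[OF u(1) u'(1)]] by metis
  qed
  show "\<exists>t. t \<noteq> 0 \<and> w t = 1" using order_eq[OF unit_one, of 1] t_nonzero by auto
  show "w (\<iota> c) = 0" if "c \<noteq> 0" for c using order_eq[OF unit_const[OF that], of 0] by simp
  have le: "w x \<le> w (x + y)" if "x \<noteq> 0" "y \<noteq> 0" "x + y \<noteq> 0" "w x \<le> w y" for x y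
  proof -

    have "w y = w (y / x) + w x" using mult[of "y / x" x] that by simp
    hence "w (y / x) \<ge> 0" using that(4) by linarith
    moreover have "y / x \<noteq> 0" using that(1,2) by simp
    ultimately obtain z where z: "(y / x, z) \<in> g" using order_local by blast
    have "1 + y / x \<noteq> 0" using that by (simp add: field_simps)
    hence "w (1 + y / x) \<ge> 0" using order_local add[OF one z] by blast
    moreover have "(1 + y / x) * x = x + y" using that(1) by (simp add: distrib_right)
    hence "w (x + y) = w (1 + y / x) + w x" using mult[OF \<open>1 + y / x \<noteq> 0\<close> that(1)]
      by simp
    ultimately show ?thesis by simp
  qed
  show "min (w x) (w y) \<le> w (x + y)" if "x \<noteq> 0" "y \<noteq> 0" "x + y \<noteq> 0" for x y
    using le[of x y] le[of y x] that by (cases "w x \<le> w y") (auto simp: add.commute)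
qed

end

end

section \<open>Valuations at the points of a projective curve\<close>

lemma proj_point_scale:
  assumes "c \<noteq> 0"
  shows "proj_point (\<lambda>j. c * x j) = proj_point x"
proof (rule subset_antisym)
  show "proj_point (\<lambda>j. c * x j) \<subseteq> proj_point x"
  proof
    fix z assume "z \<in> proj_point (\<lambda>j. c * x j)"
    then obtain d where "d \<noteq> 0" "z = (\<lambda>j. d * (c * x j))" unfolding proj_point_def by blast
    thus "z \<in> proj_point x" unfolding proj_point_def using assms
      by (intro CollectI exI[of _ "d * c"]) (simp add: mult.assoc)
  qed
  show "proj_point x \<subseteq> proj_point (\<lambda>j. c * x j)"
  proof
    fix z assume "z \<in> proj_point x"
    then obtain d where "d \<noteq> 0" "z = (\<lambda>j. d * x j)" unfolding proj_point_def by blast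
    thus "z \<in> proj_point (\<lambda>j. c * x j)" unfolding proj_point_def using assms
      by (intro CollectI exI[of _ "d / c"]) simp
  qed
qed

context finite_proj_curve begin

abbreviation val :: "('n, 'a) point \<Rightarrow> 'k \<Rightarrow> int" where
  "val \<equiv> valuation \<iota> \<xi>"

lemma residue_algebraic:
  fixes y :: "'a alg_closure"
  shows "\<exists>N c. (\<exists>j\<le>N. c j \<noteq> 0) \<and> (\<Sum>j\<le>N. to_ac (c j) * y ^ j) = 0"
proof -
  obtain p :: "'a poly" where p: "p \<noteq> 0" "poly (map_poly to_ac p) y = 0"
    by (rule alg_closure_algebraic)
  have "poly (map_poly to_ac p) y = (\<Sum>j\<le>Polynomial.degree p. poly.coeff (map_poly to_ac p) j * y ^ j)"
    by (rule poly_as_sum) (simp add: degree_map_poly)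
  with p show ?thesis
    by (intro exI[of _ "Polynomial.degree p"] exI[of _ "poly.coeff p"] conjI)
      (auto simp: coeff_map_poly intro!: exI[of _ "Polynomial.degree p"])
qed

lemma transcendental: "\<exists>x. \<forall>N c. (\<exists>j\<le>N. c j \<noteq> 0) \<longrightarrow> (\<Sum>j\<le>N. \<iota> (c j) * x ^ j) \<noteq> 0"
proof -
  obtain t where t: "\<not> algebraic_over (range \<iota>) t"
    using curve unfolding nonsingular_projective_curve_def transcendence_degree_one_def by blast
  have "(\<Sum>j\<le>N. \<iota> (c j) * t ^ j) \<noteq> 0" if c: "j \<le> N" "c j \<noteq> 0" for N c j
  proof
    assume 0: "(\<Sum>j\<le>N. \<iota> (c j) * t ^ j) = 0"
    define p where "p = (\<Sum>j\<le>N. monom (\<iota> (c j)) j)"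
    have coeff: "poly.coeff p i = (if i \<le> N then \<iota> (c i) else 0)" for i
      by (simp add: p_def coeff_sum)
    have "poly.coeff p j \<noteq> 0" using c by (simp add: coeff)
    hence "p \<noteq> 0" by auto
    moreover have "poly.coeff p i \<in> range \<iota>" for i
      unfolding coeff using hom_zero by (metis rangeI)
    moreover have "poly p t = 0" using 0 by (simp add: p_def poly_sum poly_monom)
    ultimately show False using t unfolding algebraic_over_def by blast
  qed
  thus ?thesis by blast
qed

lemma dvr_at_point:
  assumes "proj_point x \<in> \<C>" "x j \<noteq> 0" "uniformizer \<iota> \<xi> (proj_point x) t"
  shows "dvr_graph \<iota> to_ac (residue_graph x) t"
proof -
  interpret graph_ring \<iota> to_ac "residue_graph x" by (rule residue_graph_ring[OF assms(1)])
  have t: "t \<in> local_ring \<iota> \<xi> (proj_point x)"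
    "maximal_ideal_at \<iota> \<xi> (proj_point x) = {t * g | g. g \<in> local_ring \<iota> \<xi> (proj_point x)}"
    using assms(3) unfolding uniformizer_def by auto
  have "1 \<in> local_ring \<iota> \<xi> (proj_point x)" using one local_ring_iff[OF assms(1)] by blast
  hence "t \<in> maximal_ideal_at \<iota> \<xi> (proj_point x)" unfolding t(2) by force
  hence t0: "(t, 0) \<in> residue_graph x" using maximal_ideal_iff[OF assms(1)] by blast
  have div: "\<exists>h y. (h, y) \<in> residue_graph x \<and> f = t * h" if "(f, 0) \<in> residue_graph x" for f
  proof -
    have "f \<in> maximal_ideal_at \<iota> \<xi> (proj_point x)" using that maximal_ideal_iff[OF assms(1)]
      by blast
    thus ?thesis unfolding t(2) using local_ring_iff[OF assms(1)] by blast
  qed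
  show ?thesis
  proof (intro dvr_graph.intro graph_ring_axioms dvr_graph_axioms.intro)
    show "\<exists>a b y z. (a, y) \<in> residue_graph x \<and> (b, z) \<in> residue_graph x \<and> b \<noteq> 0 \<and> f = a / b" for f
      using fraction_of_local_ring[OF assms(1,2), of f] by metis
  qed (use t0 div residue_graph_inverse[OF assms(1)] finite_rank residue_algebraic transcendental in auto)
qed

text \<open>
  The exponent of \<open>f\<close> does not depend on the uniformizer: two uniformizers divide each other, so they
  differ by a unit.
\<close>

lemma valuation_at_point:
  assumes x: "proj_point x \<in> \<C>" "x j \<noteq> 0"
  shows "discrete_valuation \<iota> (val (proj_point x))"
    and "f \<in> val_ge (val (proj_point x)) 0 \<longleftrightarrow> (\<exists>y. (f, y) \<in> residue_graph x)"
    and "f \<in> val_ge (val (proj_point x)) 1 \<longleftrightarrow> (f, 0) \<in> residue_graph x"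
proof -
  obtain t where t: "uniformizer \<iota> \<xi> (proj_point x) t"
    using curve x unfolding nonsingular_projective_curve_def by blast
  interpret D: dvr_graph \<iota> to_ac "residue_graph x" t by (rule dvr_at_point[OF x t])
  have unit_iff: "u \<in> local_ring \<iota> \<xi> (proj_point x) - maximal_ideal_at \<iota> \<xi> (proj_point x) \<longleftrightarrow> D.unit u" for u
    using D.unit_or_maximal D.not_unit
    unfolding Diff_iff local_ring_iff[OF x(1)] maximal_ideal_iff[OF x(1)] D.unit_def by blast
  have w: "\<exists>u. D.unit u \<and> f = t powi (val (proj_point x) f) * u" if f: "f \<noteq> 0" for f
  proof -
    obtain k u where ku: "D.unit u" "f = t powi k * u" using D.factor[OF f] by blast
    have val_f: "val (proj_point x) f = k"
      unfolding valuation_def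
    proof (rule the_equality)
      show "\<exists>t u. uniformizer \<iota> \<xi> (proj_point x) t \<and> u \<in> local_ring \<iota> \<xi> (proj_point x) -
          maximal_ideal_at \<iota> \<xi> (proj_point x) \<and> f = t powi k * u"
        using t ku unit_iff by blast
      fix k' assume "\<exists>t u. uniformizer \<iota> \<xi> (proj_point x) t \<and> u \<in> local_ring \<iota> \<xi> (proj_point x) -
          maximal_ideal_at \<iota> \<xi> (proj_point x) \<and> f = t powi k' * u"
      then obtain t' u' where t': "uniformizer \<iota> \<xi> (proj_point x) t'"
        and u': "D.unit u'" "f = t' powi k' * u'" using unit_iff by blast
      interpret D': dvr_graph \<iota> to_ac "residue_graph x" t' by (rule dvr_at_point[OF x t'])
      obtain s y where s: "(s, y) \<in> residue_graph x" "t' = t * s" using D.t_divides[OF D'.t_residue]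
        by blast
      obtain s' y' where s': "(s', y') \<in> residue_graph x" "t = t' * s'"
        using D'.t_divides[OF D.t_residue] by blast
      have "t * (s * s') = (t * s) * s'" by (simp only: mult.assoc)
      also have "\<dots> = t" by (simp only: s(2)[symmetric] s'(2)[symmetric])
      finally have "t * (s * s') = t * 1" by simp
      hence "s * s' = 1" using D.t_nonzero by simp
      hence "(1, y * y') \<in> residue_graph x" using D.mult[OF s(1) s'(1)] by (simp only:)
      from D.unique[OF D.one this] have "y \<noteq> 0" by auto
      hence "D.unit s" using s(1) unfolding D.unit_def by blast
      hence "D.unit (s powi k' * u')" using u'(1) by (intro D.unit_mult D.unit_power_int)
      moreover have "t powi k' * (s powi k' * u') = t powi k * u"
        unfolding ku(2)[symmetric]
          by (subst u'(2), subst s(2)) (simp add: power_int_mult_distrib mult.assoc)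
      ultimately show "k' = k" using D.exponent_unique ku(1) by blast
    qed
    show ?thesis unfolding val_f using ku by blast
  qed
  show "discrete_valuation \<iota> (val (proj_point x))" using w by (rule D.order_discrete_valuation)
  show "f \<in> val_ge (val (proj_point x)) 0 \<longleftrightarrow> (\<exists>y. (f, y) \<in> residue_graph x)"
    using D.order_local[OF w, of f] D.zero by (cases "f = 0") (auto simp: val_ge_def)
  show "f \<in> val_ge (val (proj_point x)) 1 \<longleftrightarrow> (f, 0) \<in> residue_graph x"
    using D.order_maximal[OF w, of f] D.zero by (cases "f = 0") (auto simp: val_ge_def)
qed

lemma discrete_valuation_at:
  assumes "P \<in> \<C>"
  shows "discrete_valuation \<iota> (val P)"
  using assms by (rule point_cases) (use assms valuation_at_point(1) in blast)

lemma local_ring_eq_val_ge: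
  assumes "P \<in> \<C>"
  shows "local_ring \<iota> \<xi> P = val_ge (val P) 0"
proof -
  obtain x j where x: "P = proj_point x" "x j \<noteq> 0" using assms by (rule point_cases)
  show ?thesis using valuation_at_point(2)[of x j] local_ring_iff[of x] x assms by blast
qed

text \<open>
  Evaluation of polynomials in \<open>inverse f\<close> at \<open>0\<close> is well defined: a polynomial relation for \<open>inverse f\<close>
  with non-zero constant term would be one for \<open>f\<close> with non-zero leading term, while \<open>f\<close> is
  transcendental because it has a zero at \<open>P0\<close>.
\<close>

lemma pole_in_place:
  assumes "f \<noteq> 0" "P0 \<in> \<C>" "val P0 f > 0"
  shows "\<exists>g. maximal_graph_ring \<iota> (to_ac :: 'a \<Rightarrow> 'a alg_closure) g \<and> (inverse f, 0) \<in> g"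
proof -
  interpret V: discrete_valuation \<iota> "val P0" using assms(2) by (rule discrete_valuation_at)
  define g0 where "g0 = range (\<lambda>c. (\<iota> c, to_ac c :: 'a alg_closure))"
  interpret G0: graph_ring \<iota> to_ac g0
    by unfold_locales (auto simp: g0_def simp flip: hom_add hom_mult to_ac_add to_ac_mult)
  have "graph_ring \<iota> to_ac (G0.adjoin (inverse f) 0)"
  proof (rule G0.adjoin_graph_ring)
    fix p q assume pq: "(p, q) \<in> G0.polys" "poly p (inverse f) = 0"
    have "\<forall>i. \<exists>c. poly.coeff p i = \<iota> c \<and> poly.coeff q i = to_ac c"
      using G0.polys_coeff[OF pq(1)] by (auto simp: g0_def)
    then obtain c where c: "\<And>i. poly.coeff p i = \<iota> (c i)" "\<And>i. poly.coeff q i = to_ac (c i)"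
      by metis
    define N where "N = Polynomial.degree p"
    have "0 = f ^ N * poly p (inverse f)" using pq(2) by simp
    also have "\<dots> = (\<Sum>i\<le>N. \<iota> (c i) * f ^ (N - i))"
      unfolding poly_altdef N_def[symmetric] sum_distrib_left
    proof (rule sum.cong)
      fix i assume "i \<in> {..N}"
      hence "f ^ N = f ^ (N - i) * f ^ i" by (simp flip: power_add)
      thus "f ^ N * (poly.coeff p i * inverse f ^ i) = \<iota> (c i) * f ^ (N - i)"
        using assms(1) by (simp add: c field_simps)
    qed simp
    also have "\<dots> = (\<Sum>i\<le>N. \<iota> (c (N - i)) * f ^ i)"
      by (rule sum.reindex_bij_witness[of _ "\<lambda>i. N - i" "\<lambda>i. N - i"]) auto
    finally have "(\<Sum>i\<le>N. \<iota> (c (N - i)) * f ^ i) = 0" by simp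
    hence "c 0 = 0" using V.poly_nonzero[of f N N "\<lambda>i. c (N - i)"] assms by auto
    thus "poly q 0 = 0" by (simp add: poly_0_coeff_0 c)
  qed
  then obtain g where "G0.adjoin (inverse f) 0 \<subseteq> g" "maximal_graph_ring \<iota> (to_ac :: 'a \<Rightarrow> 'a alg_closure) g"
    using maximal_graph_ring_exists by blast
  thus ?thesis using G0.in_adjoin by blast
qed

text \<open>
  A valuation ring orders the coordinates by divisibility, and finitely many of them have a divisor
  among them.
\<close>

lemma dominating_coordinate:
  assumes "maximal_graph_ring \<iota> \<kappa> g" "finite A" "A \<noteq> {}" "\<And>i. i \<in> A \<Longrightarrow> \<xi> i \<noteq> 0"
  shows "\<exists>j\<in>A. \<forall>i\<in>A. \<exists>y. (\<xi> i / \<xi> j, y) \<in> g"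
  using assms(2-)
proof (induction A rule: finite_ne_induct)
  case (singleton j)
  interpret maximal_graph_ring \<iota> \<kappa> g by fact
  show ?case using one singleton by auto
next
  case (insert k A)
  interpret maximal_graph_ring \<iota> \<kappa> g by fact
  obtain j where j: "j \<in> A" "\<forall>i\<in>A. \<exists>y. (\<xi> i / \<xi> j, y) \<in> g"
    using insert by auto
  have nz: "\<xi> j \<noteq> 0" "\<xi> k \<noteq> 0" using insert.prems j by auto
  have "(\<exists>y. (\<xi> k / \<xi> j, y) \<in> g) \<or> (inverse (\<xi> k / \<xi> j), 0) \<in> g"
    using nz by (intro valuation_ring) auto
  thus ?case
  proof
    assume "\<exists>y. (\<xi> k / \<xi> j, y) \<in> g"
    with j show ?thesis by auto
  next
    assume k: "(inverse (\<xi> k / \<xi> j), 0) \<in> g"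
    have "\<exists>y. (\<xi> i / \<xi> k, y) \<in> g" if i: "i \<in> insert k A" for i
    proof (cases "i = k")
      case True
      thus ?thesis using one nz by auto
    next
      case False
      then obtain y where y: "(\<xi> i / \<xi> j, y) \<in> g" using i j by auto
      have "\<xi> i / \<xi> j * inverse (\<xi> k / \<xi> j) = \<xi> i / \<xi> k" using nz
        by (simp add: field_simps)
      with ideal_mult[OF y k] show ?thesis by auto
    qed
    thus ?thesis by blast
  qed
qed

text \<open>
  Divide the generic coordinates by the one that makes all quotients finite, and take the values of
  the quotients as the coordinates of the centre \<open>x\<close>.  The forms that define the curve vanish at the
  generic point, hence at \<open>x\<close>.
\<close>

lemma center_of_place:
  assumes "maximal_graph_ring \<iota> (to_ac :: 'a \<Rightarrow> 'a alg_closure) g"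
  shows "\<exists>x j. proj_point x \<in> \<C> \<and> x j \<noteq> 0 \<and> residue_graph x \<subseteq> g"
proof -
  interpret M: maximal_graph_ring \<iota> to_ac g by fact
  have "{i. \<xi> i \<noteq> 0} \<noteq> {}" using generic_coordinate by auto
  hence "\<exists>j\<in>{i. \<xi> i \<noteq> 0}. \<forall>i\<in>{i. \<xi> i \<noteq> 0}. \<exists>y. (\<xi> i / \<xi> j, y) \<in> g"
    by (intro dominating_coordinate[OF assms]) auto
  then obtain j where j: "\<xi> j \<noteq> 0" "\<forall>i\<in>{i. \<xi> i \<noteq> 0}. \<exists>y. (\<xi> i / \<xi> j, y) \<in> g" by blast
  have "\<exists>y. (\<xi> i / \<xi> j, y) \<in> g" for i
  proof (cases "\<xi> i = 0")
    case True
    thus ?thesis using M.zero by (intro exI[of _ 0]) simp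
  qed (use j(2) in blast)
  hence "\<forall>i. \<exists>y. (\<xi> i / \<xi> j, y) \<in> g" by blast
  from choice[OF this] obtain x where x: "\<And>i. (\<xi> i / \<xi> j, x i) \<in> g" by blast
  have "(1, x j) \<in> g" using x[of j] j(1) by simp
  from M.unique[OF this M.one] have xj: "x j = 1" .
  define \<eta> where "\<eta> i = inverse (\<xi> j) * \<xi> i" for i
  have eval: "(inverse (\<xi> j) ^ d * mpoly_eval \<iota> G \<xi>, mpoly_eval to_ac G x) \<in> g" if "homogeneous d G" for d G
  proof -
    have "(mpoly_eval \<iota> G \<eta>, mpoly_eval to_ac G x) \<in> g"
      using x by (intro M.mpoly_eval_pair) (simp add: \<eta>_def divide_inverse mult.commute)
    thus ?thesis unfolding \<eta>_def mpoly_eval_scale[OF that] .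
  qed
  obtain S where S: "\<And>G. G \<in> S \<Longrightarrow> \<exists>d. homogeneous d G"
    "\<C> = {P \<in> proj_space. \<forall>G\<in>S. vanishes_at (to_ac :: 'a \<Rightarrow> 'a alg_closure) G P}"
    using curve unfolding nonsingular_projective_curve_def proj_algebraic_set_def by blast
  have "proj_point x \<in> \<C>" unfolding S(2)
  proof (intro CollectI conjI ballI)
    show "proj_point x \<in> proj_space" using xj unfolding proj_space_def by force
    fix G assume G: "G \<in> S"
    then obtain d where d: "homogeneous d G" using S(1) by blast
    have "mpoly_eval \<iota> G \<xi> = 0" using form_zero_iff[OF d] G S(2) by blast
    hence "(0, mpoly_eval to_ac G x) \<in> g" using eval[OF d] by simp
    hence "mpoly_eval to_ac G x = 0" by (rule M.functional)
    thus "vanishes_at to_ac G (proj_point x)" using vanishes_at_proj_point[OF d] by blast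
  qed
  moreover have "residue_graph x \<subseteq> g"
  proof safe
    fix f y assume "(f, y) \<in> residue_graph x"
    then obtain d G H where *: "homogeneous d G" "homogeneous d H" "mpoly_eval to_ac H x \<noteq> 0"
      "f = mpoly_eval \<iota> G \<xi> / mpoly_eval \<iota> H \<xi>" "y = mpoly_eval to_ac G x / mpoly_eval to_ac H x"
      by (rule residue_graphE)
    have "(inverse (\<xi> j) ^ d * mpoly_eval \<iota> G \<xi> * inverse (inverse (\<xi> j) ^ d * mpoly_eval \<iota> H \<xi>),
        mpoly_eval to_ac G x * inverse (mpoly_eval to_ac H x)) \<in> g"
      by (rule M.mult[OF eval[OF *(1)] M.inverse[OF eval[OF *(2)] *(3)]])
    thus "(f, y) \<in> g" using j(1) unfolding *(4,5) by (simp add: divide_inverse mult_ac)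
  qed
  ultimately show ?thesis using xj by (intro exI[of _ x] exI[of _ j]) simp
qed

text \<open>
  At the centre of a place with value \<open>0\<close> at \<open>inverse f\<close>, the function \<open>f\<close> cannot be regular, since
  then \<open>1 = f * inverse f\<close> would have residue \<open>0\<close>.
\<close>

lemma no_zeros_without_poles:
  assumes "f \<noteq> 0" "\<forall>P\<in>\<C>. val P f \<ge> 0" "P0 \<in> \<C>"
  shows "val P0 f = 0"
proof (rule ccontr)
  assume "val P0 f \<noteq> 0"
  with assms have "val P0 f > 0" by force
  then obtain g where g: "maximal_graph_ring \<iota> (to_ac :: 'a \<Rightarrow> 'a alg_closure) g" "(inverse f, 0) \<in> g"
    using pole_in_place assms by blast
  interpret M: maximal_graph_ring \<iota> to_ac g by fact
  obtain x j where x: "proj_point x \<in> \<C>" "x j \<noteq> 0" "residue_graph x \<subseteq> g"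
    using center_of_place[OF g(1)] by blast
  have "f \<in> val_ge (val (proj_point x)) 0" using assms x by (auto simp: val_ge_def)
  then obtain y where "(f, y) \<in> g" using valuation_at_point(2)[OF x(1,2)] x(3) by blast
  from M.ideal_mult[OF this g(2)] have "(1, 0) \<in> g" using assms(1) by simp
  with M.unique[OF M.one] show False by force
qed

text \<open>
  At a point with coordinates in the ground field, fractions of forms over the ground field take values
  in the ground field.
\<close>

lemma rational_residue:
  assumes "P \<in> \<C>" "rational_point P" "f \<in> val_ge (val P) 0"
  shows "\<exists>c. f - \<iota> c \<in> val_ge (val P) 1"
proof -
  obtain q where q: "q \<noteq> (\<lambda>_. 0)" "P = proj_point (\<lambda>j. to_ac (q j))"
    using assms(2) unfolding rational_point_def by blast
  define x where "x = (\<lambda>j. to_ac (q j))"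
  obtain j where "q j \<noteq> 0" using q(1) by auto
  hence x: "proj_point x \<in> \<C>" "x j \<noteq> 0" using assms(1) q by (auto simp: x_def)
  interpret G: graph_ring \<iota> to_ac "residue_graph x" by (rule residue_graph_ring[OF x(1)])
  have ev: "mpoly_eval to_ac G x = to_ac (mpoly_eval id G q)" for G
    by (simp add: mpoly_eval_def x_def to_ac_sum to_ac_prod)
  obtain y where y: "(f, y) \<in> residue_graph x"
    using assms(3) valuation_at_point(2)[OF x] unfolding x_def q(2) by blast
  then obtain d G H where "y = mpoly_eval to_ac G x / mpoly_eval to_ac H x" by (rule residue_graphE)
  hence "y = to_ac (mpoly_eval id G q / mpoly_eval id H q)" by (simp add: ev)
  then obtain c where c: "y = to_ac c" by blast
  have "(f - \<iota> c, 0) \<in> residue_graph x" using G.diff[OF y G.const[of c]] by (simp add: c)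
  thus ?thesis using valuation_at_point(3)[OF x] unfolding x_def q(2) by blast
qed

text \<open>
  Some linear form over the ground field vanishes at the rational point \<open>P'\<close> but not at \<open>P\<close>.
  Dividing a coordinate that is non-zero at \<open>P'\<close> by it gives a function that is regular at \<open>P\<close> and has
  a pole at \<open>P'\<close>.
\<close>

lemma rational_separated:
  assumes "P \<in> \<C>" "P' \<in> \<C>" "rational_point P'" "P \<noteq> P'"
  shows "\<exists>f. f \<noteq> 0 \<and> val P f \<noteq> val P' f"
proof -
  obtain q where q: "q \<noteq> (\<lambda>_. 0)" "P' = proj_point (\<lambda>j. to_ac (q j))"
    using assms(3) unfolding rational_point_def by blast
  define x' where "x' = (\<lambda>j. to_ac (q j))"
  obtain i where i: "q i \<noteq> 0" using q(1) by auto
  hence x': "proj_point x' \<in> \<C>" "x' i \<noteq> 0" using assms(2) q by (auto simp: x'_def)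
  obtain x k where x: "P = proj_point x" "x k \<noteq> 0" using assms(1) by (rule point_cases)
  have xC: "proj_point x \<in> \<C>" using x assms(1) by simp
  have "\<exists>j. to_ac (q i) * x j - to_ac (q j) * x i \<noteq> 0"
  proof (rule ccontr)
    assume "\<not> ?thesis"
    hence proportional: "x j = (x i / to_ac (q i)) * x' j" for j using i by (simp add: x'_def field_simps)
    hence c: "x i / to_ac (q i) \<noteq> 0" using x(2) by (metis mult_zero_left)
    have "x = (\<lambda>j. (x i / to_ac (q i)) * x' j)" by (rule ext) (rule proportional)
    moreover have "proj_point (\<lambda>j. (x i / to_ac (q i)) * x' j) = proj_point x'"
      using c by (rule proj_point_scale)
    ultimately have "P = P'" unfolding x(1) q(2) x'_def[symmetric] by (simp only:)
    with assms(4) show False by simp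
  qed
  then obtain j where j: "to_ac (q i) * x j - to_ac (q j) * x i \<noteq> 0" by blast
  define F :: "('n, 'a) mpoly" where "F = const_form (q i) * coord j + const_form (- q j) * coord i"
  have F: "homogeneous 1 F" unfolding F_def
    using homogeneous_mult[OF homogeneous_const_form homogeneous_coord] by (intro homogeneous_add) simp_all
  have ev: "mpoly_eval to_ac F x \<noteq> 0" "mpoly_eval to_ac F x' = 0"
    using j by (simp_all add: F_def ac.mpoly_eval_add ac.mpoly_eval_mult x'_def)
  define f where "f = \<xi> i / mpoly_eval \<iota> F \<xi>"
  have "(f, x i / mpoly_eval to_ac F x) \<in> residue_graph x"
    using residue_graphI[OF homogeneous_coord F ev(1), of i] by (simp add: f_def)
  hence 1: "f \<in> val_ge (val P) 0" using valuation_at_point(2)[OF xC x(2)] x(1) by blast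
  have "(inverse f, 0) \<in> residue_graph x'"
    using residue_graphI[OF F homogeneous_coord, of i x'] x'(2) ev(2) by (simp add: f_def)
  hence 2: "inverse f \<in> val_ge (val P') 1"
    using valuation_at_point(3)[OF x'] unfolding x'_def q(2) by blast
  have "\<xi> i \<noteq> 0" using form_nonzero[OF x'(1) homogeneous_coord, of i] x'(2) by simp
  moreover have "mpoly_eval \<iota> F \<xi> \<noteq> 0" using form_nonzero[OF xC F ev(1)] .
  ultimately have f: "f \<noteq> 0" by (simp add: f_def)
  interpret V': discrete_valuation \<iota> "val P'" using assms(2) by (rule discrete_valuation_at)
  have "val P f \<ge> 0" "val P' f < 0" using 1 2 f by (auto simp: val_ge_def V'.val_inverse)
  thus ?thesis using f by (intro exI[of _ f]) auto
qed

end

theorem corollary3p6: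
  fixes \<C> :: "('n::finite, 'a::{field,finite}) point set"
    and \<iota> :: "'a \<Rightarrow> 'k::field" and \<xi> :: "'n \<Rightarrow> 'k"
    and Q :: "'m::finite \<Rightarrow> ('n, 'a) point"
  assumes "nonsingular_projective_curve \<C> \<iota> \<xi>"
    and "CARD('m) \<ge> 2"
    and "inj Q"
    and "\<forall>i. Q i \<in> \<C> \<and> rational_point (Q i)"
    and "CARD('a) \<ge> CARD('m)"
  shows "(\<forall>\<alpha> i.
            finite (Gamma_classes \<C> \<iota> \<xi> Q \<alpha> i) \<and>
            card (Gamma_classes \<C> \<iota> \<xi> Q \<alpha> i) =
              vector_space.dim (scale \<iota>) (riemann_roch_space \<C> \<iota> \<xi> (divisor Q \<alpha>)) \<and>
            (\<forall>B. class_preimage \<C> \<iota> \<xi> Q \<alpha> i B \<longrightarrow>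
                   basis_of \<iota> B (riemann_roch_space \<C> \<iota> \<xi> (divisor Q \<alpha>)))) \<and>
         module.span (scale \<iota>)
           {f \<in> regular_functions \<C> \<iota> \<xi> Q - {0}. rho \<iota> \<xi> Q f \<in> Gamma \<C> \<iota> \<xi> Q} =
           regular_functions \<C> \<iota> \<xi> Q \<and>
         (\<nexists>B. finite B \<and> module.span (scale \<iota>) B = regular_functions \<C> \<iota> \<xi> Q)"
proof -
  interpret finite_proj_curve \<C> \<iota> \<xi> by unfold_locales fact
  interpret pole_orders \<iota> \<C> "valuation \<iota> \<xi>" Q
  proof (intro pole_orders.intro valuations.intro pole_orders_axioms.intro valuations_axioms.intro
      field_hom_axioms)
    show "\<exists>x. x \<noteq> 0 \<and> val P x \<noteq> val (Q i) x" if "P \<in> \<C>" "P \<noteq> Q i" for P i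
      using rational_separated that assms(4) by blast
    show "\<exists>c. f - \<iota> c \<in> val_ge (val (Q i)) 1" if "f \<in> val_ge (val (Q i)) 0" for f i
      using assms(4) that by (intro rational_residue) auto
    show "\<exists>d. \<forall>u. poly_dep \<iota> y u d" for y by (rule finite_rank)
    show "val P f = 0" if "f \<noteq> 0" "\<forall>P\<in>\<C>. 0 \<le> val P f" "P \<in> \<C>" for f P
      using that by (rule no_zeros_without_poles)
  qed (use discrete_valuation_at assms(4) in auto)
  have reg_eq: "regular_functions \<C> \<iota> \<xi> Q = reg"
    unfolding regular_functions_def reg_def using local_ring_eq_val_ge by blast
  have rho_eq: "rho \<iota> \<xi> Q = \<rho>" by (simp add: rho_def \<rho>_def fun_eq_iff)
  have H_eq: "generalized_semigroup \<C> \<iota> \<xi> Q = H"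
    by (simp add: generalized_semigroup_def H_def reg_eq rho_eq)
  have Gamma_eq: "Gamma \<C> \<iota> \<xi> Q = absolute_maximal H" by (simp add: Gamma_def H_eq)
  have classes_eq: "Gamma_classes \<C> \<iota> \<xi> Q \<alpha> i = max_classes \<alpha> i" for \<alpha> i
    by (simp add: Gamma_classes_def max_classes_def Gamma_eq)
  have L_eq: "riemann_roch_space \<C> \<iota> \<xi> (divisor Q \<alpha>) = L \<alpha>" for \<alpha>
  proof -
    have Q: "divisor Q \<alpha> (Q i) = \<alpha> i" for i
    proof -
      have "{j. Q j = Q i} = {i}" using assms(3) by (auto simp: inj_on_def)
      thus ?thesis by (simp add: divisor_def)
    qed
    have out: "divisor Q \<alpha> P = 0" if "P \<notin> range Q" for P
      unfolding divisor_def using that by (intro sum.neutral) auto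
    have "(\<forall>P\<in>\<C>. val P f + divisor Q \<alpha> P \<ge> 0) \<longleftrightarrow>
        (\<forall>P\<in>\<C> - range Q. val P f \<ge> 0) \<and> (\<forall>i. val (Q i) f \<ge> - \<alpha> i)" (is "?l \<longleftrightarrow> ?r") for f
    proof
      assume l: ?l
      have "val (Q i) f \<ge> - \<alpha> i" for i using l Q_in[of i] Q[of i] by force
      moreover have "val P f \<ge> 0" if "P \<in> \<C> - range Q" for P using l out[of P] that by force
      ultimately show ?r by blast
    next
      assume r: ?r
      show ?l
      proof
        fix P assume P: "P \<in> \<C>"
        show "val P f + divisor Q \<alpha> P \<ge> 0"
        proof (cases "P \<in> range Q")
          case True
          then obtain i where i: "P = Q i" by blast
          have "val (Q i) f \<ge> - \<alpha> i" using r by blast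
          thus ?thesis unfolding i Q by simp
        next
          case False
          thus ?thesis using r P out[OF False] by simp
        qed
      qed
    qed
    thus ?thesis unfolding riemann_roch_space_def L_def reg_def val_ge_def by auto
  qed
  show ?thesis
    unfolding reg_eq rho_eq Gamma_eq classes_eq L_eq
  proof (intro conjI allI impI span_absolute_maximal reg_not_finitely_spanned)
    fix \<alpha> i
    obtain \<phi> where "\<forall>K\<in>max_classes \<alpha> i. \<phi> K \<in> reg - {0} \<and> \<rho> (\<phi> K) \<in> K"
      using class_choice_exists by blast
    thus "finite (max_classes \<alpha> i)" by (rule class_choice(4))
    show "card (max_classes \<alpha> i) = vs.dim (L \<alpha>)" by (rule card_classes)
    fix B assume "class_preimage \<C> \<iota> \<xi> Q \<alpha> i B"
    then obtain \<phi> where \<phi>: "\<forall>K\<in>max_classes \<alpha> i. \<phi> K \<in> reg - {0} \<and> \<rho> (\<phi> K) \<in> K"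
      and B: "B = \<phi> ` max_classes \<alpha> i"
      unfolding class_preimage_def classes_eq reg_eq rho_eq by blast
    show "basis_of \<iota> B (L \<alpha>)"
      unfolding basis_of_def B using class_choice(2,3)[OF \<phi>] by blast
  qed
qed

end
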